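(* For $i=0,1,\dots,k$ let $\mu_i$ be a probability measure on $([0,1],\mathcal{B})$ and $T_i:[0,1]\to[0,1]$ a $\mu_i$-preserving ergodic transformation such that (1) for each $i=0,\dots,k$ there is a partition $\mathcal{A}_i$ with $(T_i,\mu_i,\mathcal{A}_i)\in\mathcal{T}$; (2) for $i=1,\dots,k$, $(T_i,\mu_i,\mathcal{A}_i)$ has property B; (3) $0\le h(T_0)<h(T_1)<\cdots<h(T_k)<\infty$, where $h(T_i)$ is the Kolmogorov–Sinai entropy of $T_i$ with respect to $\mu_i$. Suppose that $T_0\times T_1\times\cdots\times T_k$ is ergodic with respect to $\mu_0\times\cdots\times\mu_k$. Then for every probability measure $\nu$ equivalent to Lebesgue measure $\lambda$ and all $f_0,\dots,f_k\in L^\infty$, $\lim_{N-M\to\infty}\frac{1}{N-M}\sum_{n=M}^{N-1}T_0^nf_0\cdot T_1^nf_1\cdots T_k^nf_k=\prod_{i=0}^k\int f_i\,d\mu_i$ in $L^2(\nu)$.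
   Context: $T^nf:=f\circ T^n$; $\lim_{N-M\to\infty}$ means convergence uniformly over all pairs $0\le M<N$ as $N-M\to\infty$. Let $X=[0,1]$, $\mathcal{B}$ Borel, $\lambda$ Lebesgue. A partition of $[0,1]$ is a finite or countable family of intervals with nonempty pairwise disjoint interiors covering $[0,1]$ up to a $\lambda$-null set. The class $\mathcal{T}$ consists of triples $(T,\mu,\mathcal{A})$ where $\mu$ is a Borel probability measure with $\frac1c\mu\le\lambda\le c\mu$ for some $c\ge1$, $T:[0,1]\to[0,1]$ is $\mu$-preserving and ergodic, and $\mathcal{A}$ is a partition such that $T|_{\mathrm{int}(I)}$ is continuous and strictly monotone for each $I\in\mathcal{A}$, $\bigvee_{j\ge0}T^{-j}\sigma(\mathcal{A})=\mathcal{B}$ mod $\lambda$, and $-\sum_{I\in\mathcal{A}}\mu(I)\log\mu(I)<\infty$. Write $\mathcal{A}^l=\bigvee_{j=0}^{l-1}T^{-j}\mathcal{A}$. $(T,\mu,\mathcal{A})\in\mathcal{T}$ has property B if there exist $c>0$ and positive reals $b_n\to0$ such that for every $l\in\mathbb{N}$, every integer $n\ge0$, every $A\in\sigma(\mathcal{A}^l)$ and every $B\in\mathcal{B}$: $\mu(A\cap T^{-(n+l)}B)\le c\mu(A)\mu(B)+b_n$. *)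

theory Defs
  imports "HOL-Probability.Probability"
begin

definition UI :: "real set" where "UI = {0..1}"

definition lam :: "real measure" where "lam = restrict_space lborel UI"

definition unit_prob :: "real measure \<Rightarrow> bool" where
  "unit_prob \<mu> \<longleftrightarrow> prob_space \<mu> \<and> sets \<mu> = sets lam"

definition mpt :: "'a measure \<Rightarrow> ('a \<Rightarrow> 'a) \<Rightarrow> bool" where
  "mpt M T \<longleftrightarrow> T \<in> measurable M M \<and> distr M M T = M"

definition ergodic :: "'a measure \<Rightarrow> ('a \<Rightarrow> 'a) \<Rightarrow> bool" where
  "ergodic M T \<longleftrightarrow> mpt M T \<and>
     (\<forall>A\<in>sets M. T -` A \<inter> space M = A \<longrightarrow> measure M A = 0 \<or> measure M A = 1)"

definition interval_partition :: "real set set \<Rightarrow> bool" where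
  "interval_partition \<A> \<longleftrightarrow> countable \<A> \<and>
     (\<forall>I\<in>\<A>. is_interval I \<and> I \<subseteq> UI \<and> interior I \<noteq> {}) \<and>
     (\<forall>I\<in>\<A>. \<forall>J\<in>\<A>. I \<noteq> J \<longrightarrow> interior I \<inter> interior J = {}) \<and>
     emeasure lam (UI - \<Union>\<A>) = 0"

definition join_cells :: "(real \<Rightarrow> real) \<Rightarrow> real set set \<Rightarrow> nat \<Rightarrow> real set set" where
  "join_cells T \<A> l = {UI \<inter> (\<Inter>j<l. (T ^^ j) -` P j) | P. \<forall>j<l. P j \<in> \<A>}"

definition class_T :: "(real \<Rightarrow> real) \<Rightarrow> real measure \<Rightarrow> real set set \<Rightarrow> bool" where
  "class_T T \<mu> \<A> \<longleftrightarrow>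
     unit_prob \<mu> \<and>
     (\<exists>c\<ge>1. \<forall>A\<in>sets lam. measure \<mu> A / c \<le> measure lam A \<and> measure lam A \<le> c * measure \<mu> A) \<and>
     T ` UI \<subseteq> UI \<and> mpt \<mu> T \<and> ergodic \<mu> T \<and>
     interval_partition \<A> \<and>
     (\<forall>I\<in>\<A>. continuous_on (interior I) T \<and>
        (strict_mono_on (interior I) T \<or> monotone_on (interior I) (<) (>) T)) \<and>
     (\<forall>B\<in>sets lam. \<exists>C\<in>sigma_sets UI {(T ^^ j) -` I \<inter> UI | I j. I \<in> \<A>}.
        emeasure lam ((B - C) \<union> (C - B)) = 0) \<and>
     (\<lambda>I. - measure \<mu> I * ln (measure \<mu> I)) summable_on \<A>"

definition property_B :: "(real \<Rightarrow> real) \<Rightarrow> real measure \<Rightarrow> real set set \<Rightarrow> bool" where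
  "property_B T \<mu> \<A> \<longleftrightarrow>
     (\<exists>c>0. \<exists>b::nat \<Rightarrow> real. (\<forall>n. b n > 0) \<and> b \<longlonglongrightarrow> 0 \<and>
        (\<forall>l\<ge>1. \<forall>n. \<forall>A\<in>sigma_sets UI (join_cells T \<A> l). \<forall>B\<in>sets lam.
           measure \<mu> (A \<inter> ((T ^^ (n + l)) -` B \<inter> UI)) \<le> c * measure \<mu> A * measure \<mu> B + b n))"

text \<open>Kolmogorov--Sinai entropy. A finite measurable partition is encoded by a measurable
  function with finite range (its level sets are the partition elements).\<close>
definition part_entropy :: "'a measure \<Rightarrow> ('a \<Rightarrow> 'b) \<Rightarrow> real" where
  "part_entropy M \<xi> = - (\<Sum>y\<in>\<xi> ` space M.
      measure M (\<xi> -` {y} \<inter> space M) * ln (measure M (\<xi> -` {y} \<inter> space M)))"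

definition entropy_rel :: "'a measure \<Rightarrow> ('a \<Rightarrow> 'a) \<Rightarrow> ('a \<Rightarrow> nat) \<Rightarrow> real" where
  "entropy_rel M T \<xi> =
     lim (\<lambda>n. part_entropy M (\<lambda>x. map (\<lambda>j. \<xi> ((T ^^ j) x)) [0..<n]) / real n)"

definition ks_entropy :: "'a measure \<Rightarrow> ('a \<Rightarrow> 'a) \<Rightarrow> ereal" where
  "ks_entropy M T = (SUP \<xi> \<in> {\<xi>. \<xi> \<in> M \<rightarrow>\<^sub>M count_space UNIV \<and> finite (\<xi> ` space M)}.
      ereal (entropy_rel M T \<xi>))"

definition Linf :: "(real \<Rightarrow> real) \<Rightarrow> bool" where
  "Linf f \<longleftrightarrow> f \<in> borel_measurable lam \<and> (\<exists>C. AE x in lam. \<bar>f x\<bar> \<le> C)"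

end

theory Submission
  imports Defs
begin

text \<open>Let \<open>S = T\<^sub>0 \<times> \<dots> \<times> T\<^sub>k\<close> and let \<open>P\<close> be the product measure. The key estimate is
  \<open>limsup \<lambda>(\<Inter>i. T\<^sub>i\<^sup>-\<^sup>n B\<^sub>i) \<le> C * (\<Prod>i. \<mu>\<^sub>i B\<^sub>i)\<close>, proved by induction on the number of maps. Up to a small
  set, \<open>T\<^sub>0\<^sup>-\<^sup>n B\<^sub>0 \<inter> \<dots> \<inter> T\<^sub>j\<^sup>-\<^sup>n B\<^sub>j\<close> is a union of at most \<open>exp (n h)\<close> intervals for any \<open>h > h(T\<^sub>j)\<close>.
  Because \<open>h(T\<^sub>j) < h(T\<^sub>j\<^sub>+\<^sub>1)\<close>, most cells of order \<open>n - m\<close> of \<open>T\<^sub>j\<^sub>+\<^sub>1\<close> are intervals too short to be cut by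
  more than a negligible part of the end points, so this union is nearly a union of such cells and
  property B bounds its intersection with \<open>T\<^sub>j\<^sub>+\<^sub>1\<^sup>-\<^sup>n B\<^sub>j\<^sub>+\<^sub>1\<close>.
  The cell sizes come from the Shannon--McMillan theorem in probability, which is derived from
  Gibbs' inequality applied to explicit weights on words.

  For the \<open>L\<^sup>2\<close> statement, replace the products \<open>u\<^sub>n\<close> by their averages over windows of a fixed
  length \<open>L\<close>. The square of such an average minus the limit is \<open>G\<^sub>L\<close> evaluated along the orbit of the
  diagonal under \<open>S\<close>, so by the key estimate its integral is asymptotically at most
  \<open>C * \<integral>G\<^sub>L dP\<close>, which tends to 0 as \<open>L\<close> grows by the mean ergodic theorem for \<open>S\<close>.\<close>

section \<open>Birkhoff's theorem for bounded functions\<close>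

text \<open>A set defined by \<open>T\<^sub>0, ..., T\<^sub>j\<close> bears no relation to the
  partition of \<open>T\<^sub>j\<^sub>+\<^sub>1\<close>, whereas property B constrains the past only
  through sets built from that partition. Intervals mediate between the two: branches are monotone,
  so cells of every map are intervals. The induction therefore carries a family of few intervals
  along with the measure bound. For \<open>T\<^sub>0\<close> invariance of its measure takes the
  place of property B. The error in property B is additive and vanishes only as the gap grows, so a
  gap of \<open>m\<close> letters, fixed before \<open>n\<close>, is left between the cells and time
  \<open>n\<close>.

  The constant \<open>C\<close> may exceed 1, so the key estimate cannot identify the limit. It only
  carries smallness from the product measure to the diagonal; the value of the limit comes from
  ergodicity of the product.

  Entropy is a supremum over finite partitions, while the interval partition may be countable. Both
  comparisons are made by coding, as any weight of total mass at most 1 on words bounds an entropy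
  from above.

  Lebesgue measure is kept until the end because it is comparable to every invariant measure up to
  constants, which the final measure need not be.\<close>

locale mps = prob_space M for M :: "'a measure" +
  fixes T :: "'a \<Rightarrow> 'a"
  assumes mpt: "mpt M T"
begin

lemma measurable_T [measurable]: "T \<in> measurable M M"
  using mpt by (simp add: mpt_def)

lemma measurable_iter [measurable]: "T ^^ n \<in> measurable M M"
  by (induction n) (auto intro: measurable_comp measurable_T)

lemma iter_space: "x \<in> space M \<Longrightarrow> (T ^^ n) x \<in> space M"
  using measurable_iter by (auto simp: measurable_def)

lemma distr_iter: "distr M M (T ^^ n) = M"
proof (induction n)
  case (Suc n)
  have "distr M M (T ^^ Suc n) = distr (distr M M (T ^^ n)) M T"
    by (simp add: distr_distr)
  also have "\<dots> = M" using Suc mpt by (simp add: mpt_def)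
  finally show ?case .
qed (simp add: distr_id)

lemma measure_iter: "A \<in> sets M \<Longrightarrow> measure M ((T ^^ n) -` A \<inter> space M) = measure M A"
  using measure_distr[OF measurable_iter, of A n] by (simp add: distr_iter)

lemma integrable_iter:
  fixes f :: "'a \<Rightarrow> real"
  shows "integrable M f \<Longrightarrow> integrable M (\<lambda>x. f ((T ^^ n) x))"
  using integrable_distr[OF measurable_iter, of n f] by (simp add: distr_iter)

lemma integral_iter:
  fixes f :: "'a \<Rightarrow> real"
  shows "f \<in> borel_measurable M \<Longrightarrow> (\<integral>x. f ((T ^^ n) x) \<partial>M) = integral\<^sup>L M f"
  using integral_distr[OF measurable_iter, of f n] by (simp add: distr_iter)

lemma AE_iter: "AE x in M. P x \<Longrightarrow> AE x in M. P ((T ^^ n) x)"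
  using AE_distrD[OF measurable_iter[of n], where P=P] unfolding distr_iter by blast

lemma AE_all_iter: "AE x in M. P x \<Longrightarrow> AE x in M. \<forall>n. P ((T ^^ n) x)"
  by (simp add: AE_all_countable AE_iter)

end

definition birkhoff_sum :: "('a \<Rightarrow> 'a) \<Rightarrow> ('a \<Rightarrow> real) \<Rightarrow> nat \<Rightarrow> 'a \<Rightarrow> real" where
  "birkhoff_sum T f n x = (\<Sum>j<n. f ((T ^^ j) x))"

lemma birkhoff_sum_Suc: "birkhoff_sum T f (Suc n) x = f x + birkhoff_sum T f n (T x)"
  unfolding birkhoff_sum_def by (subst sum.lessThan_Suc_shift) (simp add: funpow_swap1)

lemma (in mps) borel_measurable_birkhoff_sum [measurable (raw)]:
  "f \<in> borel_measurable M \<Longrightarrow> birkhoff_sum T f n \<in> borel_measurable M"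
  unfolding birkhoff_sum_def by (intro borel_measurable_sum measurable_compose[OF measurable_iter])

text \<open>Maximal ergodic inequality by Garsia's argument: with \<open>m\<close> the maximum of
  the partial sums, \<open>j = 0\<close> included, \<open>f\<close> dominates
  \<open>m - m \<circ> T\<close> where some sum is positive, and elsewhere
  \<open>m = 0 \<le> m \<circ> T\<close>. The integral of \<open>m - m \<circ> T\<close> vanishes by
  invariance.\<close>

lemma (in mps) garsia:
  fixes f :: "'a \<Rightarrow> real"
  assumes f: "f \<in> borel_measurable M" and bd: "\<And>x. x \<in> space M \<Longrightarrow> \<bar>f x\<bar> \<le> C"
  shows "0 \<le> (\<integral>x. f x * indicator {x\<in>space M. \<exists>j\<le>n. birkhoff_sum T f j x > 0} x \<partial>M)"
proof -
  define m where "m = (\<lambda>x. Max ((\<lambda>j. birkhoff_sum T f j x) ` {..n}))"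
  have C: "0 \<le> C" using bd not_empty by fastforce
  note [measurable] = f
  have m_meas[measurable]: "m \<in> borel_measurable M"
    unfolding m_def by measurable
  have m0: "m x \<ge> 0" for x
    unfolding m_def by (rule Max_ge_iff[THEN iffD2]) (auto simp: birkhoff_sum_def intro!: bexI[of _ 0])
  have bb: "\<bar>birkhoff_sum T f j x\<bar> \<le> real n * C" if "x \<in> space M" "j \<le> n" for x j
  proof -
    have "\<bar>birkhoff_sum T f j x\<bar> \<le> (\<Sum>i<j. C)" unfolding birkhoff_sum_def
      by (rule order.trans[OF sum_abs]) (intro sum_mono bd iter_space that)
    also have "\<dots> \<le> real n * C" using that C by (auto intro: mult_right_mono)
    finally show ?thesis .
  qed
  have mb: "\<bar>m x\<bar> \<le> real n * C" if "x \<in> space M" for x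
  proof -
    have "m x \<in> (\<lambda>j. birkhoff_sum T f j x) ` {..n}" unfolding m_def by (rule Max_in) auto
    then show ?thesis using bb[OF that] by auto
  qed
  have im: "integrable M m"
    by (rule integrable_const_bound[of _ "real n * C"]) (auto simp: mb)
  have imT: "integrable M (\<lambda>x. m (T x))" using integrable_iter[OF im, of 1] by simp
  have ifi: "integrable M (\<lambda>x. f x * indicator {x\<in>space M. \<exists>j\<le>n. birkhoff_sum T f j x > 0} x)"
    by (rule integrable_const_bound[of _ C]) (auto simp: bd C indicator_def)
  have key: "m x - m (T x) \<le> f x * indicator {x\<in>space M. \<exists>j\<le>n. birkhoff_sum T f j x > 0} x"
    if x: "x \<in> space M" for x
  proof (cases "\<exists>j\<le>n. birkhoff_sum T f j x > 0")
    case True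
    have "m x \<in> (\<lambda>j. birkhoff_sum T f j x) ` {..n}" unfolding m_def by (rule Max_in) auto
    then obtain j where j: "j \<le> n" "m x = birkhoff_sum T f j x" by auto
    have "m x > 0" using True unfolding m_def by (subst Max_gr_iff) auto
    with j obtain i where i: "j = Suc i" by (cases j) (auto simp: birkhoff_sum_def)
    have "birkhoff_sum T f i (T x) \<le> m (T x)" unfolding m_def using i j by (intro Max_ge) auto
    with i j True x show ?thesis by (simp add: birkhoff_sum_Suc)
  next
    case False
    have "m x \<le> 0" unfolding m_def using False by (subst Max_le_iff) (auto simp: not_less)
    then show ?thesis using False m0[of "T x"] by auto
  qed
  have "0 = (\<integral>x. m x - m (T x) \<partial>M)"
    using integral_iter[OF m_meas, of 1] by (simp add: Bochner_Integration.integral_diff[OF im imT])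
  also have "\<dots> \<le> (\<integral>x. f x * indicator {x\<in>space M. \<exists>j\<le>n. birkhoff_sum T f j x > 0} x \<partial>M)"
    using key by (intro integral_mono ifi Bochner_Integration.integrable_diff im imT) auto
  finally show ?thesis .
qed

locale ergodic_mps = mps +
  assumes erg: "ergodic M T"

lemma (in ergodic_mps) ergodicD:
  assumes "A \<in> sets M" "T -` A \<inter> space M = A"
  shows "measure M A = 0 \<or> measure M A = 1"
  using erg assms by (auto simp: ergodic_def)

text \<open>The limsup of the averages is invariant, so by ergodicity it exceeds \<open>r\<close>
  almost nowhere or almost everywhere, and the maximal inequality for \<open>f - r\<close> excludes
  the latter. The intermediate \<open>r\<close> turns a limsup of at most \<open>r\<close> into
  averages eventually below \<open>s\<close>.\<close>

lemma (in ergodic_mps) birkhoff_upper: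
  fixes f :: "'a \<Rightarrow> real"
  assumes f: "f \<in> borel_measurable M" and bd: "\<And>x. x \<in> space M \<Longrightarrow> \<bar>f x\<bar> \<le> C"
    and rs: "integral\<^sup>L M f < s"
  shows "AE x in M. eventually (\<lambda>n. birkhoff_sum T f n x / real n < s) sequentially"
proof -
  obtain r where r: "integral\<^sup>L M f < r" "r < s" using dense[OF rs] by auto
  note [measurable] = f
  define avg where "avg = (\<lambda>n x. birkhoff_sum T f n x / real n)"
  have [measurable]: "avg n \<in> borel_measurable M" for n unfolding avg_def by measurable
  define A where "A = {x \<in> space M. limsup (\<lambda>n. ereal (avg n x)) > ereal r}"
  have A[measurable]: "A \<in> sets M" unfolding A_def by measurable
  have C: "0 \<le> C" using bd not_empty by fastforce
  have inv: "limsup (\<lambda>n. ereal (avg n (T x))) = limsup (\<lambda>n. ereal (avg n x))" if x: "x \<in> space M" for x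
  proof -
    have eq: "avg n (T x) = avg (Suc n) x + (avg (Suc n) x - f x) / real n" if "n > 0" for n
    proof -
      have "real n * avg n (T x) = real (Suc n) * avg (Suc n) x - f x"
        using that by (simp add: avg_def birkhoff_sum_Suc)
      then show ?thesis using that by (simp add: field_simps)
    qed
    have ab: "\<bar>avg n x\<bar> \<le> C" for n
    proof -
      have "\<bar>birkhoff_sum T f n x\<bar> \<le> (\<Sum>i<n. C)" unfolding birkhoff_sum_def
        by (rule order.trans[OF sum_abs]) (intro sum_mono bd iter_space x)
      then show ?thesis using C by (cases "n = 0") (auto simp: avg_def field_simps)
    qed
    have lim0: "(\<lambda>n. (avg (Suc n) x - f x) / real n) \<longlonglongrightarrow> 0"
    proof (rule Lim_null_comparison)
      show "\<forall>\<^sub>F n in sequentially. norm ((avg (Suc n) x - f x) / real n) \<le> (2 * C) / real n"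
      proof (intro always_eventually allI)
        fix n
        have "\<bar>avg (Suc n) x - f x\<bar> \<le> 2 * C" using ab[of "Suc n"] bd[OF x] by linarith
        then show "norm ((avg (Suc n) x - f x) / real n) \<le> (2 * C) / real n"
          by (simp add: abs_divide divide_right_mono)
      qed
      show "(\<lambda>n. (2 * C) / real n) \<longlonglongrightarrow> 0" by (rule lim_const_over_n)
    qed
    have "limsup (\<lambda>n. ereal (avg n (T x))) = limsup (\<lambda>n. ereal ((avg (Suc n) x - f x) / real n) + ereal (avg (Suc n) x))"
      by (rule Limsup_eq) (auto intro!: eventually_sequentiallyI[of 1] simp: eq)
    also have "\<dots> = 0 + limsup (\<lambda>n. ereal (avg (Suc n) x))"
      using lim0 by (intro ereal_limsup_lim_add) (auto simp: zero_ereal_def)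
    also have "\<dots> = limsup (\<lambda>n. ereal (avg n x))"
      using limsup_shift[of "\<lambda>n. ereal (avg n x)"] by simp
    finally show ?thesis .
  qed
  have "T -` A \<inter> space M = A"
    using inv measurable_space[OF measurable_T] unfolding A_def by auto
  then have "measure M A = 0 \<or> measure M A = 1" using ergodicD[OF A] by simp
  moreover have "measure M A \<noteq> 1"
  proof
    assume A1: "measure M A = 1"
    define g where "g = (\<lambda>x. f x - r)"
    have g[measurable]: "g \<in> borel_measurable M" unfolding g_def by measurable
    have gb: "\<bar>g x\<bar> \<le> C + \<bar>r\<bar>" if "x \<in> space M" for x using bd[OF that] by (auto simp: g_def)
    define B where "B = (\<lambda>n. {x\<in>space M. \<exists>j\<le>n. birkhoff_sum T g j x > 0})"
    have sub: "x \<in> (\<Union>n. B n)" if "x \<in> A" for x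
    proof -
      from that have x: "x \<in> space M" and "limsup (\<lambda>n. ereal (avg n x)) > ereal r" by (auto simp: A_def)
      then have "\<not> (\<forall>\<^sub>F n in sequentially. ereal (avg n x) \<le> ereal r)"
        using Limsup_bounded[of "\<lambda>n. ereal (avg n x)" "ereal r" sequentially] by (auto simp: not_le[symmetric])
      then have "\<exists>n\<ge>1. \<not> avg n x \<le> r" by (auto simp: eventually_sequentially)
      then obtain n where n: "n \<ge> 1" "avg n x > r" by auto
      have "birkhoff_sum T g n x = birkhoff_sum T f n x - real n * r" by (simp add: birkhoff_sum_def g_def sum_subtractf)
      with n have "birkhoff_sum T g n x > 0" by (auto simp: avg_def field_simps)
      with x show ?thesis by (auto simp: B_def)
    qed
    have AE1: "AE x in M. x \<in> A" using A1 A AE_in_set_eq_1 by blast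
    have ig: "integrable M g"
      by (rule integrable_const_bound[of _ "C + \<bar>r\<bar>"]) (auto simp: gb)
    \<comment> \<open>The sets \<open>B n\<close> increase to a set of full measure, so in the limit
      the maximal inequality makes the whole integral of \<open>g\<close> nonnegative.\<close>
    have "(\<lambda>n. \<integral>x. g x * indicator (B n) x \<partial>M) \<longlonglongrightarrow> (\<integral>x. g x \<partial>M)"
    proof (rule integral_dominated_convergence[where w="\<lambda>x. C + \<bar>r\<bar>"])
      show "AE x in M. (\<lambda>n. g x * indicator (B n) x) \<longlonglongrightarrow> g x"
        using AE1
      proof eventually_elim
        case (elim x)
        from sub[OF this] obtain n0 where "x \<in> B n0" by auto
        have "x \<in> B n" if "n \<ge> n0" for n using that \<open>x \<in> B n0\<close> unfolding B_def by (auto intro: order.trans)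
        then have "\<forall>\<^sub>F n in sequentially. g x * indicator (B n) x = g x"
          by (intro eventually_sequentiallyI[of n0]) auto
        then show ?case by (rule tendsto_eventually)
      qed
      show "AE x in M. norm (g x * indicator (B n) x) \<le> C + \<bar>r\<bar>" for n
        using gb C by (auto simp: indicator_def)
    qed (auto simp: B_def)
    moreover have "\<forall>n. 0 \<le> (\<integral>x. g x * indicator (B n) x \<partial>M)"
      using garsia[OF g gb] unfolding B_def by blast
    ultimately have "0 \<le> (\<integral>x. g x \<partial>M)" by (intro LIMSEQ_le_const[where a=0]) auto
    moreover have "(\<integral>x. g x \<partial>M) = integral\<^sup>L M f - r"
      unfolding g_def using prob_space
      by (subst Bochner_Integration.integral_diff) (auto intro!: integrable_const_bound[of _ C] simp: bd)
    ultimately show False using r by simp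
  qed
  ultimately have "measure M A = 0" by simp
  then have "AE x in M. x \<notin> A" using A
    by (intro AE_not_in null_setsI) (simp_all add: emeasure_eq_measure)
  then show ?thesis
    using AE_space
  proof eventually_elim
    case (elim x)
    then have "limsup (\<lambda>n. ereal (avg n x)) < ereal s" using r by (auto simp: A_def not_less intro: le_less_trans)
    then show ?case using Limsup_lessD[of sequentially "\<lambda>n. ereal (avg n x)" "ereal s"] by (simp add: avg_def)
  qed
qed

lemma (in ergodic_mps) birkhoff:
  fixes f :: "'a \<Rightarrow> real"
  assumes f: "f \<in> borel_measurable M" and bd: "\<And>x. x \<in> space M \<Longrightarrow> \<bar>f x\<bar> \<le> C"
  shows "AE x in M. (\<lambda>n. birkhoff_sum T f n x / real n) \<longlonglongrightarrow> integral\<^sup>L M f"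
proof -
  let ?c = "integral\<^sup>L M f"
  have up: "AE x in M. \<forall>m. eventually (\<lambda>n. birkhoff_sum T f n x / real n < ?c + 1 / real (Suc m)) sequentially"
    unfolding AE_all_countable using birkhoff_upper[OF f bd] by simp
  have "AE x in M. eventually (\<lambda>n. birkhoff_sum T (\<lambda>x. - f x) n x / real n < - ?c + 1 / real (Suc m)) sequentially" for m
    by (rule birkhoff_upper[where C=C]) (use f bd in auto)
  then have lo: "AE x in M. \<forall>m. eventually (\<lambda>n. birkhoff_sum T (\<lambda>x. - f x) n x / real n < - ?c + 1 / real (Suc m)) sequentially"
    unfolding AE_all_countable by simp
  from up lo show ?thesis
  proof eventually_elim
    case (elim x)
    show ?case
    proof (rule tendstoI)
      fix e :: real assume "e > 0"
      then obtain m where m: "1 / real (Suc m) < e" using nat_approx_posE by blast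
      from elim(1)[rule_format, of m] elim(2)[rule_format, of m]
      show "\<forall>\<^sub>F n in sequentially. dist (birkhoff_sum T f n x / real n) ?c < e"
      proof eventually_elim
        case (elim n)
        then show ?case using m by (auto simp: dist_real_def birkhoff_sum_def sum_negf)
      qed
    qed
  qed
qed

lemma (in ergodic_mps) mean_ergodic_L2:
  fixes f :: "'a \<Rightarrow> real"
  assumes f[measurable]: "f \<in> borel_measurable M" and bd: "\<And>x. x \<in> space M \<Longrightarrow> \<bar>f x\<bar> \<le> C"
  shows "(\<lambda>n. \<integral>x. (birkhoff_sum T f n x / real n - integral\<^sup>L M f)\<^sup>2 \<partial>M) \<longlonglongrightarrow> 0"
proof -
  let ?c = "integral\<^sup>L M f"
  have C: "0 \<le> C" using bd not_empty by fastforce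
  have "(\<lambda>n. \<integral>x. (birkhoff_sum T f n x / real n - ?c)\<^sup>2 \<partial>M) \<longlonglongrightarrow> (\<integral>x. 0 \<partial>M)"
  proof (rule integral_dominated_convergence[where w="\<lambda>x. (C + \<bar>?c\<bar>)\<^sup>2"])
    show "AE x in M. (\<lambda>n. (birkhoff_sum T f n x / real n - ?c)\<^sup>2) \<longlonglongrightarrow> 0"
    proof (rule AE_mp[OF birkhoff[OF f bd]])
      show "AE x in M. (\<lambda>n. birkhoff_sum T f n x / real n) \<longlonglongrightarrow> ?c \<longrightarrow> (\<lambda>n. (birkhoff_sum T f n x / real n - ?c)\<^sup>2) \<longlonglongrightarrow> 0"
        using tendsto_power[OF tendsto_diff[OF _ tendsto_const[of ?c]], of _ ?c sequentially 2] by auto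
    qed
    show "AE x in M. norm ((birkhoff_sum T f n x / real n - ?c)\<^sup>2) \<le> (C + \<bar>?c\<bar>)\<^sup>2" for n
    proof (rule AE_I2)
      fix x assume x: "x \<in> space M"
      have "\<bar>birkhoff_sum T f n x\<bar> \<le> (\<Sum>i<n. C)" unfolding birkhoff_sum_def
        by (rule order.trans[OF sum_abs]) (intro sum_mono bd iter_space x)
      then have "\<bar>birkhoff_sum T f n x / real n\<bar> \<le> C" using C by (cases "n = 0") (auto simp: field_simps)
      then have "\<bar>birkhoff_sum T f n x / real n - ?c\<bar> \<le> \<bar>C + \<bar>?c\<bar>\<bar>" by linarith
      then show "norm ((birkhoff_sum T f n x / real n - ?c)\<^sup>2) \<le> (C + \<bar>?c\<bar>)\<^sup>2" by (simp add: abs_le_square_iff)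
    qed
  qed auto
  then show ?thesis by simp
qed

section \<open>Words, information and Gibbs' inequality\<close>

definition name :: "('a \<Rightarrow> 'a) \<Rightarrow> ('a \<Rightarrow> nat) \<Rightarrow> nat \<Rightarrow> 'a \<Rightarrow> nat list" where
  "name T \<alpha> n x = map (\<lambda>j. \<alpha> ((T ^^ j) x)) [0..<n]"

definition point_mass :: "'a measure \<Rightarrow> ('a \<Rightarrow> 'c) \<Rightarrow> 'c \<Rightarrow> real" where
  "point_mass M f y = measure M (f -` {y} \<inter> space M)"

text \<open>Since \<open>ln 0 = 0\<close>, the information is 0 on cells of mass 0.\<close>

definition info :: "'a measure \<Rightarrow> ('a \<Rightarrow> 'c) \<Rightarrow> 'a \<Rightarrow> real" where
  "info M f x = - ln (point_mass M f (f x))"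

lemma length_name [simp]: "length (name T \<alpha> n x) = n"
  by (simp add: name_def)

lemma take_name: "m \<le> n \<Longrightarrow> take m (name T \<alpha> n x) = name T \<alpha> m x"
  by (simp add: name_def take_map)

lemma drop_name: "drop m (name T \<alpha> (m + n) x) = name T \<alpha> n ((T ^^ m) x)"
  by (rule nth_equalityI) (auto simp: name_def funpow_add add.commute)

lemma nth_name: "j < n \<Longrightarrow> name T \<alpha> n x ! j = \<alpha> ((T ^^ j) x)"
  by (simp add: name_def)

lemma name_Suc: "name T \<alpha> (Suc n) x = \<alpha> x # name T \<alpha> n (T x)"
  unfolding name_def map_upt_Suc by (simp add: funpow_swap1)

lemma point_mass_nonneg: "point_mass M f y \<ge> 0"
  by (simp add: point_mass_def)

lemma (in prob_space) point_mass_le_1: "point_mass M f y \<le> 1"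
  by (simp add: point_mass_def)

lemma (in prob_space) info_nonneg: "info M f x \<ge> 0"
  using point_mass_le_1[of f "f x"] point_mass_nonneg[of M f "f x"]
  by (cases "point_mass M f (f x) = 0") (auto simp: info_def)

lemma (in prob_space) distr_point_mass:
  fixes f :: "'a \<Rightarrow> 'c::countable"
  assumes [measurable]: "f \<in> measurable M (count_space UNIV)"
  shows "distr M (count_space UNIV) f = density (count_space UNIV) (\<lambda>y. ennreal (point_mass M f y))"
proof (rule measure_eqI_countable[where A=UNIV])
  fix y :: 'c
  show "emeasure (distr M (count_space UNIV) f) {y} = emeasure (density (count_space UNIV) (\<lambda>y. ennreal (point_mass M f y))) {y}"
    by (subst emeasure_distr) (auto simp: emeasure_density nn_integral_count_space_indicator[symmetric] point_mass_def emeasure_eq_measure)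
qed auto

lemma (in prob_space) nn_integral_point_mass:
  fixes f :: "'a \<Rightarrow> 'c::countable"
  assumes [measurable]: "f \<in> measurable M (count_space UNIV)"
  shows "(\<integral>\<^sup>+x. g (f x) \<partial>M) = (\<integral>\<^sup>+y. ennreal (point_mass M f y) * g y \<partial>count_space UNIV)"
proof -
  have "(\<integral>\<^sup>+x. g (f x) \<partial>M) = (\<integral>\<^sup>+y. g y \<partial>distr M (count_space UNIV) f)"
    by (subst nn_integral_distr) auto
  then show ?thesis by (simp add: distr_point_mass[OF assms] nn_integral_density)
qed

lemma (in prob_space) AE_point_mass_pos:
  fixes f :: "'a \<Rightarrow> 'c::countable"
  assumes [measurable]: "f \<in> measurable M (count_space UNIV)"
  shows "AE x in M. point_mass M f (f x) > 0"
proof -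
  have "AE y in distr M (count_space UNIV) f. point_mass M f y > 0"
    by (subst distr_point_mass[OF assms]) (auto simp: AE_density)
  then show ?thesis by (subst (asm) AE_distr_iff) auto
qed

text \<open>A weight \<open>q\<close> of total mass at most 1 is a code whose lengths are bounded by \<open>U\<close>: the entropy is at
  most the expected code length.\<close>

lemma (in prob_space) gibbs:
  fixes f :: "'a \<Rightarrow> 'c::countable"
  assumes f[measurable]: "f \<in> measurable M (count_space UNIV)"
    and S: "\<And>x. x \<in> space M \<Longrightarrow> f x \<in> S"
    and q: "\<And>y. 0 \<le> q y" "(\<integral>\<^sup>+y. ennreal (q y) \<partial>count_space S) \<le> 1"
    and U: "integrable M U" "AE x in M. exp (- U x) \<le> q (f x)"
  shows "integrable M (info M f)" "integral\<^sup>L M (info M f) \<le> integral\<^sup>L M U"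
proof -
  define p where "p = point_mass M f"
  \<comment> \<open>The likelihood ratio. Its integral is at most 1, and
    \<open>ln r \<le> r - 1\<close> compares the information with the code length pointwise.\<close>
  define r where "r = (\<lambda>x. q (f x) / p (f x))"
  have [measurable]: "r \<in> borel_measurable M" "info M f \<in> borel_measurable M"
    unfolding r_def info_def by measurable
  have p0: "0 \<le> p y" for y by (simp add: p_def point_mass_nonneg)
  have "(\<integral>\<^sup>+x. ennreal (r x) \<partial>M) = (\<integral>\<^sup>+x. ennreal (q (f x) / p (f x)) * indicator S (f x) \<partial>M)"
    by (intro nn_integral_cong) (auto simp: r_def S)
  also have "\<dots> = (\<integral>\<^sup>+y. ennreal (p y) * (ennreal (q y / p y) * indicator S y) \<partial>count_space UNIV)"
    unfolding p_def by (rule nn_integral_point_mass[OF f, of "\<lambda>y. ennreal (q y / point_mass M f y) * indicator S y"])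
  also have "\<dots> \<le> (\<integral>\<^sup>+y. ennreal (q y) * indicator S y \<partial>count_space UNIV)"
    using p0 q(1) by (intro nn_integral_mono) (auto simp: indicator_def ennreal_mult[symmetric])
  also have "\<dots> \<le> 1" using q(2) by (simp add: nn_integral_count_space_indicator)
  finally have r1: "(\<integral>\<^sup>+x. ennreal (r x) \<partial>M) \<le> 1" .
  have r0: "0 \<le> r x" for x using q(1) p0 by (simp add: r_def)
  have ir: "integrable M r"
    using r0 le_less_trans[OF r1 ennreal_one_less_top] by (intro integrableI_bounded) auto
  have ir1: "integral\<^sup>L M r \<le> 1"
    using r1 r0 by (subst integral_eq_nn_integral) (auto intro: enn2real_leI)
  have le: "AE x in M. info M f x \<le> U x + r x - 1"
    using U(2) AE_point_mass_pos[OF f]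
  proof eventually_elim
    case (elim x)
    then have q0: "0 < q (f x)" by (meson exp_gt_zero less_le_trans)
    have "ln (r x) \<le> r x - 1" using q0 elim(2) by (intro ln_le_minus_one) (simp add: r_def p_def)
    moreover have "ln (r x) = ln (q (f x)) - ln (p (f x))"
      using q0 elim(2) by (simp add: r_def p_def ln_div)
    moreover have "- U x \<le> ln (q (f x))" using elim(1) q0 by (subst ln_ge_iff) auto
    ultimately show ?case by (simp add: info_def p_def)
  qed
  have iU: "integrable M (\<lambda>x. U x + r x - 1)" using U(1) ir by auto
  show I: "integrable M (info M f)"
  proof (rule Bochner_Integration.integrable_bound[OF iU])
    show "AE x in M. norm (info M f x) \<le> norm (U x + r x - 1)"
      using le
    proof eventually_elim
      case (elim x)
      with info_nonneg[of f x] show ?case by simp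
    qed
  qed simp
  have "integral\<^sup>L M (info M f) \<le> (\<integral>x. U x + r x - 1 \<partial>M)"
    by (rule integral_mono_AE[OF I iU le])
  also have "\<dots> = integral\<^sup>L M U + integral\<^sup>L M r - 1" using U(1) ir prob_space by simp
  finally show "integral\<^sup>L M (info M f) \<le> integral\<^sup>L M U" using ir1 by simp
qed

lemma (in prob_space) nn_integral_point_mass_le_1:
  fixes f :: "'a \<Rightarrow> 'c::countable"
  assumes [measurable]: "f \<in> measurable M (count_space UNIV)"
  shows "(\<integral>\<^sup>+y. ennreal (point_mass M f y) \<partial>count_space S) \<le> 1"
proof -
  have "(\<integral>\<^sup>+y. ennreal (point_mass M f y) \<partial>count_space S) \<le> (\<integral>\<^sup>+y. ennreal (point_mass M f y) * 1 \<partial>count_space UNIV)"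
    by (subst nn_integral_count_space_indicator) (auto intro!: nn_integral_mono simp: indicator_def)
  also have "\<dots> = 1" by (subst nn_integral_point_mass[OF assms, symmetric]) (simp add: emeasure_space_1)
  finally show ?thesis .
qed

text \<open>Finitely many such values have total mass at most 1. The exponential bound on the number
  of cells comes from here.\<close>

lemma (in prob_space) card_point_mass_ge:
  fixes f :: "'a \<Rightarrow> 'c::countable"
  assumes f: "f \<in> measurable M (count_space UNIV)" and c: "c > 0"
  shows "finite {y. point_mass M f y \<ge> c}" "real (card {y. point_mass M f y \<ge> c}) \<le> 1 / c"
proof -
  have *: "finite F \<and> real (card F) \<le> 1 / c" if "finite F" "F \<subseteq> {y. point_mass M f y \<ge> c}" for F
  proof -
    have "ennreal (c * real (card F)) = (\<Sum>y\<in>F. ennreal c)" 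
      using c by (simp add: ennreal_mult ennreal_of_nat_eq_real_of_nat mult.commute)
    also have "\<dots> \<le> (\<Sum>y\<in>F. ennreal (point_mass M f y))" using that by (intro sum_mono ennreal_leI) auto
    also have "\<dots> = (\<integral>\<^sup>+y. ennreal (point_mass M f y) \<partial>count_space F)" using that by (simp add: nn_integral_count_space_finite)
    also have "\<dots> \<le> 1" by (rule nn_integral_point_mass_le_1[OF f])
    finally have "c * real (card F) \<le> 1" by (simp flip: ennreal_1)
    then show ?thesis using c that by (simp add: field_simps)
  qed
  show fin: "finite {y. point_mass M f y \<ge> c}"
  proof (rule ccontr)
    assume "infinite {y. point_mass M f y \<ge> c}"
    then obtain F where "finite F" "card F = nat \<lceil>1/c\<rceil> + 1" "F \<subseteq> {y. point_mass M f y \<ge> c}"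
      using infinite_arbitrarily_large by blast
    with *[of F] c show False by (simp, linarith)
  qed
  show "real (card {y. point_mass M f y \<ge> c}) \<le> 1 / c" using *[OF fin] by simp
qed

text \<open>Kraft's inequality for the words of one length, the form in which \<open>gibbs\<close>
  takes a code.\<close>

definition subprob :: "nat \<Rightarrow> (nat list \<Rightarrow> real) \<Rightarrow> bool" where
  "subprob n q \<longleftrightarrow> (\<integral>\<^sup>+w. ennreal (q w) \<partial>count_space {w. length w = n}) \<le> 1"

lemma nn_integral_words_append:
  fixes F :: "nat list \<Rightarrow> nat list \<Rightarrow> ennreal"
  shows "(\<integral>\<^sup>+w. F (take n w) (drop n w) \<partial>count_space {w. length w = n + m}) =
    (\<integral>\<^sup>+u. (\<integral>\<^sup>+v. F u v \<partial>count_space {v. length v = m}) \<partial>count_space {u. length u = n})"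
proof -
  let ?A = "{u::nat list. length u = n}" and ?B = "{u::nat list. length u = m}"
  interpret B: sigma_finite_measure "count_space ?B" by (rule sigma_finite_measure_count_space_countable) auto
  have bij: "bij_betw (\<lambda>(u,v). u @ v) (?A \<times> ?B) {w. length w = n + m}"
    by (rule bij_betw_byWitness[where f'="\<lambda>w. (take n w, drop n w)"]) auto
  have "(\<integral>\<^sup>+w. F (take n w) (drop n w) \<partial>count_space {w. length w = n + m})
     = (\<integral>\<^sup>+z. (\<lambda>w. F (take n w) (drop n w)) ((\<lambda>(u,v). u @ v) z) \<partial>count_space (?A \<times> ?B))"
    by (rule nn_integral_bij_count_space[OF bij, symmetric])
  also have "\<dots> = (\<integral>\<^sup>+z. (\<lambda>(u,v). F u v) z \<partial>count_space (?A \<times> ?B))"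
    by (intro nn_integral_cong) auto
  also have "\<dots> = (\<integral>\<^sup>+z. (\<lambda>(u,v). F u v) z \<partial>(count_space ?A \<Otimes>\<^sub>M count_space ?B))"
    by (subst pair_measure_countable) auto
  also have "\<dots> = (\<integral>\<^sup>+u. (\<integral>\<^sup>+v. F u v \<partial>count_space ?B) \<partial>count_space ?A)"
    by (subst B.nn_integral_fst[symmetric]) (auto simp: pair_measure_countable)
  finally show ?thesis .
qed

lemma subprob_append:
  assumes "subprob n q" "subprob m r" "\<And>w. 0 \<le> q w" "\<And>w. 0 \<le> r w"
  shows "subprob (n + m) (\<lambda>w. q (take n w) * r (drop n w))"
proof -
  have "(\<integral>\<^sup>+w. ennreal (q (take n w) * r (drop n w)) \<partial>count_space {w. length w = n + m})
    = (\<integral>\<^sup>+u. ennreal (q u) * (\<integral>\<^sup>+v. ennreal (r v) \<partial>count_space {v. length v = m}) \<partial>count_space {u. length u = n})"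
    using assms by (subst nn_integral_words_append[where F="\<lambda>u v. ennreal (q u * r v)"]) (simp add: ennreal_mult nn_integral_cmult)
  also have "\<dots> \<le> (\<integral>\<^sup>+u. ennreal (q u) * 1 \<partial>count_space {u. length u = n})"
    using assms by (intro nn_integral_mono mult_left_mono) (auto simp: subprob_def)
  finally show ?thesis using assms by (simp add: subprob_def)
qed

lemma nn_integral_words_Suc:
  fixes F :: "nat list \<Rightarrow> ennreal"
  shows "(\<integral>\<^sup>+w. F w \<partial>count_space {w. length w = Suc n}) =
    (\<integral>\<^sup>+b. (\<integral>\<^sup>+v. F (b # v) \<partial>count_space {v. length v = n}) \<partial>count_space UNIV)"
proof -
  have bij: "bij_betw (\<lambda>b::nat. [b]) UNIV {u. length u = 1}"
    by (rule bij_betw_byWitness[where f'=hd]) (auto simp: length_Suc_conv)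
  have "(\<integral>\<^sup>+w. F w \<partial>count_space {w. length w = Suc n}) =
    (\<integral>\<^sup>+w. F (take 1 w @ drop 1 w) \<partial>count_space {w. length w = 1 + n})" by simp
  also have "\<dots> = (\<integral>\<^sup>+u. (\<integral>\<^sup>+v. F (u @ v) \<partial>count_space {v. length v = n}) \<partial>count_space {u. length u = 1})"
    by (rule nn_integral_words_append)
  also have "\<dots> = (\<integral>\<^sup>+b. (\<integral>\<^sup>+v. F ([b] @ v) \<partial>count_space {v. length v = n}) \<partial>count_space UNIV)"
    by (rule nn_integral_bij_count_space[OF bij, symmetric])
  finally show ?thesis by simp
qed

section \<open>Entropy by coding\<close>

text \<open>Fekete's lemma. \<open>entropy_rel\<close> is defined by \<open>lim\<close>, whose value
  is informative only once convergence is known.\<close>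

lemma fekete:
  fixes a :: "nat \<Rightarrow> real"
  assumes sub: "\<And>m n. a (m + n) \<le> a m + a n" and pos: "\<And>n. 0 \<le> a n"
  shows "convergent (\<lambda>n. a n / real n)"
proof -
  define I where "I = (INF n\<in>{1..}. a n / real n)"
  have bdd: "bdd_below ((\<lambda>n. a n / real n) ` {1..})"
    using pos by (intro bdd_belowI[of _ 0]) auto
  have low: "I \<le> a n / real n" if "n \<ge> 1" for n
    unfolding I_def using that by (intro cINF_lower bdd) auto
  have mult: "a (q * m + r) \<le> real q * a m + a r" for q m r
  proof (induction q)
    case (Suc q)
    have "a (Suc q * m + r) \<le> a m + a (q * m + r)" using sub[of m "q * m + r"] by (simp add: add.assoc)
    with Suc show ?case by (simp add: algebra_simps)
  qed simp
  have "(\<lambda>n. a n / real n) \<longlonglongrightarrow> I"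
  proof (rule LIMSEQ_I)
    fix e :: real assume e: "e > 0"
    have "\<exists>m\<in>{1..}. a m / real m < I + e / 2"
      using cINF_less_iff[OF _ bdd, of "I + e/2"] e by (auto simp: I_def)
    then obtain m where m: "m \<ge> 1" "a m / real m < I + e / 2" by auto
    \<comment> \<open>\<open>B\<close> bounds the contribution of the remainder
      \<open>n mod m\<close>; beyond \<open>n0\<close> it is less than \<open>e / 2\<close> per
      letter.\<close>
    define B where "B = Max (a ` {..<m})"
    obtain n0 :: nat where n0: "real n0 > 2 * B / e" using reals_Archimedean2 by blast
    show "\<exists>no. \<forall>n\<ge>no. norm (a n / real n - I) < e"
    proof (intro exI allI impI)
      fix n assume n: "n \<ge> max 1 n0"
      have B: "a (n mod m) \<le> B" unfolding B_def using m by (intro Max_ge) auto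
      have "a n \<le> real (n div m) * a m + a (n mod m)"
        using mult[of "n div m" m "n mod m"] by simp
      also have "real (n div m) * a m = real (n div m * m) * (a m / real m)" using m by simp
      also have "\<dots> \<le> real n * (a m / real m)"
        using pos[of m] by (intro mult_right_mono) (auto simp only: of_nat_le_iff div_times_less_eq_dividend divide_nonneg_nonneg of_nat_0_le_iff)
      finally have "a n \<le> real n * (a m / real m) + B" using B by linarith
      moreover have "2 * B < e * real n" using n0 n e by (simp add: field_simps) (smt (verit) mult_left_mono of_nat_mono max.bounded_iff)
      moreover have "real n * (a m / real m) \<le> real n * (I + e / 2)" using m by (intro mult_left_mono) auto
      ultimately have "a n < real n * (I + e)" by (simp add: algebra_simps)
      then have "a n / real n < I + e" using n by (simp add: field_simps)
      with low[of n] n show "norm (a n / real n - I) < e" by auto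
    qed
  qed
  then show ?thesis by (rule convergentI)
qed

lemma (in prob_space) integral_finite_range:
  fixes g :: "'c \<Rightarrow> real"
  assumes f: "f \<in> measurable M (count_space UNIV)" and fin: "finite (f ` space M)"
  shows "integrable M (\<lambda>x. g (f x))" "(\<integral>x. g (f x) \<partial>M) = (\<Sum>y\<in>f ` space M. point_mass M f y * g y)"
proof -
  have A: "f -` {y} \<inter> space M \<in> sets M" for y using f by (rule measurable_sets) auto
  have eq: "g (f x) = (\<Sum>y\<in>f ` space M. g y * indicator (f -` {y} \<inter> space M) x)" if "x \<in> space M" for x
  proof -
    have "(\<Sum>y\<in>f ` space M. g y * indicator (f -` {y} \<inter> space M) x) = (\<Sum>y\<in>f ` space M. if y = f x then g y else 0)"
      using that by (intro sum.cong) (auto simp: indicator_def)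
    then show ?thesis using that fin by simp
  qed
  have I: "integrable M (\<lambda>x. \<Sum>y\<in>f ` space M. g y * indicator (f -` {y} \<inter> space M) x)"
    using A by (intro Bochner_Integration.integrable_sum integrable_mult_right) (auto simp: emeasure_eq_measure)
  show "integrable M (\<lambda>x. g (f x))"
    by (subst Bochner_Integration.integrable_cong[OF refl eq]) (auto intro: I)
  have "(\<integral>x. g (f x) \<partial>M) = (\<integral>x. (\<Sum>y\<in>f ` space M. g y * indicator (f -` {y} \<inter> space M) x) \<partial>M)"
    by (intro Bochner_Integration.integral_cong refl eq)
  also have "\<dots> = (\<Sum>y\<in>f ` space M. g y * measure M (f -` {y} \<inter> space M))"
    using A by (subst Bochner_Integration.integral_sum) (auto simp: emeasure_eq_measure)
  finally show "(\<integral>x. g (f x) \<partial>M) = (\<Sum>y\<in>f ` space M. point_mass M f y * g y)"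
    by (simp add: point_mass_def mult.commute)
qed

lemma (in prob_space) part_entropy_eq:
  assumes "f \<in> measurable M (count_space UNIV)" "finite (f ` space M)"
  shows "integrable M (info M f)" "part_entropy M f = integral\<^sup>L M (info M f)"
  using integral_finite_range[OF assms, of "\<lambda>y. - ln (point_mass M f y)"]
  unfolding part_entropy_def info_def point_mass_def by (auto simp: sum_negf)

lemma (in mps) measurable_name [measurable (raw)]:
  assumes [measurable]: "\<alpha> \<in> measurable M (count_space UNIV)"
  shows "name T \<alpha> n \<in> measurable M (count_space UNIV)"
proof (induction n)
  case (Suc n)
  have [measurable]: "(\<lambda>x. name T \<alpha> n (T x)) \<in> measurable M (count_space UNIV)"
    by (rule measurable_compose[OF measurable_T Suc])
  have "(\<lambda>x. (\<lambda>(a, w). a # w) (\<alpha> x, name T \<alpha> n (T x))) \<in> measurable M (count_space UNIV)"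
    by (rule measurable_compose[where N="count_space UNIV \<Otimes>\<^sub>M count_space UNIV"])
       (auto simp: pair_measure_countable)
  then show ?case by (simp add: name_Suc[abs_def])
qed (simp add: name_def)

lemma (in mps) finite_name:
  assumes "finite (\<alpha> ` space M)"
  shows "finite (name T \<alpha> n ` space M)"
proof (rule finite_subset)
  show "name T \<alpha> n ` space M \<subseteq> {w. set w \<subseteq> \<alpha> ` space M \<and> length w = n}"
    by (auto simp: name_def iter_space)
  show "finite {w. set w \<subseteq> \<alpha> ` space M \<and> length w = n}" by (rule finite_lists_length_eq[OF assms])
qed

lemma (in mps) subprob_point_mass:
  "\<alpha> \<in> measurable M (count_space UNIV) \<Longrightarrow> subprob n (point_mass M (name T \<alpha> n))"
  unfolding subprob_def by (intro nn_integral_point_mass_le_1 measurable_name)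

lemma (in prob_space) AE_exp_info:
  fixes f :: "'a \<Rightarrow> 'c::countable"
  assumes "f \<in> measurable M (count_space UNIV)"
  shows "AE x in M. exp (- info M f x) = point_mass M f (f x)"
  using AE_point_mass_pos[OF assms] by eventually_elim (simp add: info_def)

text \<open>Subadditivity is Gibbs' inequality for the code that treats a word of length
  \<open>m + n\<close> as two independent blocks. By invariance the second block costs the entropy
  of the words of length \<open>n\<close>.\<close>

lemma (in mps) convergent_part_entropy:
  assumes \<xi>[measurable]: "\<xi> \<in> measurable M (count_space UNIV)" and fin: "finite (\<xi> ` space M)"
  shows "(\<lambda>n. part_entropy M (name T \<xi> n) / real n) \<longlonglongrightarrow> entropy_rel M T \<xi>"
proof -
  note [measurable] = measurable_name[OF \<xi>]
  note pe = part_entropy_eq[OF measurable_name[OF \<xi>] finite_name[OF fin]]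
  have "convergent (\<lambda>n. part_entropy M (name T \<xi> n) / real n)"
  proof (rule fekete)
    fix m n
    let ?U = "\<lambda>x. info M (name T \<xi> m) x + info M (name T \<xi> n) ((T ^^ m) x)"
    have "integral\<^sup>L M (info M (name T \<xi> (m + n))) \<le> integral\<^sup>L M ?U"
    proof (rule gibbs)
      show "(\<integral>\<^sup>+w. ennreal (point_mass M (name T \<xi> m) (take m w) * point_mass M (name T \<xi> n) (drop m w))
          \<partial>count_space {w. length w = m + n}) \<le> 1"
        using subprob_append[OF subprob_point_mass[OF \<xi>] subprob_point_mass[OF \<xi>]] by (simp add: subprob_def point_mass_nonneg)
      show "AE x in M. exp (- ?U x) \<le> point_mass M (name T \<xi> m) (take m (name T \<xi> (m + n) x)) *
          point_mass M (name T \<xi> n) (drop m (name T \<xi> (m + n) x))"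
        using AE_exp_info[OF measurable_name[OF \<xi>], of m] AE_iter[OF AE_exp_info[OF measurable_name[OF \<xi>], of n], of m]
        by eventually_elim (simp add: exp_add exp_diff exp_minus field_simps take_name drop_name)
    qed (auto simp: pe point_mass_nonneg intro!: integrable_iter mult_nonneg_nonneg)
    also have "\<dots> = part_entropy M (name T \<xi> m) + part_entropy M (name T \<xi> n)"
      by (subst Bochner_Integration.integral_add) (auto simp: pe integral_iter[OF borel_measurable_integrable[OF pe(1)]] intro!: integrable_iter)
    finally show "part_entropy M (name T \<xi> (m + n)) \<le> part_entropy M (name T \<xi> m) + part_entropy M (name T \<xi> n)"
      by (simp add: pe)
  qed (auto simp: pe info_nonneg)
  then show ?thesis unfolding entropy_rel_def name_def[abs_def] by (simp add: convergent_LIMSEQ_iff)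
qed

lemma (in mps) entropy_rel_le:
  assumes "\<xi> \<in> measurable M (count_space UNIV)" "finite (\<xi> ` space M)"
    and le: "\<And>n. part_entropy M (name T \<xi> n) \<le> real n * c + K"
  shows "entropy_rel M T \<xi> \<le> c"
proof (rule LIMSEQ_le[OF convergent_part_entropy[OF assms(1,2)]])
  show "(\<lambda>n. c + K / real n) \<longlonglongrightarrow> c"
    using tendsto_add[OF tendsto_const[of c] lim_const_over_n[of K]] by simp
  have "part_entropy M (name T \<xi> n) / real n \<le> c + K / real n" if "n \<ge> 1" for n
    using le[of n] that by (simp add: field_simps)
  then show "\<exists>N. \<forall>n\<ge>N. part_entropy M (name T \<xi> n) / real n \<le> c + K / real n" by blast
qed

section \<open>Coding one partition through another\<close>

text \<open>The conditional weight of a target word, given a source word: each target letter is coded by the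
  kernel \<open>\<kappa>\<close> from the window of \<open>m\<close> source letters at its position.\<close>

fun kernel_prod :: "(nat list \<Rightarrow> nat \<Rightarrow> real) \<Rightarrow> nat \<Rightarrow> nat list \<Rightarrow> nat list \<Rightarrow> real" where
  "kernel_prod \<kappa> m a [] = 1"
| "kernel_prod \<kappa> m a (b # bs) = \<kappa> (take m a) b * kernel_prod \<kappa> m (tl a) bs"

lemma kernel_prod_nonneg: "(\<And>u b. 0 \<le> \<kappa> u b) \<Longrightarrow> 0 \<le> kernel_prod \<kappa> m a w"
  by (induction w arbitrary: a) auto

lemma subprob_kernel_prod:
  assumes "\<And>u b. 0 \<le> \<kappa> u b" "\<And>u. (\<integral>\<^sup>+b. ennreal (\<kappa> u b) \<partial>count_space UNIV) \<le> 1"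
  shows "subprob n (kernel_prod \<kappa> m a)"
proof (induction n arbitrary: a)
  case 0
  have "{w::nat list. length w = 0} = {[]}" by auto
  then show ?case by (simp add: subprob_def nn_integral_count_space_finite)
next
  case (Suc n)
  have "(\<integral>\<^sup>+w. ennreal (kernel_prod \<kappa> m a w) \<partial>count_space {w. length w = Suc n}) =
    (\<integral>\<^sup>+b. ennreal (\<kappa> (take m a) b) * (\<integral>\<^sup>+v. ennreal (kernel_prod \<kappa> m (tl a) v) \<partial>count_space {v. length v = n}) \<partial>count_space UNIV)"
    by (subst nn_integral_words_Suc) (simp add: ennreal_mult assms kernel_prod_nonneg nn_integral_cmult)
  also have "\<dots> \<le> (\<integral>\<^sup>+b. ennreal (\<kappa> (take m a) b) * 1 \<partial>count_space UNIV)"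
    using Suc by (intro nn_integral_mono mult_left_mono) (auto simp: subprob_def)
  also have "\<dots> \<le> 1" using assms(2) by simp
  finally show ?case by (simp add: subprob_def)
qed

text \<open>Costs per letter add up to a Birkhoff sum. The source word has \<open>m\<close> letters
  more than the target word, because the windows of the last target letters may reach beyond
  position \<open>n\<close>.\<close>

lemma kernel_prod_name:
  assumes "\<And>t. exp (- v ((T ^^ t) x)) \<le> \<kappa> (name T \<alpha> m ((T ^^ t) x)) (\<beta> ((T ^^ t) x))"
    and k: "\<And>u b. 0 \<le> \<kappa> u b"
  shows "exp (- birkhoff_sum T v n x) \<le> kernel_prod \<kappa> m (name T \<alpha> (n + m) x) (name T \<beta> n x)"
  using assms(1)
proof (induction n arbitrary: x)
  case 0
  then show ?case by (simp add: name_def birkhoff_sum_def)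
next
  case (Suc n)
  have "exp (- v ((T ^^ t) (T x))) \<le> \<kappa> (name T \<alpha> m ((T ^^ t) (T x))) (\<beta> ((T ^^ t) (T x)))" for t
    using Suc.prems[of "Suc t"] by (simp add: funpow_swap1)
  from Suc.IH[OF this] have "exp (- v x) * exp (- birkhoff_sum T v n (T x)) \<le> \<kappa> (name T \<alpha> m x) (\<beta> x) * kernel_prod \<kappa> m (name T \<alpha> (n + m) (T x)) (name T \<beta> n (T x))"
    using Suc.prems[of 0] by (intro mult_mono) (auto simp: k kernel_prod_nonneg)
  moreover have "take m (name T \<alpha> (Suc n + m) x) = name T \<alpha> m x" by (rule take_name) simp
  moreover have "tl (name T \<alpha> (Suc n + m) x) = name T \<alpha> (n + m) (T x)" by (simp add: name_Suc)
  ultimately show ?case by (simp add: name_Suc[of T \<beta>] birkhoff_sum_Suc exp_add[symmetric] add.commute)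
qed

text \<open>The pair of words is coded: the source by \<open>W\<close>, then the target given the
  source by the kernel. Forgetting the source can only decrease the information, since the cell of
  the pair lies in the cell of the target.\<close>

lemma (in mps) integral_info_coding:
  assumes \<alpha>[measurable]: "\<alpha> \<in> measurable M (count_space UNIV)" and \<beta>[measurable]: "\<beta> \<in> measurable M (count_space UNIV)"
    and W: "\<And>w. 0 \<le> W w" "subprob (n + m) W"
    and \<kappa>: "\<And>u b. 0 \<le> \<kappa> u b" "\<And>u. (\<integral>\<^sup>+b. ennreal (\<kappa> u b) \<partial>count_space UNIV) \<le> 1"
    and U: "integrable M U" "AE x in M. exp (- U x) \<le> W (name T \<alpha> (n + m) x)"
    and v: "integrable M v" "AE x in M. exp (- v x) \<le> \<kappa> (name T \<alpha> m x) (\<beta> x)"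
  shows "integrable M (info M (name T \<beta> n))"
    "integral\<^sup>L M (info M (name T \<beta> n)) \<le> integral\<^sup>L M U + real n * integral\<^sup>L M v"
proof -
  define f where "f = (\<lambda>x. (name T \<alpha> (n + m) x, name T \<beta> n x))"
  let ?A = "{u::nat list. length u = n + m}" and ?B = "{u::nat list. length u = n}"
  define q where "q = (\<lambda>(a, b). W a * kernel_prod \<kappa> m a b)"
  interpret B: sigma_finite_measure "count_space ?B" by (rule sigma_finite_measure_count_space_countable) auto
  have f[measurable]: "f \<in> measurable M (count_space UNIV)"
  proof -
    have "f \<in> measurable M (count_space UNIV \<Otimes>\<^sub>M count_space UNIV)"
      unfolding f_def using measurable_name[OF \<alpha>, of "n + m"] measurable_name[OF \<beta>, of n] by measurable
    then show ?thesis by (simp add: pair_measure_countable)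
  qed
  have ib: "integrable M (birkhoff_sum T v n)" unfolding birkhoff_sum_def
    by (intro Bochner_Integration.integrable_sum integrable_iter v)
  have iU: "integrable M (\<lambda>x. U x + birkhoff_sum T v n x)" using U ib by auto
  have intb: "integral\<^sup>L M (birkhoff_sum T v n) = real n * integral\<^sup>L M v"
    unfolding birkhoff_sum_def using v by (subst Bochner_Integration.integral_sum) (auto intro!: integrable_iter simp: integral_iter)
  have "(\<integral>\<^sup>+y. ennreal (q y) \<partial>count_space (?A \<times> ?B)) = (\<integral>\<^sup>+y. ennreal (q y) \<partial>(count_space ?A \<Otimes>\<^sub>M count_space ?B))"
    by (subst pair_measure_countable) auto
  also have "\<dots> = (\<integral>\<^sup>+a. ennreal (W a) * (\<integral>\<^sup>+b. ennreal (kernel_prod \<kappa> m a b) \<partial>count_space ?B) \<partial>count_space ?A)"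
    by (subst B.nn_integral_fst[symmetric])
       (auto simp: pair_measure_countable q_def ennreal_mult W kernel_prod_nonneg \<kappa>(1) nn_integral_cmult)
  also have "\<dots> \<le> (\<integral>\<^sup>+a. ennreal (W a) * 1 \<partial>count_space ?A)"
    using subprob_kernel_prod[OF \<kappa>] by (intro nn_integral_mono mult_left_mono) (auto simp: subprob_def)
  also have "\<dots> \<le> 1" using W(2) by (simp add: subprob_def)
  finally have q1: "(\<integral>\<^sup>+y. ennreal (q y) \<partial>count_space (?A \<times> ?B)) \<le> 1" .
  have lb: "AE x in M. exp (- (U x + birkhoff_sum T v n x)) \<le> q (f x)"
    using U(2) AE_all_iter[OF v(2)]
  proof eventually_elim
    case (elim x)
    have "exp (- birkhoff_sum T v n x) \<le> kernel_prod \<kappa> m (name T \<alpha> (n + m) x) (name T \<beta> n x)"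
      using elim(2) \<kappa>(1) by (intro kernel_prod_name) auto
    with elim(1) have "exp (- U x) * exp (- birkhoff_sum T v n x) \<le> W (name T \<alpha> (n + m) x) * kernel_prod \<kappa> m (name T \<alpha> (n + m) x) (name T \<beta> n x)"
      by (intro mult_mono W) auto
    then show ?case by (simp add: q_def f_def exp_diff exp_minus field_simps)
  qed
  have S: "f x \<in> ?A \<times> ?B" for x by (simp add: f_def)
  have q0: "0 \<le> q y" for y using W(1) kernel_prod_nonneg[OF \<kappa>(1)] by (auto simp: q_def split: prod.split)
  note g = gibbs[OF f S q0 q1 iU lb]
  have le: "AE x in M. info M (name T \<beta> n) x \<le> info M f x"
    using AE_point_mass_pos[OF f]
  proof eventually_elim
    case (elim x)
    have "point_mass M f (f x) \<le> point_mass M (name T \<beta> n) (name T \<beta> n x)" unfolding point_mass_def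
      by (rule finite_measure_mono) (auto simp: f_def intro!: measurable_sets[OF measurable_name[OF \<beta>]])
    with elim show ?case by (auto simp: info_def)
  qed
  have [measurable]: "info M (name T \<beta> n) \<in> borel_measurable M"
    using measurable_name[OF \<beta>, of n] unfolding info_def by measurable
  show I: "integrable M (info M (name T \<beta> n))"
  proof (rule Bochner_Integration.integrable_bound[OF g(1)])
    show "AE x in M. norm (info M (name T \<beta> n) x) \<le> norm (info M f x)"
      using le by eventually_elim (simp add: info_nonneg)
  qed simp
  show "integral\<^sup>L M (info M (name T \<beta> n)) \<le> integral\<^sup>L M U + real n * integral\<^sup>L M v"
    using integral_mono_AE[OF I g(1) le] g(2) U(1) ib intb by simp
qed

lemma (in prob_space) borel_measurable_info:
  assumes [measurable]: "f \<in> measurable M (count_space (UNIV :: 'c::countable set))"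
  shows "info M f \<in> borel_measurable M"
  unfolding info_def by measurable

lemma integral_indicator_tendsto_0:
  fixes f :: "'a \<Rightarrow> real"
  assumes f: "integrable M f" and B: "\<And>n. B n \<in> sets M"
    and ev: "AE x in M. eventually (\<lambda>n. x \<notin> B n) sequentially"
  shows "(\<lambda>n. \<integral>x. indicator (B n) x * f x \<partial>M) \<longlonglongrightarrow> 0"
proof -
  note [measurable] = B borel_measurable_integrable[OF f]
  have "(\<lambda>n. \<integral>x. indicator (B n) x * f x \<partial>M) \<longlonglongrightarrow> (\<integral>x. 0 \<partial>M)"
  proof (rule integral_dominated_convergence[where w="\<lambda>x. \<bar>f x\<bar>"])
    show "AE x in M. (\<lambda>n. indicator (B n) x * f x) \<longlonglongrightarrow> 0"
      using ev
    proof eventually_elim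
      case (elim x)
      then have "\<forall>\<^sub>F n in sequentially. indicator (B n) x * f x = 0" by eventually_elim simp
      then show ?case by (rule tendsto_eventually)
    qed
  qed (use f in \<open>auto simp: indicator_def\<close>)
  then show ?thesis by simp
qed

lemma ks_entropy_ge:
  assumes "\<xi> \<in> measurable M (count_space UNIV)" "finite (\<xi> ` space M)"
  shows "ereal (entropy_rel M T \<xi>) \<le> ks_entropy M T"
  unfolding ks_entropy_def using assms by (intro SUP_upper) auto

text \<open>The code of the partition with the tail \<open>\<alpha> \<ge> r\<close> merged into one symbol is extended to \<open>\<alpha>\<close> by
  coding the tail symbols separately, at a small cost per letter.\<close>

lemma (in mps) info_name_le:
  assumes \<alpha>[measurable]: "\<alpha> \<in> measurable M (count_space UNIV)" and i\<alpha>: "integrable M (info M \<alpha>)"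
    and h: "ks_entropy M T \<le> ereal h" and e: "e > 0"
  shows "\<forall>\<^sub>F n in sequentially. integrable M (info M (name T \<alpha> n)) \<and>
    integral\<^sup>L M (info M (name T \<alpha> n)) \<le> real n * (h + e)"
proof -
  define tail where "tail = (\<lambda>r. {x\<in>space M. r \<le> \<alpha> x})"
  have tail[measurable]: "tail r \<in> sets M" for r unfolding tail_def by measurable
  have "(\<lambda>r. \<integral>x. indicator (tail r) x * info M \<alpha> x \<partial>M) \<longlonglongrightarrow> 0"
  proof (rule integral_indicator_tendsto_0[OF i\<alpha> tail])
    show "AE x in M. \<forall>\<^sub>F r in sequentially. x \<notin> tail r"
    proof (rule AE_I2)
      fix x
      show "\<forall>\<^sub>F r in sequentially. x \<notin> tail r"
        by (rule eventually_sequentiallyI[of "Suc (\<alpha> x)"]) (auto simp: tail_def)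
    qed
  qed
  then have "\<forall>\<^sub>F r in sequentially. (\<integral>x. indicator (tail r) x * info M \<alpha> x \<partial>M) < e / 2"
    using e by (intro order_tendstoD) auto
  then obtain r where r: "(\<integral>x. indicator (tail r) x * info M \<alpha> x \<partial>M) < e / 2"
    by (auto simp: eventually_sequentially)
  define v where "v = (\<lambda>x. indicator (tail r) x * info M \<alpha> x)"
  have iv: "integrable M v" unfolding v_def using i\<alpha> by (simp add: integrable_mult_indicator[of "tail r" M "info M \<alpha>", simplified])
  define \<beta> where "\<beta> = (\<lambda>x. min (\<alpha> x) r)"
  have \<beta>[measurable]: "\<beta> \<in> measurable M (count_space UNIV)" unfolding \<beta>_def by measurable
  have "\<beta> ` space M \<subseteq> {..r}" by (auto simp: \<beta>_def)
  then have fin\<beta>: "finite (\<beta> ` space M)" by (rule finite_subset) simp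
  define \<tau> where "\<tau> = measure M (tail r)"
  \<comment> \<open>A letter below \<open>r\<close> is read off from the truncated letter at no
    cost. The symbol \<open>r\<close> stands for the whole tail, and there the kernel is the
    conditional distribution, which costs at most \<open>info M \<alpha>\<close>.\<close>
  define \<kappa> where "\<kappa> = (\<lambda>(u::nat list) b. if hd u < r then (if b = hd u then 1 else 0)
     else if b \<ge> r then point_mass M \<alpha> b / \<tau> else 0 :: real)"
  have \<kappa>0: "0 \<le> \<kappa> u b" for u b by (auto simp: \<kappa>_def \<tau>_def point_mass_nonneg)
  have \<kappa>1: "(\<integral>\<^sup>+b. ennreal (\<kappa> u b) \<partial>count_space UNIV) \<le> 1" for u
  proof (cases "hd u < r")
    case True
    then have "(\<integral>\<^sup>+b. ennreal (\<kappa> u b) \<partial>count_space UNIV) = (\<integral>\<^sup>+b. 1 * indicator {hd u} b \<partial>count_space UNIV)"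
      by (intro nn_integral_cong) (auto simp: \<kappa>_def indicator_def)
    then show ?thesis by (simp del: mult_1_left)
  next
    case False
    then have "(\<integral>\<^sup>+b. ennreal (\<kappa> u b) \<partial>count_space UNIV) = (\<integral>\<^sup>+b. ennreal (point_mass M \<alpha> b) * (ennreal (1 / \<tau>) * indicator {r..} b) \<partial>count_space UNIV)"
      by (intro nn_integral_cong) (auto simp: \<kappa>_def indicator_def point_mass_nonneg \<tau>_def ennreal_mult[symmetric])
    also have "\<dots> = (\<integral>\<^sup>+x. ennreal (1 / \<tau>) * indicator {r..} (\<alpha> x) \<partial>M)"
      by (rule nn_integral_point_mass[OF \<alpha>, symmetric])
    also have "\<dots> = (\<integral>\<^sup>+x. ennreal (1 / \<tau>) * indicator (tail r) x \<partial>M)"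
      by (intro nn_integral_cong) (auto simp: tail_def indicator_def)
    also have "\<dots> = ennreal (1 / \<tau>) * ennreal \<tau>"
      by (subst nn_integral_cmult_indicator) (auto simp: \<tau>_def emeasure_eq_measure)
    also have "\<dots> \<le> 1" by (simp add: \<tau>_def ennreal_mult[symmetric] flip: ennreal_1)
    finally show ?thesis .
  qed
  have AEv: "AE x in M. exp (- v x) \<le> \<kappa> (name T \<beta> 1 x) (\<alpha> x)"
    using AE_exp_info[OF \<alpha>] AE_point_mass_pos[OF \<alpha>] AE_space
  proof eventually_elim
    case (elim x)
    have hd: "hd (name T \<beta> 1 x) = min (\<alpha> x) r" by (simp add: name_def \<beta>_def)
    show ?case
    proof (cases "\<alpha> x < r")
      case True
      then show ?thesis using hd by (simp add: \<kappa>_def v_def tail_def indicator_def)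
    next
      case False
      have "point_mass M \<alpha> (\<alpha> x) \<le> \<tau>" unfolding point_mass_def \<tau>_def
        by (rule finite_measure_mono) (use False in \<open>auto simp: tail_def\<close>)
      moreover have "\<tau> \<le> 1" by (simp add: \<tau>_def)
      ultimately have "point_mass M \<alpha> (\<alpha> x) \<le> point_mass M \<alpha> (\<alpha> x) / \<tau>"
        using elim(2) by (simp add: pos_le_divide_eq)
      then show ?thesis using hd False elim by (simp add: \<kappa>_def v_def tail_def)
    qed
  qed
  note pe = part_entropy_eq[OF measurable_name[OF \<beta>] finite_name[OF fin\<beta>]]
  have main: "integrable M (info M (name T \<alpha> n)) \<and>
      integral\<^sup>L M (info M (name T \<alpha> n)) \<le> part_entropy M (name T \<beta> (Suc n)) + real n * (e / 2)" for n
  proof -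
    have AEU: "AE x in M. exp (- info M (name T \<beta> (n + 1)) x) \<le> point_mass M (name T \<beta> (n + 1)) (name T \<beta> (n + 1) x)"
      using AE_exp_info[OF measurable_name[OF \<beta>], of "n + 1"] by eventually_elim simp
    note c = integral_info_coding[OF \<beta> \<alpha> point_mass_nonneg subprob_point_mass[OF \<beta>] \<kappa>0 \<kappa>1 pe(1) AEU iv AEv]
    have "real n * integral\<^sup>L M v \<le> real n * (e / 2)" using r by (intro mult_left_mono) (auto simp: v_def)
    with c show ?thesis by (simp add: pe)
  qed
  have "entropy_rel M T \<beta> < h + e / 4"
    using ks_entropy_ge[OF \<beta> fin\<beta>, of T] h e order_trans by fastforce
  then have "\<forall>\<^sub>F n in sequentially. part_entropy M (name T \<beta> n) / real n < h + e / 4"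
    using convergent_part_entropy[OF \<beta> fin\<beta>] by (intro order_tendstoD)
  then have ev1: "\<forall>\<^sub>F n in sequentially. part_entropy M (name T \<beta> (Suc n)) / real (Suc n) < h + e / 4"
    by (subst eventually_sequentially_Suc)
  \<comment> \<open>The source word has one letter more than the target word. Beyond
    \<open>n0\<close> its cost \<open>h + e / 4\<close> is covered by \<open>e / 4\<close> per
    target letter.\<close>
  obtain n0 :: nat where n0: "(h + e / 4) / (e / 4) < real n0" using reals_Archimedean2 by blast
  from ev1 eventually_ge_at_top[of n0] show ?thesis
  proof eventually_elim
    case (elim n)
    have "part_entropy M (name T \<beta> (Suc n)) \<le> real (Suc n) * (h + e / 4)"
      using elim(1) by (simp add: field_simps)
    also have "\<dots> \<le> real n * (h + e / 2)"
    proof -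
      have "(h + e / 4) / (e / 4) \<le> real n" using n0 elim(2) by linarith
      then have "h + e / 4 \<le> real n * (e / 4)" using e by (simp add: pos_divide_le_eq)
      moreover have "real (Suc n) * (h + e / 4) = real n * (h + e / 4) + (h + e / 4)"
        by (simp add: algebra_simps)
      moreover have "real n * (h + e / 2) = real n * (h + e / 4) + real n * (e / 4)"
        by (simp only: distrib_left[symmetric]) simp
      ultimately show ?thesis by linarith
    qed
    finally show ?case using main[of n] by (auto simp: algebra_simps)
  qed
qed

section \<open>Renewal weights and the upper bound for the entropy\<close>

text \<open>The renewal weight of a word is a mixture over all ways to cut it into blocks, each block
  weighted by its mass. The probabilities \<open>1 / (n (n + 1))\<close> of the block lengths sum to 1, and using a
  long block costs only \<open>O(ln n)\<close>.\<close>

definition renewal_prob :: "nat \<Rightarrow> real" where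
  "renewal_prob n = 1 / (real n * real (Suc n))"

lemma renewal_prob_nonneg: "0 \<le> renewal_prob n"
  by (simp add: renewal_prob_def)

lemma sum_renewal_prob: "(\<Sum>n\<in>{1..N}. renewal_prob n) = 1 - 1 / real (Suc N)"
proof (induction N)
  case (Suc N)
  have "renewal_prob (Suc N) = 1 / real (Suc N) - 1 / real (Suc (Suc N))"
    unfolding renewal_prob_def by (simp add: field_simps del: of_nat_Suc)
  with Suc show ?case by simp
qed simp

function renewal_weight :: "(nat list \<Rightarrow> real) \<Rightarrow> nat list \<Rightarrow> real" where
  "renewal_weight p w = (if w = [] then 1 else
     (\<Sum>n\<in>{1..length w}. renewal_prob n * p (take n w) * renewal_weight p (drop n w)))"
  by auto
termination by (relation "Wellfounded.measure (\<lambda>(p, w). length w)") auto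

declare renewal_weight.simps [simp del]

lemma renewal_weight_nonneg:
  assumes "\<And>u. 0 \<le> p u"
  shows "0 \<le> renewal_weight p w"
proof (induction "length w" arbitrary: w rule: less_induct)
  case less
  show ?case by (subst renewal_weight.simps) (auto intro!: sum_nonneg mult_nonneg_nonneg renewal_prob_nonneg assms less)
qed

text \<open>Induction on the length: after the first block a shorter word remains, and the
  probabilities of block lengths up to \<open>N\<close> add up to less than 1.\<close>

lemma subprob_renewal_weight:
  assumes p: "\<And>u. 0 \<le> p u" "\<And>n. subprob n p"
  shows "subprob N (renewal_weight p)"
proof (induction N rule: less_induct)
  case (less N)
  show ?case
  proof (cases "N = 0")
    case True
    have "{w::nat list. length w = 0} = {[]}" by auto
    then show ?thesis using True by (simp add: subprob_def nn_integral_count_space_finite renewal_weight.simps)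
  next
    case False
    note r0 = renewal_weight_nonneg[of p, OF p(1)]
    have "(\<integral>\<^sup>+w. ennreal (renewal_weight p w) \<partial>count_space {w. length w = N}) =
      (\<integral>\<^sup>+w. (\<Sum>n\<in>{1..N}. ennreal (renewal_prob n) * ennreal (p (take n w) * renewal_weight p (drop n w))) \<partial>count_space {w. length w = N})"
    proof (intro nn_integral_cong)
      fix w :: "nat list" assume "w \<in> space (count_space {w. length w = N})"
      then have w: "length w = N" "w \<noteq> []" using False by auto
      show "ennreal (renewal_weight p w) = (\<Sum>n\<in>{1..N}. ennreal (renewal_prob n) * ennreal (p (take n w) * renewal_weight p (drop n w)))"
        by (subst renewal_weight.simps) (use w p r0 renewal_prob_nonneg in \<open>auto simp: ennreal_mult[symmetric] mult.assoc intro!: sum_ennreal[symmetric]\<close>)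
    qed
    also have "\<dots> = (\<Sum>n\<in>{1..N}. ennreal (renewal_prob n) * (\<integral>\<^sup>+w. ennreal (p (take n w) * renewal_weight p (drop n w)) \<partial>count_space {w. length w = N}))"
      by (simp add: nn_integral_sum nn_integral_cmult)
    also have "\<dots> \<le> (\<Sum>n\<in>{1..N}. ennreal (renewal_prob n) * 1)"
    proof (intro sum_mono mult_left_mono)
      fix n assume n: "n \<in> {1..N}"
      then have "subprob (n + (N - n)) (\<lambda>w. p (take n w) * renewal_weight p (drop n w))"
        by (intro subprob_append p r0 less) auto
      then show "(\<integral>\<^sup>+w. ennreal (p (take n w) * renewal_weight p (drop n w)) \<partial>count_space {w. length w = N}) \<le> 1"
        using n by (simp add: subprob_def)
    qed auto
    also have "\<dots> = ennreal (\<Sum>n\<in>{1..N}. renewal_prob n)" by (simp add: sum_ennreal renewal_prob_nonneg)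
    also have "(\<Sum>n\<in>{1..N}. renewal_prob n) = 1 - 1 / real (Suc N)" by (rule sum_renewal_prob)
    also have "ennreal (1 - 1 / real (Suc N)) \<le> 1" by (simp flip: ennreal_1)
    finally show ?thesis by (simp add: subprob_def)
  qed
qed

text \<open>The mixture is at least the contribution of a single parse. From a point of
  \<open>G\<close> a block with length in \<open>{K..L}\<close> is taken if it ends by
  \<open>N\<close>, otherwise a single letter. Every position is charged \<open>h\<close> for the
  mass and \<open>d\<close> for the probability of the block length. Single letters are charged
  \<open>s\<close>, where the factor 1/2 is \<open>renewal_prob 1\<close>. The last \<open>L\<close>
  positions are charged \<open>s\<close> as well, in case no block fits.\<close>

lemma renewal_weight_lower:
  fixes s :: "'a \<Rightarrow> real"
  assumes p: "\<And>u. 0 \<le> p u" and s: "\<And>y. 0 \<le> s y" and hd: "0 \<le> h" "0 \<le> d"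
    and K: "1 \<le> K" "\<And>n. K \<le> n \<Longrightarrow> exp (- (real n * d)) \<le> renewal_prob n"
    and good: "\<And>t. (T ^^ t) x \<in> G \<Longrightarrow> \<exists>n\<in>{K..L}. exp (- (real n * h)) \<le> p (name T \<alpha> n ((T ^^ t) x))"
    and single: "\<And>t. exp (- s ((T ^^ t) x)) \<le> p [\<alpha> ((T ^^ t) x)] / 2"
  shows "exp (- (\<Sum>t<N. h + d + (if (T ^^ t) x \<in> G then 0 else s ((T ^^ t) x)) +
     (if N \<le> t + L then s ((T ^^ t) x) else 0))) \<le> renewal_weight p (name T \<alpha> N x)"
  using good single
proof (induction N arbitrary: x rule: less_induct)
  case (less N)
  let ?g = "\<lambda>N x t. h + d + (if (T ^^ t) x \<in> G then 0 else s ((T ^^ t) x)) + (if N \<le> t + L then s ((T ^^ t) x) else 0)"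
  have g0: "?g N x t \<ge> h + d" for N x t using s hd by simp
  show ?case
  proof (cases "N = 0")
    case True
    then show ?thesis by (simp add: name_def renewal_weight.simps)
  next
    case False
    \<comment> \<open>It suffices to find the first block: a charge depends on \<open>t\<close> only
      through the point reached and the distance to \<open>N\<close>, so the charges of the
      remaining word have the same form.\<close>
    have step: ?thesis if n: "n \<in> {1..N}" and le: "exp (- (\<Sum>t<n. ?g N x t)) \<le> renewal_prob n * p (name T \<alpha> n x)" for n
    proof -
      let ?y = "(T ^^ n) x"
      have IH: "exp (- (\<Sum>t<N-n. ?g (N - n) ?y t)) \<le> renewal_weight p (name T \<alpha> (N - n) ?y)"
      proof (rule less.IH)
        show "N - n < N" using n by auto
        show "\<exists>n\<in>{K..L}. exp (- (real n * h)) \<le> p (name T \<alpha> n ((T ^^ t) ?y))" if "(T ^^ t) ?y \<in> G" for t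
          using less.prems(1)[of "t + n"] that by (simp add: funpow_add)
        show "exp (- s ((T ^^ t) ?y)) \<le> p [\<alpha> ((T ^^ t) ?y)] / 2" for t
          using less.prems(2)[of "t + n"] by (simp add: funpow_add)
      qed
      have split: "(\<Sum>t<N. ?g N x t) = (\<Sum>t<n. ?g N x t) + (\<Sum>t<N-n. ?g (N - n) ?y t)"
      proof -
        have "(\<Sum>t<N. ?g N x t) = (\<Sum>t<n. ?g N x t) + (\<Sum>t\<in>{n..<N}. ?g N x t)"
          using n by (subst sum.union_disjoint[symmetric]) (auto intro!: sum.cong)
        also have "(\<Sum>t\<in>{n..<N}. ?g N x t) = (\<Sum>t<N-n. ?g N x (t + n))"
          by (rule sum.reindex_bij_witness[of _ "\<lambda>t. t + n" "\<lambda>t. t - n"]) auto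
        also have "\<dots> = (\<Sum>t<N-n. ?g (N - n) ?y t)"
          using n by (intro sum.cong) (auto simp: funpow_add)
        finally show ?thesis .
      qed
      have "exp (- (\<Sum>t<N. ?g N x t)) = exp (- (\<Sum>t<n. ?g N x t)) * exp (- (\<Sum>t<N-n. ?g (N - n) ?y t))"
        unfolding split by (simp add: exp_add[symmetric])
      also have "\<dots> \<le> (renewal_prob n * p (name T \<alpha> n x)) * renewal_weight p (name T \<alpha> (N - n) ?y)"
        by (intro mult_mono le IH) (auto intro!: mult_nonneg_nonneg renewal_prob_nonneg p)
      also have "\<dots> = renewal_prob n * p (take n (name T \<alpha> N x)) * renewal_weight p (drop n (name T \<alpha> N x))"
        using n drop_name[of n T \<alpha> "N - n" x] by (simp add: take_name)
      also have "\<dots> \<le> (\<Sum>n\<in>{1..N}. renewal_prob n * p (take n (name T \<alpha> N x)) * renewal_weight p (drop n (name T \<alpha> N x)))"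
        using n by (intro member_le_sum[of n]) (auto intro!: mult_nonneg_nonneg renewal_prob_nonneg p renewal_weight_nonneg)
      also have "\<dots> = renewal_weight p (name T \<alpha> N x)"
        by (subst (2) renewal_weight.simps) (use False in \<open>auto simp: name_def\<close>)
      finally show ?thesis .
    qed
    show ?thesis
    proof (cases "x \<in> G \<and> (\<exists>n\<in>{K..min L N}. exp (- (real n * h)) \<le> p (name T \<alpha> n x))")
      case True
      then obtain n where n: "K \<le> n" "n \<le> N" "exp (- (real n * h)) \<le> p (name T \<alpha> n x)" by auto
      have "exp (- (\<Sum>t<n. ?g N x t)) \<le> exp (- (\<Sum>t<n. h + d))"
        using g0 by (intro exp_le_cancel_iff[THEN iffD2] le_imp_neg_le sum_mono) auto
      also have "\<dots> = exp (- (real n * d)) * exp (- (real n * h))"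
        by (simp add: exp_add[symmetric] algebra_simps)
      also have "\<dots> \<le> renewal_prob n * p (name T \<alpha> n x)"
        using n K renewal_prob_nonneg by (intro mult_mono) auto
      finally show ?thesis using n K by (intro step[of n]) auto
    next
      case F: False
      have "s x \<le> ?g N x 0"
      proof (cases "x \<in> G")
        case True
        then have "\<exists>n\<in>{K..L}. exp (- (real n * h)) \<le> p (name T \<alpha> n x)" using less.prems(1)[of 0] by simp
        \<comment> \<open>A good point without a fitting block is within \<open>L\<close> of the
          end, where the last summand pays for the letter.\<close>
        then have "N \<le> L" using F True by force
        then show ?thesis using s hd by simp
      qed (use s hd in auto)
      moreover have "(\<Sum>t<1. ?g N x t) = ?g N x 0"
        by (subst One_nat_def, subst sum.lessThan_Suc) simp
      ultimately have "exp (- (\<Sum>t<1. ?g N x t)) \<le> exp (- s x)" by (simp only: exp_le_cancel_iff neg_le_iff_le)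
      also have "\<dots> \<le> p [\<alpha> x] / 2" using less.prems(2)[of 0] by simp
      also have "\<dots> = renewal_prob 1 * p (name T \<alpha> 1 x)" by (simp add: name_def renewal_prob_def)
      finally show ?thesis using False by (intro step[of 1]) auto
    qed
  qed
qed

section \<open>Cell sizes and entropy\<close>

text \<open>The generator property in the form suited to codes: a finite stretch of the name decides
  membership up to a small error.\<close>

definition generating :: "'a measure \<Rightarrow> ('a \<Rightarrow> 'a) \<Rightarrow> ('a \<Rightarrow> nat) \<Rightarrow> bool" where
  "generating M T \<alpha> \<longleftrightarrow> (\<forall>A\<in>sets M. \<forall>e>0. \<exists>m S.
     measure M (sym_diff A {x \<in> space M. name T \<alpha> m x \<in> S}) < e)"

lemma (in mps) sets_name:
  assumes "\<alpha> \<in> measurable M (count_space UNIV)"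
  shows "{x \<in> space M. name T \<alpha> m x \<in> S} \<in> sets M"
proof -
  have "{x \<in> space M. name T \<alpha> m x \<in> S} = name T \<alpha> m -` S \<inter> space M" by auto
  then show ?thesis using measurable_name[OF assms] by (simp add: measurable_sets)
qed

text \<open>Each of the at most \<open>r\<close> values is recognised from its own word length with
  error \<open>e / r\<close>. Shorter names are prefixes of longer ones, so the longest of these
  lengths serves for all values.\<close>

lemma (in mps) approx_code:
  fixes \<xi> :: "'a \<Rightarrow> nat"
  assumes \<alpha>: "\<alpha> \<in> measurable M (count_space UNIV)" and gen: "generating M T \<alpha>"
    and \<xi>[measurable]: "\<xi> \<in> measurable M (count_space UNIV)" and r: "\<And>x. x \<in> space M \<Longrightarrow> \<xi> x < r" "0 < r"
    and e: "0 < e"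
  obtains \<eta> m where "\<forall>u. \<eta> u < r" "measure M {x\<in>space M. \<xi> x \<noteq> \<eta> (name T \<alpha> m x)} < e"
proof -
  define A where "A = (\<lambda>v. {x\<in>space M. \<xi> x = v})"
  have A: "A v \<in> sets M" for v unfolding A_def by measurable
  have "\<forall>v. \<exists>m S. measure M (sym_diff (A v) {x \<in> space M. name T \<alpha> m x \<in> S}) < e / r"
    using gen A e r(2) unfolding generating_def by simp
  from choice[OF this] obtain m where "\<forall>v. \<exists>S. measure M (sym_diff (A v) {x \<in> space M. name T \<alpha> (m v) x \<in> S}) < e / r" ..
  from choice[OF this] obtain S where mS: "\<And>v. measure M (sym_diff (A v) {x \<in> space M. name T \<alpha> (m v) x \<in> S v}) < e / r" by auto
  define D where "D = (\<lambda>v. sym_diff (A v) {x \<in> space M. name T \<alpha> (m v) x \<in> S v})"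
  have D: "D v \<in> sets M" for v unfolding D_def using A sets_name[OF \<alpha>] by auto
  define k where "k = Max (m ` {..<r})"
  have mk: "m v \<le> k" if "v < r" for v unfolding k_def using that by (intro Max_ge) auto
  \<comment> \<open>Off the exceptional sets \<open>D v\<close> exactly one \<open>v < r\<close>
    matches, namely the value of \<open>\<xi>\<close>; elsewhere any choice below \<open>r\<close>
    will do.\<close>
  define \<eta> where "\<eta> = (\<lambda>u. if \<exists>v<r. take (m v) u \<in> S v then LEAST v. v < r \<and> take (m v) u \<in> S v else 0)"
  have \<eta>r: "\<eta> u < r" for u
  proof (cases "\<exists>v<r. take (m v) u \<in> S v")
    case True
    then show ?thesis using LeastI_ex[of "\<lambda>v. v < r \<and> take (m v) u \<in> S v"] by (simp add: \<eta>_def)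
  qed (use r in \<open>auto simp: \<eta>_def\<close>)
  have sub: "{x\<in>space M. \<xi> x \<noteq> \<eta> (name T \<alpha> k x)} \<subseteq> (\<Union>v<r. D v)"
  proof (rule subsetI, rule ccontr)
    fix x assume x: "x \<in> {x\<in>space M. \<xi> x \<noteq> \<eta> (name T \<alpha> k x)}" and nD: "x \<notin> (\<Union>v<r. D v)"
    have iff: "take (m v) (name T \<alpha> k x) \<in> S v \<longleftrightarrow> v = \<xi> x" if "v < r" for v
    proof -
      have "x \<notin> D v" using nD that by blast
      then have "x \<in> A v \<longleftrightarrow> name T \<alpha> (m v) x \<in> S v" using x unfolding D_def by blast
      then show ?thesis unfolding take_name[OF mk[OF that]] using x by (auto simp: A_def)
    qed
    have "\<xi> x < r" using r x by simp
    with iff have "\<eta> (name T \<alpha> k x) = \<xi> x"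
      unfolding \<eta>_def by (subst if_P, blast) (rule Least_equality, simp, metis order_refl)
    with x show False by simp
  qed
  have "measure M {x\<in>space M. \<xi> x \<noteq> \<eta> (name T \<alpha> k x)} \<le> measure M (\<Union>v<r. D v)"
    using sub D by (intro finite_measure_mono) auto
  also have "\<dots> \<le> (\<Sum>v<r. measure M (D v))"
    using D by (intro measure_UNION_le) auto
  also have "\<dots> < (\<Sum>v<r. e / r)"
    using mS r(2) by (intro sum_strict_mono) (auto simp: D_def)
  also have "\<dots> = e" using r(2) by simp
  finally show ?thesis using that \<eta>r by blast
qed

text \<open>The quadratic lower bound for \<open>exp (n d / 2)\<close>, squared, gives
  \<open>n^4 d^4 / 64\<close>. Once \<open>n d^2 \<ge> 12\<close> this exceeds \<open>2 n^2\<close>,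
  hence also \<open>n (n + 1)\<close>.\<close>

lemma exp_le_renewal_prob:
  assumes d: "0 < d"
  obtains K where "1 \<le> K" "\<And>n. K \<le> n \<Longrightarrow> exp (- (real n * d)) \<le> renewal_prob n"
proof -
  obtain K0 :: nat where K0: "12 / d\<^sup>2 < real K0" using reals_Archimedean2 by blast
  have "exp (- (real n * d)) \<le> renewal_prob n" if n: "max 1 K0 \<le> n" for n
  proof -
    have "12 \<le> real n * d\<^sup>2" using K0 n d by (simp add: divide_less_eq) (smt (verit) max.bounded_iff mult_right_mono of_nat_mono zero_le_power2)
    then have "12\<^sup>2 \<le> (real n * d\<^sup>2)\<^sup>2" by (intro power_mono) auto
    then have "2 \<le> (real n * d\<^sup>2)\<^sup>2 / 64" by simp
    then have "2 * (real n)\<^sup>2 \<le> (real n * d\<^sup>2)\<^sup>2 / 64 * (real n)\<^sup>2" by (intro mult_right_mono) auto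
    also have "\<dots> = ((real n * d / 2)\<^sup>2 / 2)\<^sup>2" by (simp add: power2_eq_square field_simps)
    also have "\<dots> \<le> (exp (real n * d / 2))\<^sup>2"
    proof (rule power_mono)
      have "1 + real n * d / 2 + (real n * d / 2)\<^sup>2 / 2 \<le> exp (real n * d / 2)"
        using d by (intro exp_lower_Taylor_quadratic) auto
      moreover have "0 \<le> real n * d / 2" using d by simp
      ultimately show "(real n * d / 2)\<^sup>2 / 2 \<le> exp (real n * d / 2)" by linarith
    qed simp
    also have "\<dots> = exp (real n * d)" by (simp add: power2_eq_square exp_add[symmetric])
    finally have *: "2 * (real n)\<^sup>2 \<le> exp (real n * d)" .
    have "real n * real (Suc n) \<le> real n * (2 * real n)" using n by (intro mult_left_mono) auto
    with * have "real n * real (Suc n) \<le> exp (real n * d)" by (simp add: power2_eq_square)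
    moreover have "0 < real n * real (Suc n)" using n by simp
    ultimately have "1 / exp (real n * d) \<le> 1 / (real n * real (Suc n))" by (intro divide_left_mono) auto
    then show ?thesis by (simp add: renewal_prob_def exp_minus inverse_eq_divide)
  qed
  then show ?thesis using that[of "max 1 K0"] by auto
qed

text \<open>Cut the orbit greedily into blocks of mass at least \<open>exp (- n h)\<close>, leaving single letters where none
  of length at most \<open>L\<close> starts; the renewal weight then codes \<open>\<alpha>\<close>, and hence any finite partition, at
  rate \<open>h\<close>.\<close>

lemma (in mps) ks_entropy_le:
  assumes \<alpha>[measurable]: "\<alpha> \<in> measurable M (count_space UNIV)" and i\<alpha>: "integrable M (info M \<alpha>)"
    and gen: "generating M T \<alpha>" and h: "0 \<le> h"
    and io: "AE x in M. \<forall>K. \<exists>n\<ge>K. exp (- (real n * h)) \<le> point_mass M (name T \<alpha> n) (name T \<alpha> n x)"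
  shows "ks_entropy M T \<le> ereal h"
proof -
  have key: "entropy_rel M T \<xi> \<le> h + e"
    if \<xi>[measurable]: "\<xi> \<in> measurable M (count_space UNIV)" and fin: "finite (\<xi> ` space M)" and e: "0 < e" for \<xi> :: "'a \<Rightarrow> nat" and e
  proof -
    define p where "p = (\<lambda>u. point_mass M (name T \<alpha> (length u)) u)"
    have p0: "0 \<le> p u" for u by (simp add: p_def point_mass_nonneg)
    have "subprob n p \<longleftrightarrow> subprob n (point_mass M (name T \<alpha> n))" for n
      unfolding subprob_def p_def by (subst nn_integral_cong[of _ _ "\<lambda>w. ennreal (point_mass M (name T \<alpha> n) w)"]) auto
    then have p1: "subprob n p" for n using subprob_point_mass[OF \<alpha>] by simp
    obtain K where K: "1 \<le> K" "\<And>n. K \<le> n \<Longrightarrow> exp (- (real n * (e / 4))) \<le> renewal_prob n"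
      using exp_le_renewal_prob[of "e/4"] e by auto
    define bad where "bad = (\<lambda>L. {x\<in>space M. \<forall>n\<in>{K..L}. \<not> exp (- (real n * h)) \<le> point_mass M (name T \<alpha> n) (name T \<alpha> n x)})"
    have [measurable]: "(\<lambda>x. point_mass M (name T \<alpha> n) (name T \<alpha> n x)) \<in> borel_measurable M" for n
      by (rule measurable_compose[OF measurable_name[OF \<alpha>]]) auto
    have bad[measurable]: "bad L \<in> sets M" for L unfolding bad_def by measurable
    \<comment> \<open>The \<open>ln 2\<close> pays for \<open>renewal_prob 1 = 1 / 2\<close>, the
      price of a block of length 1.\<close>
    define s where "s = (\<lambda>x. info M \<alpha> x + ln 2)"
    have s0: "0 \<le> s x" for x using info_nonneg[of \<alpha> x] by (simp add: s_def)
    have is1: "integrable M s" unfolding s_def using i\<alpha> by auto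
    have "(\<lambda>L. \<integral>x. indicator (bad L) x * s x \<partial>M) \<longlonglongrightarrow> 0"
    proof (rule integral_indicator_tendsto_0[OF is1 bad])
      show "AE x in M. \<forall>\<^sub>F L in sequentially. x \<notin> bad L"
        using io
      proof eventually_elim
        case (elim x)
        then obtain n where "n \<ge> K" "exp (- (real n * h)) \<le> point_mass M (name T \<alpha> n) (name T \<alpha> n x)" by blast
        then show ?case by (intro eventually_sequentiallyI[of n]) (auto simp: bad_def)
      qed
    qed
    then have "\<forall>\<^sub>F L in sequentially. (\<integral>x. indicator (bad L) x * s x \<partial>M) < e / 4"
      using e by (intro order_tendstoD) auto
    then obtain L where L: "(\<integral>x. indicator (bad L) x * s x \<partial>M) < e / 4"
      by (auto simp: eventually_sequentially)
    \<comment> \<open>On top of \<open>h\<close>, a position costs \<open>e / 4\<close> for the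
      block lengths and, on average, less than \<open>e / 4\<close> for single letters at points
      where no suitable block starts.\<close>
    define b where "b = (\<lambda>x. h + e / 4 + indicator (bad L) x * s x)"
    have ibs: "integrable M (\<lambda>x. indicator (bad L) x * s x)"
      using is1 by (simp add: integrable_mult_indicator[of "bad L" M s, simplified])
    have ib: "integrable M b" unfolding b_def using ibs by auto
    have intb: "integral\<^sup>L M b \<le> h + e / 2"
      unfolding b_def using ibs L prob_space by (subst Bochner_Integration.integral_add) auto
    define U where "U = (\<lambda>N x. \<Sum>t<N. b ((T ^^ t) x) + (if N \<le> t + L then 1 else 0) * s ((T ^^ t) x))"
    have iU: "integrable M (U N)" for N
      unfolding U_def by (intro Bochner_Integration.integrable_sum Bochner_Integration.integrable_add integrable_mult_right integrable_iter ib is1)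
    have intU: "integral\<^sup>L M (U N) \<le> real N * (h + e / 2) + real L * integral\<^sup>L M s" for N
    proof -
      have "integral\<^sup>L M (U N) = (\<Sum>t<N. integral\<^sup>L M b + (if N \<le> t + L then 1 else 0) * integral\<^sup>L M s)"
        unfolding U_def
        by (subst Bochner_Integration.integral_sum)
           (auto intro!: Bochner_Integration.integrable_add integrable_mult_right integrable_iter ib is1 sum.cong
             simp: Bochner_Integration.integral_add integrable_iter ib is1 integral_iter borel_measurable_integrable[OF ib] borel_measurable_integrable[OF is1])
      also have "\<dots> = real N * integral\<^sup>L M b + real (card {t\<in>{..<N}. N \<le> t + L}) * integral\<^sup>L M s"
        by (simp add: sum.distrib sum_distrib_right[symmetric] sum.If_cases Int_def)
      also have "\<dots> \<le> real N * (h + e / 2) + real L * integral\<^sup>L M s"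
      proof (intro add_mono mult_left_mono mult_right_mono intb)
        have "card {t\<in>{..<N}. N \<le> t + L} \<le> card {N-L..<N}" by (intro card_mono) auto
        then show "real (card {t\<in>{..<N}. N \<le> t + L}) \<le> real L" by simp
      qed (auto simp: s0)
      finally show ?thesis .
    qed
    have AEU: "AE x in M. exp (- U N x) \<le> renewal_weight p (name T \<alpha> N x)" for N
      using AE_all_iter[OF AE_exp_info[OF \<alpha>]] AE_space
    proof eventually_elim
      case (elim x)
      have "exp (- (\<Sum>t<N. h + e / 4 + (if (T ^^ t) x \<in> space M - bad L then 0 else s ((T ^^ t) x)) +
         (if N \<le> t + L then s ((T ^^ t) x) else 0))) \<le> renewal_weight p (name T \<alpha> N x)"
      proof (rule renewal_weight_lower[where K=K, OF p0 s0 h _ K])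
        show "\<exists>n\<in>{K..L}. exp (- (real n * h)) \<le> p (name T \<alpha> n ((T ^^ t) x))" if "(T ^^ t) x \<in> space M - bad L" for t
          using that by (auto simp: bad_def p_def)
        show "exp (- s ((T ^^ t) x)) \<le> p [\<alpha> ((T ^^ t) x)] / 2" for t
        proof -
          have "point_mass M (name T \<alpha> 1) [a] = point_mass M \<alpha> a" for a
            by (auto simp: point_mass_def name_def intro!: arg_cong[where f="measure M"])
          then have "p [a] = point_mass M \<alpha> a" for a by (simp add: p_def)
          moreover have "exp (- s y) = exp (- info M \<alpha> y) / 2" for y
            by (simp add: s_def exp_diff)
          ultimately show ?thesis using elim(1) by simp
        qed
      qed (use e in auto)
      moreover have "(\<Sum>t<N. h + e / 4 + (if (T ^^ t) x \<in> space M - bad L then 0 else s ((T ^^ t) x)) +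
         (if N \<le> t + L then s ((T ^^ t) x) else 0)) = U N x"
        unfolding U_def b_def using elim(2) by (intro sum.cong) (auto simp: iter_space)
      ultimately show ?case by simp
    qed
    define r where "r = Suc (Max (\<xi> ` space M))"
    have r: "\<xi> x < r" if "x \<in> space M" for x unfolding r_def using fin that by (simp add: less_Suc_eq_le)
    have r0: "0 < r" by (simp add: r_def)
    \<comment> \<open>The kernel puts mass \<open>1 - d\<close> on the predicted letter and
      \<open>d / r\<close> on each other one. A correct prediction then costs \<open>e / 4\<close>,
      a wrong one \<open>c\<close>, and the tolerance \<open>e / 4 / (1 + c)\<close> below keeps the
      mean cost of errors at most \<open>e / 4\<close>.\<close>
    define d where "d = 1 - exp (- (e / 4))"
    have d: "0 < d" "d < 1" using e by (auto simp: d_def)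
    define c where "c = ln (real r / d)"
    have c0: "0 \<le> c" unfolding c_def using d r0 by (intro ln_ge_zero) (auto simp: field_simps)
    have ec: "0 < e / 4 / (1 + c)" using e c0 by simp
    obtain \<eta> m where \<eta>: "\<forall>u. \<eta> u < r" "measure M {x\<in>space M. \<xi> x \<noteq> \<eta> (name T \<alpha> m x)} < e / 4 / (1 + c)"
      by (rule approx_code[OF \<alpha> gen \<xi> r r0 ec]) blast
    define Bd where "Bd = {x\<in>space M. \<xi> x \<noteq> \<eta> (name T \<alpha> m x)}"
    have Bd[measurable]: "Bd \<in> sets M"
    proof -
      have "Bd = (\<Union>a. {x\<in>space M. \<xi> x \<noteq> a} \<inter> {x\<in>space M. name T \<alpha> m x \<in> {u. \<eta> u = a}})"
        by (auto simp: Bd_def)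
      also have "\<dots> \<in> sets M"
        by (intro sets.countable_UN'' sets.Int sets_name[OF \<alpha>]) auto
      finally show ?thesis .
    qed
    define \<kappa> where "\<kappa> = (\<lambda>u b. if b = \<eta> u then 1 - d else if b < r then d / r else 0)"
    have \<kappa>0: "0 \<le> \<kappa> u b" for u b using d by (simp add: \<kappa>_def)
    have \<kappa>1: "(\<integral>\<^sup>+b. ennreal (\<kappa> u b) \<partial>count_space UNIV) \<le> 1" for u
    proof -
      have "(\<integral>\<^sup>+b. ennreal (\<kappa> u b) \<partial>count_space UNIV) = (\<Sum>b<r. ennreal (\<kappa> u b))"
        using \<eta>(1)[rule_format, of u] by (intro nn_integral_count_space'[of "{..<r}"]) (auto simp: \<kappa>_def)
      also have "\<dots> = ennreal (\<Sum>b<r. \<kappa> u b)" using \<kappa>0 by (simp add: sum_ennreal)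
      also have "(\<Sum>b<r. \<kappa> u b) \<le> (\<Sum>b<r. (if b = \<eta> u then 1 - d else 0) + d / r)"
        using d by (intro sum_mono) (auto simp: \<kappa>_def)
      also have "\<dots> = 1" using \<eta>(1)[rule_format, of u] r0 by (simp add: sum.distrib)
      finally show ?thesis by (simp add: ennreal_leI flip: ennreal_1)
    qed
    define v where "v = (\<lambda>x. e / 4 + indicator Bd x * c)"
    have iv: "integrable M v" unfolding v_def by (auto simp: emeasure_eq_measure)
    have "integral\<^sup>L M v = e / 4 + measure M Bd * c"
      unfolding v_def using prob_space by (subst Bochner_Integration.integral_add) (auto simp: emeasure_eq_measure)
    moreover have "measure M Bd * c \<le> e / 4"
    proof -
      have "measure M Bd * c \<le> e / 4 / (1 + c) * c" using \<eta>(2) c0 by (intro mult_right_mono) (auto simp: Bd_def)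
      also have "\<dots> \<le> e / 4" using c0 e by (simp add: field_simps)
      finally show ?thesis .
    qed
    ultimately have intv: "integral\<^sup>L M v \<le> e / 2" by simp
    have AEv: "AE x in M. exp (- v x) \<le> \<kappa> (name T \<alpha> m x) (\<xi> x)"
    proof (rule AE_I2)
      fix x assume x: "x \<in> space M"
      show "exp (- v x) \<le> \<kappa> (name T \<alpha> m x) (\<xi> x)"
      proof (cases "x \<in> Bd")
        case True
        have "exp (- v x) = exp (- (e / 4)) * exp (- c)" using True by (simp add: v_def exp_add[symmetric])
        also have "\<dots> \<le> 1 * exp (- c)" using e by (intro mult_right_mono) auto
        also have "\<dots> = d / r" using d r0 by (simp add: c_def exp_minus field_simps)
        finally show ?thesis using True r[OF x] by (simp add: \<kappa>_def Bd_def)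
      next
        case False
        then show ?thesis using x by (simp add: \<kappa>_def Bd_def v_def d_def)
      qed
    qed
    have "part_entropy M (name T \<xi> n) \<le> real n * (h + e) + (real m * (h + e / 2) + real L * integral\<^sup>L M s)" for n
    proof -
      have "part_entropy M (name T \<xi> n) = integral\<^sup>L M (info M (name T \<xi> n))"
        by (rule part_entropy_eq[OF measurable_name[OF \<xi>] finite_name[OF fin]])
      also have "\<dots> \<le> integral\<^sup>L M (U (n + m)) + real n * integral\<^sup>L M v"
        by (rule integral_info_coding[OF \<alpha> \<xi> renewal_weight_nonneg[OF p0] subprob_renewal_weight[OF p0 p1] \<kappa>0 \<kappa>1 iU AEU iv AEv])
      also have "\<dots> \<le> (real (n + m) * (h + e / 2) + real L * integral\<^sup>L M s) + real n * (e / 2)"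
        using intU[of "n + m"] mult_left_mono[OF intv, of "real n"] by simp
      finally show ?thesis by (simp add: algebra_simps add_divide_distrib)
    qed
    then show ?thesis by (rule entropy_rel_le[OF \<xi> fin])
  qed
  show ?thesis unfolding ks_entropy_def
  proof (rule SUP_least)
    fix \<xi> :: "'a \<Rightarrow> nat" assume "\<xi> \<in> {\<xi>. \<xi> \<in> M \<rightarrow>\<^sub>M count_space UNIV \<and> finite (\<xi> ` space M)}"
    then have "entropy_rel M T \<xi> \<le> h + e" if "0 < e" for e using key that by auto
    then have "entropy_rel M T \<xi> \<le> h" by (rule field_le_epsilon)
    then show "ereal (entropy_rel M T \<xi>) \<le> ereal h" by simp
  qed
qed

section \<open>Shannon--McMillan in probability\<close>

lemma (in mps) sets_point_mass_name:
  assumes "\<alpha> \<in> measurable M (count_space UNIV)"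
  shows "{x\<in>space M. c \<le> point_mass M (name T \<alpha> n) (name T \<alpha> n x)} \<in> sets M"
    "{x\<in>space M. point_mass M (name T \<alpha> n) (name T \<alpha> n x) < c} \<in> sets M"
  using sets_name[OF assms, of n "{w. c \<le> point_mass M (name T \<alpha> n) w}"]
    sets_name[OF assms, of n "{w. point_mass M (name T \<alpha> n) w < c}"] by simp_all

text \<open>The cell of \<open>x\<close> lies in the preimage of the cell of \<open>T x\<close> of
  order one less, and taking preimages preserves measure.\<close>

lemma (in mps) point_mass_name_Suc_le:
  assumes \<alpha>: "\<alpha> \<in> measurable M (count_space UNIV)"
  shows "point_mass M (name T \<alpha> (Suc n)) (name T \<alpha> (Suc n) x) \<le> point_mass M (name T \<alpha> n) (name T \<alpha> n (T x))"
proof -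
  let ?A = "name T \<alpha> n -` {name T \<alpha> n (T x)} \<inter> space M"
  have A: "?A \<in> sets M" using measurable_name[OF \<alpha>] by (simp add: measurable_sets)
  have "point_mass M (name T \<alpha> (Suc n)) (name T \<alpha> (Suc n) x) \<le> measure M ((T ^^ 1) -` ?A \<inter> space M)"
    unfolding point_mass_def
    using measurable_sets[OF measurable_iter A, of 1] iter_space[of _ 1]
    by (intro finite_measure_mono) (auto simp: name_Suc)
  also have "\<dots> = point_mass M (name T \<alpha> n) (name T \<alpha> n (T x))"
    unfolding measure_iter[OF A] by (simp add: point_mass_def)
  finally show ?thesis .
qed

text \<open>The slack \<open>C\<close> makes the set of points lying in infinitely many large cells \<open>T\<close>-subinvariant,
  so that ergodicity applies.\<close>

lemma (in ergodic_mps) frequently_large_cells: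
  assumes \<alpha>[measurable]: "\<alpha> \<in> measurable M (count_space UNIV)" and h: "h < h'"
    and e: "0 < e" "\<exists>\<^sub>F n in sequentially. e \<le> measure M {x\<in>space M. exp (- (real n * h)) \<le> point_mass M (name T \<alpha> n) (name T \<alpha> n x)}"
  shows "AE x in M. \<forall>K. \<exists>n\<ge>K. exp (- (real n * h')) \<le> point_mass M (name T \<alpha> n) (name T \<alpha> n x)"
proof -
  define p where "p = (\<lambda>n x. point_mass M (name T \<alpha> n) (name T \<alpha> n x))"
  have [measurable]: "p n \<in> borel_measurable M" for n unfolding p_def
    by (rule measurable_compose[OF measurable_name[OF \<alpha>]]) auto
  define R where "R = {x\<in>space M. \<exists>C::nat. \<forall>K. \<exists>n\<ge>K. exp (- (real n * h) - real C) \<le> p n x}"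
  have R[measurable]: "R \<in> sets M" unfolding R_def by measurable
  define E where "E = (\<lambda>n. {x\<in>space M. exp (- (real n * h)) \<le> p n x})"
  have E[measurable]: "E n \<in> sets M" for n unfolding E_def by measurable
  have R_T: "T x \<in> R" if "x \<in> R" for x
  proof -
    from that obtain C :: nat where x: "x \<in> space M" and C: "\<And>K. \<exists>n\<ge>K. exp (- (real n * h) - real C) \<le> p n x"
      by (auto simp: R_def)
    \<comment> \<open>Moving to \<open>T x\<close> replaces \<open>n\<close> by
      \<open>n - 1\<close>; the larger slack \<open>D\<close> absorbs the resulting factor
      \<open>exp h\<close>.\<close>
    obtain D :: nat where D: "real C + h \<le> real D" using real_arch_simple by blast
    have "\<exists>n\<ge>K. exp (- (real n * h) - real D) \<le> p n (T x)" for K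
    proof -
      obtain n where n: "n \<ge> Suc K" "exp (- (real n * h) - real C) \<le> p n x" using C by blast
      then obtain m where m: "n = Suc m" by (cases n) auto
      have "exp (- (real m * h) - real D) \<le> exp (- (real n * h) - real C)"
        using D m by (simp add: algebra_simps)
      also have "\<dots> \<le> p n x" by fact
      also have "\<dots> \<le> p m (T x)" unfolding p_def m by (rule point_mass_name_Suc_le[OF \<alpha>])
      finally show ?thesis using n m by auto
    qed
    then show ?thesis using x iter_space[of x 1] by (auto simp: R_def)
  qed
  \<comment> \<open>So far \<open>R\<close> is only known to be mapped into itself. Its preimages
    increase to an invariant set and all have the measure of \<open>R\<close>, so ergodicity yields
    a zero-one law for \<open>R\<close>.\<close>
  define Rk where "Rk = (\<lambda>k. (T ^^ k) -` R \<inter> space M)"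
  have Rk[measurable]: "Rk k \<in> sets M" for k unfolding Rk_def using R by (rule measurable_sets[OF measurable_iter])
  have mono: "incseq Rk"
    by (intro incseq_SucI) (auto simp: Rk_def intro: R_T)
  have "T -` (\<Union>k. Rk k) \<inter> space M = (\<Union>k. Rk k)"
  proof (intro equalityI subsetI)
    fix x assume "x \<in> T -` (\<Union>k. Rk k) \<inter> space M"
    then obtain k where "x \<in> space M" "(T ^^ k) (T x) \<in> R" by (auto simp: Rk_def)
    then show "x \<in> (\<Union>k. Rk k)" by (auto simp: Rk_def funpow_swap1 intro!: exI[of _ "Suc k"])
  next
    fix x assume "x \<in> (\<Union>k. Rk k)"
    then obtain k where "x \<in> space M" "(T ^^ k) x \<in> R" by (auto simp: Rk_def)
    then show "x \<in> T -` (\<Union>k. Rk k) \<inter> space M"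
      using R_T[of "(T ^^ k) x"] iter_space[of x 1] by (auto simp: Rk_def funpow_swap1 intro!: exI[of _ k])
  qed
  then have 01: "measure M (\<Union>k. Rk k) = 0 \<or> measure M (\<Union>k. Rk k) = 1"
    by (intro ergodicD) auto
  have "(\<lambda>k. measure M (Rk k)) \<longlonglongrightarrow> measure M (\<Union>k. Rk k)"
    using mono by (intro finite_Lim_measure_incseq) auto
  moreover have "measure M (Rk k) = measure M R" for k unfolding Rk_def by (rule measure_iter[OF R])
  ultimately have eqR: "measure M (\<Union>k. Rk k) = measure M R"
    by (simp add: LIMSEQ_const_iff)
  \<comment> \<open>The points lying in infinitely many \<open>E n\<close> have measure at least
    \<open>e\<close>, because infinitely many \<open>E n\<close> do. They belong to \<open>R\<close>
    with slack 0.\<close>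
  have "e \<le> measure M R"
  proof -
    have "(\<lambda>N. measure M (\<Union>n\<in>{N..}. E n)) \<longlonglongrightarrow> measure M (\<Inter>N. \<Union>n\<in>{N..}. E n)"
      by (intro finite_Lim_measure_decseq) (auto simp: decseq_def intro: order.trans)
    moreover have "e \<le> measure M (\<Union>n\<in>{N..}. E n)" for N
    proof -
      obtain n where "n \<ge> N" "e \<le> measure M (E n)"
        using e(2) unfolding frequently_sequentially E_def p_def by blast
      moreover have "measure M (E n) \<le> measure M (\<Union>n\<in>{N..}. E n)"
        using \<open>n \<ge> N\<close> by (intro finite_measure_mono) auto
      ultimately show ?thesis by linarith
    qed
    ultimately have "e \<le> measure M (\<Inter>N. \<Union>n\<in>{N..}. E n)"
      by (intro LIMSEQ_le_const) auto
    also have "\<dots> \<le> measure M R"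
    proof (intro finite_measure_mono R subsetI)
      fix x assume x: "x \<in> (\<Inter>N. \<Union>n\<in>{N..}. E n)"
      then have "\<exists>n\<ge>K. exp (- (real n * h) - real 0) \<le> p n x" for K
        by (auto simp: E_def dest!: INT_D[of x _ _ K])
      with x show "x \<in> R" unfolding R_def E_def by blast
    qed
    finally show ?thesis .
  qed
  with 01 eqR e(1) have "measure M R = 1" by auto
  then have "AE x in M. x \<in> R" using R by (simp add: AE_in_set_eq_1)
  then show ?thesis
  proof eventually_elim
    case (elim x)
    then obtain C :: nat where C: "\<And>K. \<exists>n\<ge>K. exp (- (real n * h) - real C) \<le> p n x"
      by (auto simp: R_def)
    obtain n0 :: nat where n0: "real C / (h' - h) \<le> real n0" using real_arch_simple by blast
    show ?case
    proof
      fix K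
      obtain n where n: "n \<ge> max K n0" "exp (- (real n * h) - real C) \<le> p n x" using C by blast
      have "real C / (h' - h) \<le> real n" using n0 n by linarith
      then have "real C \<le> real n * (h' - h)" using h by (simp add: pos_divide_le_eq)
      then have "exp (- (real n * h')) \<le> exp (- (real n * h) - real C)" by (simp add: algebra_simps)
      with n(2) have "exp (- (real n * h')) \<le> p n x" by linarith
      with n show "\<exists>n\<ge>K. exp (- (real n * h')) \<le> point_mass M (name T \<alpha> n) (name T \<alpha> n x)"
        by (auto simp: p_def intro!: exI[of _ n])
    qed
  qed
qed

text \<open>Otherwise large cells keep a fixed share of the measure at infinitely many orders.
  Ergodicity makes them recur at almost every point at any rate above \<open>h\<close>, and
  \<open>ks_entropy_le\<close> then bounds the entropy by a rate chosen strictly below it.\<close>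

lemma (in ergodic_mps) large_cells_tendsto_0:
  assumes \<alpha>[measurable]: "\<alpha> \<in> measurable M (count_space UNIV)" and i\<alpha>: "integrable M (info M \<alpha>)"
    and gen: "generating M T \<alpha>" and h: "ereal h < ks_entropy M T"
  shows "(\<lambda>n. measure M {x\<in>space M. exp (- (real n * h)) \<le> point_mass M (name T \<alpha> n) (name T \<alpha> n x)}) \<longlonglongrightarrow> 0"
    (is "?m \<longlonglongrightarrow> 0")
proof (cases "h < 0")
  case True
  have "?m n = 0" if "n \<ge> 1" for n
  proof -
    \<comment> \<open>\<open>ks_entropy_le\<close> covers nonnegative rates. For a negative one the
      threshold exceeds every probability.\<close>
    have "1 < exp (- (real n * h))" using that True by (simp add: mult_pos_neg)
    then have "\<not> exp (- (real n * h)) \<le> point_mass M (name T \<alpha> n) w" for w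
      using point_mass_le_1[of "name T \<alpha> n" w] by linarith
    then show ?thesis by simp
  qed
  then show ?thesis by (intro tendsto_eventually eventually_sequentiallyI[of 1]) auto
next
  case False
  show ?thesis
  proof (rule ccontr)
    assume "\<not> ?m \<longlonglongrightarrow> 0"
    then obtain e where e: "0 < e" "\<not> (\<forall>\<^sub>F n in sequentially. dist (?m n) 0 < e)"
      unfolding tendsto_iff by blast
    then have fr: "\<exists>\<^sub>F n in sequentially. e \<le> ?m n"
      by (simp add: not_eventually not_less)
    obtain h' where h': "h < h'" "ereal h' < ks_entropy M T"
      using ereal_dense2[OF h] by auto
    have "ks_entropy M T \<le> ereal h'"
      using False h' by (intro ks_entropy_le[OF \<alpha> i\<alpha> gen] frequently_large_cells[OF \<alpha> h'(1) e(1) fr]) auto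
    with h' show False by simp
  qed
qed

text \<open>The information of most points is at least \<open>n (k - g)\<close> by the bound on large cells, while its mean is
  at most \<open>n (k + g)\<close>, so it can exceed \<open>n h\<close> only with small probability.\<close>

lemma (in ergodic_mps) small_cells_tendsto_0:
  assumes \<alpha>[measurable]: "\<alpha> \<in> measurable M (count_space UNIV)" and i\<alpha>: "integrable M (info M \<alpha>)"
    and gen: "generating M T \<alpha>" and k: "0 \<le> ks_entropy M T" "ks_entropy M T < ereal h"
  shows "(\<lambda>n. measure M {x\<in>space M. point_mass M (name T \<alpha> n) (name T \<alpha> n x) < exp (- (real n * h))}) \<longlonglongrightarrow> 0"
    (is "?m \<longlonglongrightarrow> 0")
proof (rule tendstoI)
  fix e :: real assume e: "0 < e"
  from k obtain k where k: "ks_entropy M T = ereal k" "0 \<le> k" "k < h"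
    by (cases "ks_entropy M T") auto
  \<comment> \<open>With these values \<open>2 * g\<close> and \<open>k * d\<close> are each at most
    \<open>(h - k) * e / 4\<close>, so the final comparison is strict. Writing \<open>k + 1\<close>
    keeps the denominator positive when \<open>k = 0\<close>.\<close>
  define g where "g = (h - k) * e / 8"
  define d where "d = (h - k) * e / (4 * (k + 1))"
  have gd: "0 < g" "0 < d" using k e by (auto simp: g_def d_def)
  have "ereal (k - g) < ks_entropy M T" using k gd by simp
  from large_cells_tendsto_0[OF \<alpha> i\<alpha> gen this]
  have E: "\<forall>\<^sub>F n in sequentially. measure M {x\<in>space M. exp (- (real n * (k - g))) \<le> point_mass M (name T \<alpha> n) (name T \<alpha> n x)} < d"
    using gd by (intro order_tendstoD) auto
  have I: "\<forall>\<^sub>F n in sequentially. integrable M (info M (name T \<alpha> n)) \<and>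
    integral\<^sup>L M (info M (name T \<alpha> n)) \<le> real n * (k + g)"
    using info_name_le[OF \<alpha> i\<alpha> _ gd(1)] k by simp
  show "\<forall>\<^sub>F n in sequentially. dist (?m n) 0 < e"
    using E I eventually_ge_at_top[of 1]
  proof eventually_elim
    case (elim n)
    define p where "p = (\<lambda>x. point_mass M (name T \<alpha> n) (name T \<alpha> n x))"
    define L where "L = {x\<in>space M. exp (- (real n * (k - g))) \<le> p x}"
    define B where "B = {x\<in>space M. p x < exp (- (real n * h))}"
    have [measurable]: "L \<in> sets M" "B \<in> sets M"
      unfolding L_def B_def p_def by (rule sets_point_mass_name[OF \<alpha>])+
    have disj: "L \<inter> B = {}"
    proof -
      have "exp (- (real n * h)) \<le> exp (- (real n * (k - g)))" using k gd by (simp add: mult_left_mono)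
      then have "\<not> (exp (- (real n * (k - g))) \<le> p x \<and> p x < exp (- (real n * h)))" for x by linarith
      then show ?thesis unfolding L_def B_def by blast
    qed
    \<comment> \<open>Small cells carry information at least \<open>n * h\<close>, large ones at
      least 0, and all others at least \<open>n * (k - g)\<close>.\<close>
    have le: "AE x in M. real n * (h * indicator B x + (k - g) * (1 - indicator B x - indicator L x)) \<le> info M (name T \<alpha> n) x"
      using AE_point_mass_pos[OF measurable_name[OF \<alpha>], of n] AE_space
    proof eventually_elim
      case (elim x)
      consider "x \<in> L" "x \<notin> B" | "x \<in> B" "x \<notin> L" | "x \<notin> B" "x \<notin> L" using disj by auto
      then show ?case
      proof cases
        case 1
        then show ?thesis by (simp add: info_nonneg)
      next
        case 2
        then have "ln (p x) \<le> ln (exp (- (real n * h)))" using elim by (subst ln_le_cancel_iff) (auto simp: B_def p_def)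
        then show ?thesis using 2 by (simp add: info_def p_def)
      next
        case 3
        then have "ln (p x) \<le> ln (exp (- (real n * (k - g))))" using elim by (subst ln_le_cancel_iff) (auto simp: L_def p_def)
        then show ?thesis using 3 by (simp add: info_def p_def)
      qed
    qed
    have "(\<integral>x. real n * (h * indicator B x + (k - g) * (1 - indicator B x - indicator L x)) \<partial>M) \<le> real n * (k + g)"
      using elim(2) by (intro order.trans[OF integral_mono_AE[OF _ _ le]]) (auto simp: emeasure_eq_measure)
    also have "(\<integral>x. real n * (h * indicator B x + (k - g) * (1 - indicator B x - indicator L x)) \<partial>M)
      = real n * (h * measure M B + (k - g) * (1 - measure M B - measure M L))"
      using prob_space by (simp add: emeasure_eq_measure)
    finally have "h * measure M B + (k - g) * (1 - measure M B - measure M L) \<le> k + g"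
      using elim(3) by simp
    then have "(h - k) * measure M B + g * measure M B + g * measure M L \<le> 2 * g + k * measure M L"
      by (simp add: algebra_simps)
    moreover have "0 \<le> g * measure M B" "0 \<le> g * measure M L" using gd by auto
    moreover have "k * measure M L \<le> k * d" using elim(1) k by (intro mult_left_mono) (auto simp: L_def p_def)
    moreover have "k * d < (h - k) * e / 4 + (h - k) * e / 4"
    proof -
      have "k * d \<le> (k + 1) * d" using gd by simp
      also have "\<dots> = (h - k) * e / 4" using k by (simp add: d_def field_simps)
      finally show ?thesis using k e mult_pos_pos[of "h - k" e] by linarith
    qed
    ultimately have "(h - k) * measure M B < (h - k) * e" using k e mult_pos_pos[of "h - k" e] unfolding g_def by linarith
    then have "measure M B < e" using k by simp
    then show ?case by (simp add: B_def p_def)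
  qed
qed

section \<open>Piecewise monotone interval maps\<close>

definition approx_by_names :: "'a measure \<Rightarrow> ('a \<Rightarrow> 'a) \<Rightarrow> ('a \<Rightarrow> nat) \<Rightarrow> 'a set \<Rightarrow> bool" where
  "approx_by_names M T \<alpha> A \<longleftrightarrow> A \<in> sets M \<and>
     (\<forall>e>0. \<exists>m S. measure M (sym_diff A {x \<in> space M. name T \<alpha> m x \<in> S}) < e)"

lemma (in prob_space) measure_sym_diff_trans:
  assumes "A \<in> sets M" "B \<in> sets M" "C \<in> sets M"
  shows "measure M (sym_diff A C) \<le> measure M (sym_diff A B) + measure M (sym_diff B C)"
proof -
  have "measure M (sym_diff A C) \<le> measure M (sym_diff A B \<union> sym_diff B C)"
    using assms by (intro finite_measure_mono) auto
  also have "\<dots> \<le> measure M (sym_diff A B) + measure M (sym_diff B C)"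
    using assms by (intro measure_Un_le) auto
  finally show ?thesis .
qed

text \<open>In a countable union all but \<open>n\<close> members are dropped at a cost below
  \<open>e / 2\<close>, the remaining ones are approximated with total error at most
  \<open>e / 2\<close>, and the longest name involved determines the others. Complements only
  replace \<open>S\<close> by its complement.\<close>

lemma (in mps) approx_by_names_sigma:
  assumes \<alpha>: "\<alpha> \<in> measurable M (count_space UNIV)"
    and G: "\<And>A. A \<in> G \<Longrightarrow> approx_by_names M T \<alpha> A" and C: "C \<in> sigma_sets (space M) G"
  shows "approx_by_names M T \<alpha> C"
  using C
proof (induction rule: sigma_sets.induct)
  case (Basic a)
  then show ?case by (rule G)
next
  case Empty
  show ?case unfolding approx_by_names_def by (auto intro!: exI[of _ "{}"])
next
  case (Compl a)
  show ?case unfolding approx_by_names_def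
  proof (intro conjI allI impI)
    fix e :: real assume "e > 0"
    then obtain m S where mS: "measure M (sym_diff a {x \<in> space M. name T \<alpha> m x \<in> S}) < e"
      using Compl.IH by (auto simp: approx_by_names_def)
    have "a \<subseteq> space M" using Compl.IH by (auto simp: approx_by_names_def dest: sets.sets_into_space)
    then have "sym_diff (space M - a) {x \<in> space M. name T \<alpha> m x \<in> - S} = sym_diff a {x \<in> space M. name T \<alpha> m x \<in> S}"
      by auto
    with mS show "\<exists>m S. measure M (sym_diff (space M - a) {x \<in> space M. name T \<alpha> m x \<in> S}) < e"
      by (intro exI[of _ m] exI[of _ "- S"]) simp
  qed (use Compl.IH in \<open>auto simp: approx_by_names_def\<close>)
next
  case (Union a)
  have a: "a i \<in> sets M" for i using Union.IH by (simp add: approx_by_names_def)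
  show ?case unfolding approx_by_names_def
  proof (intro conjI allI impI)
    fix e :: real assume e: "e > 0"
    define D where "D = (\<lambda>n. (\<Union>i. a i) - (\<Union>i<n. a i))"
    have D[measurable]: "D n \<in> sets M" for n unfolding D_def using a by auto
    have "decseq D" by (force simp: decseq_def D_def)
    then have "(\<lambda>n. measure M (D n)) \<longlonglongrightarrow> measure M (\<Inter>n. D n)"
      using D by (intro finite_Lim_measure_decseq) auto
    moreover have "(\<Inter>n. D n) = {}" by (auto simp: D_def)
    ultimately have "\<forall>\<^sub>F n in sequentially. measure M (D n) < e / 2"
      using e by (intro order_tendstoD) auto
    then obtain n where n: "measure M (D n) < e / 2" by (auto simp: eventually_sequentially)
    define d where "d = e / (2 * real (Suc n))"
    have d: "d > 0" using e by (simp add: d_def)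
    have "\<forall>i. \<exists>m S. measure M (sym_diff (a i) {x \<in> space M. name T \<alpha> m x \<in> S}) < d"
      using Union.IH d by (simp add: approx_by_names_def)
    from choice[OF this] obtain m where "\<forall>i. \<exists>S. measure M (sym_diff (a i) {x \<in> space M. name T \<alpha> (m i) x \<in> S}) < d" ..
    from choice[OF this] obtain S where mS: "\<And>i. measure M (sym_diff (a i) {x \<in> space M. name T \<alpha> (m i) x \<in> S i}) < d" by auto
    define k where "k = Max (insert 0 (m ` {..<n}))"
    have mk: "m i \<le> k" if "i < n" for i unfolding k_def using that by (intro Max_ge) auto
    define S' where "S' = {w. \<exists>i<n. take (m i) w \<in> S i}"
    define E where "E = (\<lambda>i. sym_diff (a i) {x \<in> space M. name T \<alpha> (m i) x \<in> S i})"
    have E: "E i \<in> sets M" for i unfolding E_def using a sets_name[OF \<alpha>] by auto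
    have sub: "sym_diff (\<Union>i. a i) {x \<in> space M. name T \<alpha> k x \<in> S'} \<subseteq> D n \<union> (\<Union>i<n. E i)"
    proof (rule subsetI, rule ccontr)
      fix x assume x: "x \<in> sym_diff (\<Union>i. a i) {x \<in> space M. name T \<alpha> k x \<in> S'}" and n: "x \<notin> D n \<union> (\<Union>i<n. E i)"
      have a_sp: "x \<in> a i \<Longrightarrow> x \<in> space M" for i using a[of i] sets.sets_into_space by blast
      have *: "x \<in> a i \<longleftrightarrow> x \<in> space M \<and> take (m i) (name T \<alpha> k x) \<in> S i" if "i < n" for i
      proof -
        have "x \<notin> E i" using n that by blast
        then show ?thesis unfolding E_def take_name[OF mk[OF that]] by blast
      qed
      have "x \<in> (\<Union>i. a i) \<longleftrightarrow> (\<exists>i<n. x \<in> a i)" using n unfolding D_def by blast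
      also have "\<dots> \<longleftrightarrow> x \<in> space M \<and> name T \<alpha> k x \<in> S'" using * unfolding S'_def by blast
      finally show False using x by blast
    qed
    have "measure M (sym_diff (\<Union>i. a i) {x \<in> space M. name T \<alpha> k x \<in> S'}) \<le> measure M (D n \<union> (\<Union>i<n. E i))"
      using sub E D by (intro finite_measure_mono) auto
    also have "\<dots> \<le> measure M (D n) + measure M (\<Union>i<n. E i)"
      using E D by (intro measure_Un_le) auto
    also have "measure M (\<Union>i<n. E i) \<le> (\<Sum>i<n. measure M (E i))" using E by (intro measure_UNION_le) auto
    also have "\<dots> \<le> (\<Sum>i<n. d)" using mS by (intro sum_mono) (auto simp: E_def intro: less_imp_le)
    also have "\<dots> \<le> e / 2" using e by (simp add: d_def field_simps)
    finally show "\<exists>m S. measure M (sym_diff (\<Union>i. a i) {x \<in> space M. name T \<alpha> m x \<in> S}) < e"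
      using n by (intro exI[of _ k] exI[of _ S']) simp
  qed (use a in auto)
qed

section \<open>Coding an interval map by its partition\<close>

text \<open>Code 0 is reserved for points outside the interiors of the partition intervals.\<close>

definition icode :: "real set set \<Rightarrow> real \<Rightarrow> nat" where
  "icode \<A> x = (if \<exists>I\<in>\<A>. x \<in> interior I then Suc (to_nat_on \<A> (THE I. I \<in> \<A> \<and> x \<in> interior I)) else 0)"

lemma icode_eq:
  assumes "interval_partition \<A>" "I \<in> \<A>" "x \<in> interior I"
  shows "icode \<A> x = Suc (to_nat_on \<A> I)"
proof -
  have "(THE I. I \<in> \<A> \<and> x \<in> interior I) = I"
    using assms unfolding interval_partition_def by (intro the_equality) blast+
  then show ?thesis using assms by (auto simp: icode_def)
qed

lemma icode_SucD:
  assumes A: "interval_partition \<A>" and c: "icode \<A> x \<noteq> 0"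
  obtains I where "I \<in> \<A>" "x \<in> interior I" "icode \<A> x = Suc (to_nat_on \<A> I)"
  using c icode_eq[OF A] by (auto simp: icode_def split: if_splits)

lemma icode_iff:
  assumes A: "interval_partition \<A>" and I: "I \<in> \<A>"
  shows "icode \<A> x = Suc (to_nat_on \<A> I) \<longleftrightarrow> x \<in> interior I"
proof
  assume *: "icode \<A> x = Suc (to_nat_on \<A> I)"
  then obtain J where J: "J \<in> \<A>" "x \<in> interior J" "icode \<A> x = Suc (to_nat_on \<A> J)"
    using icode_SucD[OF A, of x] by auto
  have "countable \<A>" using A by (simp add: interval_partition_def)
  then have "J = I" using J I * by (simp add: inj_on_eq_iff[OF inj_on_to_nat_on])
  with J show "x \<in> interior I" by simp
qed (rule icode_eq[OF A I])

lemma interval_minus_interior: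
  fixes I :: "real set"
  assumes I: "is_interval I" "I \<subseteq> UI"
  shows "I - interior I \<subseteq> {Inf I, Sup I}"
proof
  fix x assume x: "x \<in> I - interior I"
  have bdd: "bdd_above I" "bdd_below I" using I(2) bdd_above_mono[of "{0..1}" I] bdd_below_mono[of "{0..1}" I] by (simp_all add: UI_def)
  show "x \<in> {Inf I, Sup I}"
  proof (rule ccontr)
    assume "x \<notin> {Inf I, Sup I}"
    then have "Inf I < x" "x < Sup I"
      using cInf_lower[of x I] cSup_upper[of x I] bdd x by auto
    then obtain a b where ab: "a \<in> I" "a < x" "b \<in> I" "x < b"
      using cInf_lessD[of I x] less_cSupD[of I x] x by auto
    have "{a<..<b} \<subseteq> I" using I(1) ab unfolding is_interval_1 by (meson greaterThanLessThan_iff less_imp_le subsetI)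
    then have "{a<..<b} \<subseteq> interior I" by (intro interior_maximal) auto
    with ab x show False by auto
  qed
qed

lemma interval_borel:
  fixes I :: "real set"
  assumes "is_interval I" "I \<subseteq> UI"
  shows "I \<in> sets borel"
proof -
  have "I = interior I \<union> (I - interior I)" using interior_subset by auto
  moreover have "finite (I - interior I)" using finite_subset[OF interval_minus_interior[OF assms]] by simp
  then have "I - interior I \<in> sets borel" by (intro borel_closed finite_imp_closed)
  moreover have "interior I \<in> sets borel" by simp
  ultimately show ?thesis by (metis sets.Un)
qed

lemma sets_lam_iff: "A \<in> sets lam \<longleftrightarrow> A \<subseteq> UI \<and> A \<in> sets borel"
  unfolding lam_def by (subst sets_restrict_space_iff) (auto simp: UI_def)

lemma space_lam: "space lam = UI"
  by (simp add: lam_def space_restrict_space)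

lemma prob_space_lam: "prob_space lam"
  by (rule prob_spaceI) (simp add: lam_def UI_def space_restrict_space emeasure_restrict_space)

lemma measure_eq_0_AE: "N \<in> sets M \<Longrightarrow> AE x in M. x \<notin> N \<Longrightarrow> measure M N = 0"
  by (simp add: AE_iff_null_sets[symmetric] measure_eq_0_null_sets)

locale interval_map =
  fixes T :: "real \<Rightarrow> real" and \<mu> :: "real measure" and \<A> :: "real set set"
  assumes class_T: "class_T T \<mu> \<A>"
begin

sublocale ergodic_mps \<mu> T
proof -
  interpret prob_space \<mu> using class_T by (simp add: class_T_def unit_prob_def)
  have "mpt \<mu> T" "ergodic \<mu> T" using class_T by (simp_all add: class_T_def)
  then show "ergodic_mps \<mu> T" by unfold_locales
qed

lemma sets_\<mu>: "sets \<mu> = sets lam" and space_\<mu>: "space \<mu> = UI"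
  using class_T sets_eq_imp_space_eq[of \<mu> lam] by (auto simp: class_T_def unit_prob_def space_lam)

lemma part: "interval_partition \<A>"
  using class_T by (simp add: class_T_def)

lemma equiv_lam:
  obtains c where "1 \<le> c" "\<And>A. A \<in> sets lam \<Longrightarrow> measure \<mu> A \<le> c * measure lam A"
    "\<And>A. A \<in> sets lam \<Longrightarrow> measure lam A \<le> c * measure \<mu> A"
proof -
  from class_T obtain c where "c \<ge> 1" "\<forall>A\<in>sets lam. measure \<mu> A / c \<le> measure lam A \<and> measure lam A \<le> c * measure \<mu> A"
    by (auto simp: class_T_def)
  then show ?thesis by (intro that[of c]) (auto simp: field_simps)
qed

lemma null_if_lam_null:
  assumes "A \<in> null_sets lam"
  shows "A \<in> null_sets \<mu>"
proof -
  from equiv_lam obtain c where c: "measure \<mu> A \<le> c * measure lam A" using assms by (metis null_setsD2)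
  have "measure lam A = 0" using assms by (simp add: null_sets_def measure_def)
  then have "measure \<mu> A = 0" using c measure_nonneg[of \<mu> A] by simp
  then show ?thesis using assms by (auto simp: null_sets_def sets_\<mu> emeasure_eq_measure)
qed

abbreviation "\<alpha> \<equiv> icode \<A>"

text \<open>Off this null set, lying in a partition interval and lying in its interior are the same,
  so letters describe the given partition exactly.\<close>

definition Z :: "real set" where
  "Z = (UI - \<Union>\<A>) \<union> (\<Union>I\<in>\<A>. I - interior I)"

lemma A_interval: "I \<in> \<A> \<Longrightarrow> is_interval I" and A_sub: "I \<in> \<A> \<Longrightarrow> I \<subseteq> UI"
  and A_countable: "countable \<A>"
  using part by (auto simp: interval_partition_def)

lemma A_sets: "I \<in> \<A> \<Longrightarrow> I \<in> sets lam" "I \<in> \<A> \<Longrightarrow> interior I \<in> sets lam"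
  using interval_borel[OF A_interval A_sub] A_sub order.trans[OF interior_subset A_sub] by (simp_all add: sets_lam_iff)

lemma Z_null: "Z \<in> null_sets \<mu>"
proof (rule null_if_lam_null)
  have "\<Union>\<A> \<in> sets lam" using A_countable A_sets by (intro sets.countable_Union) auto
  then have "UI - \<Union>\<A> \<in> sets lam" using sets.compl_sets[of _ lam] by (simp add: space_lam)
  then have "UI - \<Union>\<A> \<in> null_sets lam" using part by (auto simp: interval_partition_def null_sets_def)
  moreover have "I - interior I \<in> null_sets lam" if "I \<in> \<A>" for I
  proof -
    have fin: "finite (I - interior I)"
      using finite_subset[OF interval_minus_interior[OF A_interval A_sub]] that by simp
    have "emeasure lam (I - interior I) = emeasure lborel (I - interior I)"
      unfolding lam_def using A_sub[OF that] by (intro emeasure_restrict_space) (auto simp: UI_def)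
    also have "\<dots> = 0" using fin by (intro emeasure_lborel_countable countable_finite)
    finally show ?thesis using A_sets[OF that] by (auto simp: null_sets_def)
  qed
  ultimately show "Z \<in> null_sets lam" unfolding Z_def using A_countable by (intro null_sets.Un null_sets_UN') auto
qed

lemma not_Z: "x \<in> UI \<Longrightarrow> x \<notin> Z \<Longrightarrow> \<alpha> x \<noteq> 0"
  unfolding Z_def using icode_eq[OF part] by force

lemma not_Z_iff: "I \<in> \<A> \<Longrightarrow> x \<notin> Z \<Longrightarrow> x \<in> I \<longleftrightarrow> \<alpha> x = Suc (to_nat_on \<A> I)"
  unfolding icode_iff[OF part] Z_def using interior_subset by auto

lemma AE_not_Z: "AE x in \<mu>. \<forall>n. (T ^^ n) x \<notin> Z"
  by (rule AE_all_iter[OF AE_not_in[OF Z_null]])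

lemma measurable_code [measurable]: "\<alpha> \<in> measurable \<mu> (count_space UNIV)"
proof (rule measurable_count_space_eq2_countable[THEN iffD2, OF conjI[OF _ ballI]])
  have 1: "{x\<in>UI. \<alpha> x \<noteq> 0} = (\<Union>I\<in>\<A>. interior I)"
  proof (intro equalityI subsetI)
    fix x assume "x \<in> {x\<in>UI. \<alpha> x \<noteq> 0}"
    then show "x \<in> (\<Union>I\<in>\<A>. interior I)" using icode_SucD[OF part, of x] by blast
  next
    fix x assume "x \<in> (\<Union>I\<in>\<A>. interior I)"
    then obtain I where I: "I \<in> \<A>" "x \<in> interior I" by blast
    then have "x \<in> UI" using A_sub interior_subset by blast
    then show "x \<in> {x\<in>UI. \<alpha> x \<noteq> 0}" using icode_eq[OF part I] by simp
  qed
  fix a :: nat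
  show "\<alpha> -` {a} \<inter> space \<mu> \<in> sets \<mu>"
  proof (cases "\<exists>I\<in>\<A>. a = Suc (to_nat_on \<A> I)")
    case True
    then obtain I where I: "I \<in> \<A>" "a = Suc (to_nat_on \<A> I)" by auto
    have "\<alpha> -` {a} \<inter> space \<mu> = interior I"
      using icode_iff[OF part I(1)] I A_sub[OF I(1)] interior_subset[of I] by (auto simp: space_\<mu>)
    then show ?thesis using A_sets I by (simp add: sets_\<mu>)
  next
    case False
    show ?thesis
    proof (cases "a = 0")
      case True
      have "\<alpha> -` {a} \<inter> space \<mu> = space \<mu> - {x\<in>UI. \<alpha> x \<noteq> 0}" using True by (auto simp: space_\<mu>)
      also have "\<dots> \<in> sets \<mu>" unfolding 1 using A_sets A_countable
        by (intro sets.Diff sets.top sets.countable_UN') (auto simp: sets_\<mu>)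
      finally show ?thesis .
    next
      case a0: False
      then have "\<alpha> -` {a} \<inter> space \<mu> = {}" using False icode_SucD[OF part] by blast
      then show ?thesis by simp
    qed
  qed
qed auto

lemma code_sets: "\<alpha> -` X \<inter> space \<mu> \<in> sets \<mu>"
  by (rule measurable_sets[OF measurable_code]) simp

lemma mono_T:
  assumes "I \<in> \<A>"
  shows "(\<forall>x\<in>interior I. \<forall>y\<in>interior I. x < y \<longrightarrow> T x < T y) \<or> (\<forall>x\<in>interior I. \<forall>y\<in>interior I. x < y \<longrightarrow> T y < T x)"
proof -
  have "strict_mono_on (interior I) T \<or> monotone_on (interior I) (<) (>) T"
    using class_T assms by (simp add: class_T_def)
  then show ?thesis unfolding monotone_on_def by blast
qed

text \<open>Induction on the word: the first letter confines the point to the interior of one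
  interval, where \<open>T\<close> is monotone, so the points there that \<open>T\<close> maps into
  the interval cell of the remaining word form an interval. The letter 0 is excluded because it
  marks scattered end points and gaps.\<close>

lemma cell_interval:
  assumes "0 \<notin> set w"
  shows "is_interval {x\<in>UI. name T \<alpha> (length w) x = w}"
  using assms
proof (induction w)
  case Nil
  have "{x\<in>UI. name T \<alpha> (length []) x = []} = {0..1}" by (auto simp: name_def UI_def)
  then show ?case using is_interval_cc[of 0 "1::real"] by metis
next
  case (Cons a w)
  let ?C = "{x\<in>UI. name T \<alpha> (length w) x = w}"
  have IH: "is_interval ?C" using Cons by simp
  have T_UI: "x \<in> UI \<Longrightarrow> T x \<in> UI" for x using iter_space[of x 1] by (simp add: space_\<mu>)
  show ?case unfolding is_interval_1
  proof (intro ballI allI impI)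
    fix x z y assume x: "x \<in> {x\<in>UI. name T \<alpha> (length (a # w)) x = a # w}"
      and z: "z \<in> {x\<in>UI. name T \<alpha> (length (a # w)) x = a # w}" and y: "x \<le> y \<and> y \<le> z"
    have yUI: "y \<in> UI" using x z y by (auto simp: UI_def)
    have x': "\<alpha> x = a" "T x \<in> ?C" and z': "\<alpha> z = a" "T z \<in> ?C"
      using x z T_UI by (auto simp: name_Suc)
    obtain I where I: "I \<in> \<A>" "x \<in> interior I" "a = Suc (to_nat_on \<A> I)"
      using icode_SucD[OF part, of x] x' Cons.prems by auto
    have zI: "z \<in> interior I" using icode_iff[OF part I(1)] z' I by simp
    have "is_interval (interior I)"
      using A_interval[OF I(1)] by (simp add: is_interval_convex_1)
    then have yI: "y \<in> interior I" using I zI y unfolding is_interval_1 by blast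
    have "T x \<le> T y \<and> T y \<le> T z \<or> T z \<le> T y \<and> T y \<le> T x"
      using mono_T[OF I(1)] I yI zI y by (metis order.order_iff_strict)
    then have "T y \<in> ?C" using IH x'(2) z'(2) unfolding is_interval_1 by blast
    moreover have "\<alpha> y = a" using icode_iff[OF part I(1)] yI I by simp
    ultimately show "y \<in> {x\<in>UI. name T \<alpha> (length (a # w)) x = a # w}"
      using yUI by (simp add: name_Suc)
  qed
qed

text \<open>A word containing the letter 0 has mass 0, since almost no orbit meets \<open>Z\<close>.
  Positive mass is therefore a handy test for a cell to be an interval.\<close>

lemma point_mass_pos_interval:
  assumes "0 < point_mass \<mu> (name T \<alpha> n) w"
  shows "is_interval {x\<in>UI. name T \<alpha> n x = w}"
proof (cases "0 \<in> set w \<or> length w \<noteq> n")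
  case True
  have "AE x in \<mu>. name T \<alpha> n x \<noteq> w"
    using AE_not_Z AE_space
  proof eventually_elim
    case (elim x)
    then have nz: "\<alpha> ((T ^^ j) x) \<noteq> 0" for j
      using iter_space by (intro not_Z) (auto simp: space_\<mu>[symmetric])
    have "0 \<notin> set (name T \<alpha> n x)"
    proof
      assume "0 \<in> set (name T \<alpha> n x)"
      then obtain j where "name T \<alpha> n x ! j = 0" "j < n" by (auto simp: in_set_conv_nth)
      then show False using nz[of j] nth_name[of j n T \<alpha> x] by simp
    qed
    with True show ?case by auto
  qed
  then have "AE x in \<mu>. x \<notin> name T \<alpha> n -` {w} \<inter> space \<mu>" by eventually_elim auto
  then have "point_mass \<mu> (name T \<alpha> n) w = 0" unfolding point_mass_def
    by (intro measure_eq_0_AE) (auto simp: measurable_sets[OF measurable_name[OF measurable_code]])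
  with assms show ?thesis by simp
qed (use cell_interval in auto)

text \<open>\<open>class_T\<close> generates from preimages of the intervals, names from their
  interiors; the two differ only along orbits meeting \<open>Z\<close>. The null difference allowed
  by \<open>class_T\<close> is with respect to \<open>lam\<close>, hence null for the invariant
  measure too.\<close>

lemma generating: "generating \<mu> T \<alpha>"
proof -
  let ?G = "{(T ^^ j) -` I \<inter> UI | I j. I \<in> \<A>}"
  have G: "approx_by_names \<mu> T \<alpha> A" if "A \<in> ?G" for A
  proof -
    from that obtain I j where I: "I \<in> \<A>" and A: "A = (T ^^ j) -` I \<inter> UI" by auto
    have Am: "A \<in> sets \<mu>" unfolding A using measurable_sets[OF measurable_iter, of I j] A_sets[OF I] by (simp add: sets_\<mu> space_\<mu>)
    let ?N = "{x \<in> space \<mu>. name T \<alpha> (Suc j) x \<in> {w. w ! j = Suc (to_nat_on \<A> I)}}"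
    have N: "?N \<in> sets \<mu>" by (rule sets_name[OF measurable_code])
    have "AE x in \<mu>. x \<notin> sym_diff A ?N"
      using AE_not_Z AE_space
      by eventually_elim (auto simp: A nth_name not_Z_iff[OF I] space_\<mu>)
    then have "measure \<mu> (sym_diff A ?N) = 0"
      using Am N by (intro measure_eq_0_AE) auto
    then show ?thesis unfolding approx_by_names_def using Am
      by (intro conjI allI impI exI[of _ "Suc j"] exI[of _ "{w. w ! j = Suc (to_nat_on \<A> I)}"]) auto
  qed
  show ?thesis unfolding generating_def
  proof (intro ballI allI impI)
    fix A and e :: real assume A: "A \<in> sets \<mu>" and e: "e > 0"
    then obtain C where C: "C \<in> sigma_sets UI ?G" "emeasure lam (sym_diff A C) = 0"
      using class_T by (auto simp: class_T_def sets_\<mu>)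
    have "approx_by_names \<mu> T \<alpha> C"
      by (rule approx_by_names_sigma[OF measurable_code G]) (use C in \<open>auto simp: space_\<mu>\<close>)
    then obtain m S where mS: "C \<in> sets \<mu>" "measure \<mu> (sym_diff C {x \<in> space \<mu>. name T \<alpha> m x \<in> S}) < e"
      using e by (auto simp: approx_by_names_def)
    have "sym_diff A C \<in> null_sets lam" using C A mS by (auto simp: null_sets_def sets_\<mu>[symmetric])
    then have "measure \<mu> (sym_diff A C) = 0" by (intro measure_eq_0_null_sets null_if_lam_null)
    then have "measure \<mu> (sym_diff A {x \<in> space \<mu>. name T \<alpha> m x \<in> S}) < e"
      using measure_sym_diff_trans[OF A mS(1) sets_name[OF measurable_code, of m S]] mS by simp
    then show "\<exists>m S. measure \<mu> (sym_diff A {x \<in> space \<mu>. name T \<alpha> m x \<in> S}) < e" by blast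
  qed
qed

text \<open>The entropy of the interval partition, assumed finite, is the expectation of
  \<open>info\<close>. The sum over intervals becomes a sum over letters because letters that belong
  to no interval have mass 0.\<close>

lemma integrable_info_code: "integrable \<mu> (info \<mu> \<alpha>)"
proof -
  define f where "f = (\<lambda>I. - measure \<mu> I * ln (measure \<mu> I))"
  have f0: "0 \<le> f I" for I
  proof -
    have "ln (measure \<mu> I) \<le> 0" by (cases "measure \<mu> I = 0") (auto simp: less_le)
    then show ?thesis by (simp add: f_def mult_nonneg_nonpos)
  qed
  have "f summable_on \<A>" using class_T by (simp add: class_T_def f_def)
  then have "integrable (count_space \<A>) f"
    by (intro Infinite_Set_Sum.abs_summable_on_def[THEN iffD1] abs_summable_equivalent[THEN iffD1]
      summable_on_iff_abs_summable_on_real[THEN iffD1])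
  then have fin: "(\<integral>\<^sup>+I. ennreal (f I) \<partial>count_space \<A>) < \<infinity>"
    using f0 by (simp add: integrable_iff_bounded)
  let ?c = "\<lambda>I. Suc (to_nat_on \<A> I)"
  have inj: "inj_on ?c \<A>" using inj_on_to_nat_on[OF A_countable] by (auto simp: inj_on_def)
  have prbI: "point_mass \<mu> \<alpha> (?c I) = measure \<mu> I" if I: "I \<in> \<A>" for I
    unfolding point_mass_def
  proof (rule measure_eq_AE)
    show "AE x in \<mu>. (x \<in> \<alpha> -` {?c I} \<inter> space \<mu>) = (x \<in> I)"
      using AE_not_in[OF Z_null] AE_space by eventually_elim (auto simp: not_Z_iff[OF I])
  qed (simp_all add: code_sets A_sets(1)[OF I] sets_\<mu>[symmetric, THEN equalityD1, THEN subsetD])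
  have point_mass0: "point_mass \<mu> \<alpha> a = 0" if "a \<notin> ?c ` \<A>" for a
  proof -
    have "AE x in \<mu>. x \<notin> \<alpha> -` {a} \<inter> space \<mu>"
      using AE_not_in[OF Z_null] AE_space
    proof eventually_elim
      case (elim x)
      then have "\<alpha> x \<noteq> 0" using not_Z by (simp add: space_\<mu>)
      then obtain I where "I \<in> \<A>" "\<alpha> x = ?c I" using icode_SucD[OF part] by metis
      then show ?case using that by auto
    qed
    then show ?thesis unfolding point_mass_def
      by (intro measure_eq_0_AE code_sets)
  qed
  have "(\<integral>\<^sup>+x. ennreal (info \<mu> \<alpha> x) \<partial>\<mu>) = (\<integral>\<^sup>+a. ennreal (point_mass \<mu> \<alpha> a) * ennreal (- ln (point_mass \<mu> \<alpha> a)) \<partial>count_space UNIV)"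
    unfolding info_def by (rule nn_integral_point_mass) simp
  also have "\<dots> = (\<integral>\<^sup>+a. ennreal (- point_mass \<mu> \<alpha> a * ln (point_mass \<mu> \<alpha> a)) \<partial>count_space UNIV)"
    by (intro nn_integral_cong) (simp add: ennreal_mult'[symmetric] point_mass_nonneg)
  also have "\<dots> = (\<integral>\<^sup>+a. ennreal (- point_mass \<mu> \<alpha> a * ln (point_mass \<mu> \<alpha> a)) \<partial>count_space (?c ` \<A>))"
    by (rule nn_integral_count_space_eq) (use point_mass0 in auto)
  also have "\<dots> = (\<integral>\<^sup>+I. ennreal (- point_mass \<mu> \<alpha> (?c I) * ln (point_mass \<mu> \<alpha> (?c I))) \<partial>count_space \<A>)"
    by (rule nn_integral_bij_count_space[symmetric]) (use inj in \<open>simp add: bij_betw_def\<close>)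
  also have "\<dots> = (\<integral>\<^sup>+I. ennreal (f I) \<partial>count_space \<A>)"
    by (intro nn_integral_cong) (simp add: prbI f_def)
  finally have "(\<integral>\<^sup>+x. ennreal (info \<mu> \<alpha> x) \<partial>\<mu>) < \<infinity>" using fin by simp
  then show ?thesis
    using borel_measurable_info[OF measurable_code] by (intro integrableI_bounded) (simp_all add: info_nonneg)
qed

text \<open>Property B is stated for sets generated by \<open>join_cells\<close>. A set of names
  coincides almost everywhere with a countable union of such cells, and intersecting both with the
  same preimage keeps this.\<close>

lemma property_B_names:
  assumes B: "property_B T \<mu> \<A>"
  obtains c b where "c > 0" "b \<longlonglongrightarrow> 0"
    "\<And>l n S B. 1 \<le> l \<Longrightarrow> B \<in> sets lam \<Longrightarrow>
       measure \<mu> ({x\<in>UI. name T \<alpha> l x \<in> S} \<inter> ((T ^^ (n + l)) -` B \<inter> UI))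
         \<le> c * measure \<mu> {x\<in>UI. name T \<alpha> l x \<in> S} * measure \<mu> B + b n"
proof -
  obtain c b where c: "c > 0" and b: "b \<longlonglongrightarrow> (0::real)"
    and cb: "\<forall>l\<ge>1. \<forall>n. \<forall>A\<in>sigma_sets UI (join_cells T \<A> l). \<forall>B\<in>sets lam.
        measure \<mu> (A \<inter> ((T ^^ (n + l)) -` B \<inter> UI)) \<le> c * measure \<mu> A * measure \<mu> B + b n"
    using B unfolding property_B_def by (elim exE conjE) (rule that, assumption+)
  have "measure \<mu> ({x\<in>UI. name T \<alpha> l x \<in> S} \<inter> ((T ^^ (n + l)) -` B \<inter> UI))
         \<le> c * measure \<mu> {x\<in>UI. name T \<alpha> l x \<in> S} * measure \<mu> B + b n"
    if l: "1 \<le> l" and B: "B \<in> sets lam" for l n S B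
  proof -
    let ?c = "\<lambda>I. Suc (to_nat_on \<A> I)"
    define cyl where "cyl = (\<lambda>P. UI \<inter> (\<Inter>j<l. (T ^^ j) -` P j))"
    \<comment> \<open>Only words whose letters all come from intervals correspond to join cells;
      \<open>P w\<close> recovers the sequence of intervals. Almost every name is such a
      word.\<close>
    define W where "W = {w\<in>S. length w = l \<and> (\<forall>j<l. w ! j \<in> ?c ` \<A>)}"
    define P where "P = (\<lambda>w j. SOME I. I \<in> \<A> \<and> w ! j = ?c I)"
    have P: "P w j \<in> \<A> \<and> w ! j = ?c (P w j)" if "w \<in> W" "j < l" for w j
    proof -
      have "w ! j \<in> ?c ` \<A>" using that by (simp add: W_def)
      then have "\<exists>I. I \<in> \<A> \<and> w ! j = ?c I" by blast
      then show ?thesis unfolding P_def by (rule someI_ex)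
    qed
    define A where "A = (\<Union>w\<in>W. cyl (P w))"
    have "join_cells T \<A> l \<subseteq> Pow UI" by (auto simp: join_cells_def)
    then interpret J: sigma_algebra UI "sigma_sets UI (join_cells T \<A> l)" by (rule sigma_algebra_sigma_sets)
    have "cyl (P w) \<in> join_cells T \<A> l" if "w \<in> W" for w
      using P[OF that] unfolding join_cells_def cyl_def by blast
    then have A: "A \<in> sigma_sets UI (join_cells T \<A> l)"
      unfolding A_def by (intro J.countable_UN') (auto intro: sigma_sets.Basic)
    have "join_cells T \<A> l \<subseteq> sets \<mu>"
    proof
      fix X assume "X \<in> join_cells T \<A> l"
      then obtain Q where Q: "X = UI \<inter> (\<Inter>j<l. (T ^^ j) -` Q j)" "\<forall>j<l. Q j \<in> \<A>"
        unfolding join_cells_def by (elim CollectE exE conjE) (rule that)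
      have m: "(T ^^ j) -` Q j \<inter> space \<mu> \<in> sets \<mu>" if "j < l" for j
        using Q(2) that A_sets(1)[of "Q j"] by (intro measurable_sets[OF measurable_iter]) (simp add: sets_\<mu>)
      have l0: "0 < l" using l by simp
      then have "X = (\<Inter>j\<in>{..<l}. (T ^^ j) -` Q j \<inter> space \<mu>)" unfolding Q(1) space_\<mu> by blast
      also have "\<dots> \<in> sets \<mu>" using m l0 by (intro sets.finite_INT) auto
      finally show "X \<in> sets \<mu>" .
    qed
    then have "sigma_sets (space \<mu>) (join_cells T \<A> l) \<subseteq> sets \<mu>" by (rule sets.sigma_sets_subset)
    then have Am: "A \<in> sets \<mu>" using A unfolding space_\<mu> by blast
    have Bm: "(T ^^ (n + l)) -` B \<inter> UI \<in> sets \<mu>"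
      using measurable_sets[OF measurable_iter, of B "n + l"] B by (simp add: sets_\<mu> space_\<mu>)
    have Nm: "{x\<in>UI. name T \<alpha> l x \<in> S} \<in> sets \<mu>" using sets_name[OF measurable_code, of l S] by (simp add: space_\<mu>)
    have AE: "AE x in \<mu>. x \<in> A \<longleftrightarrow> x \<in> {x\<in>UI. name T \<alpha> l x \<in> S}"
      using AE_not_Z AE_space
    proof eventually_elim
      case (elim x)
      then have x: "x \<in> UI" by (simp add: space_\<mu>)
      have nW: "name T \<alpha> l x \<in> W" if "name T \<alpha> l x \<in> S"
      proof -
        have "\<alpha> ((T ^^ j) x) \<in> ?c ` \<A>" for j
          using not_Z[of "(T ^^ j) x"] elim iter_space[of x j] icode_SucD[OF part, of "(T ^^ j) x"] by (metis image_eqI space_\<mu>)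
        then show ?thesis using that by (simp add: W_def nth_name)
      qed
      have "x \<in> cyl (P w) \<longleftrightarrow> name T \<alpha> l x = w" if w: "w \<in> W" for w
      proof -
        have "x \<in> cyl (P w) \<longleftrightarrow> (\<forall>j<l. \<alpha> ((T ^^ j) x) = w ! j)"
          using x P[OF w] elim(1) by (auto simp: cyl_def not_Z_iff)
        then show ?thesis using w by (auto simp: list_eq_iff_nth_eq nth_name W_def)
      qed
      then show ?case using x nW by (auto simp: A_def W_def)
    qed
    have "measure \<mu> A = measure \<mu> {x\<in>UI. name T \<alpha> l x \<in> S}"
      by (rule measure_eq_AE[OF AE Am Nm])
    moreover have "measure \<mu> (A \<inter> ((T ^^ (n + l)) -` B \<inter> UI)) = measure \<mu> ({x\<in>UI. name T \<alpha> l x \<in> S} \<inter> ((T ^^ (n + l)) -` B \<inter> UI))"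
      by (rule measure_eq_AE) (use AE Am Nm Bm in auto)
    ultimately show ?thesis using cb[rule_format, OF l A B, of n] by simp
  qed
  then show ?thesis using that[OF c b] by blast
qed

end

section \<open>The joint recurrence bound\<close>

lemma card_le_1:
  assumes "\<And>x y. x \<in> A \<Longrightarrow> y \<in> A \<Longrightarrow> x = y"
  shows "finite A" "card A \<le> 1"
proof -
  have "A = {} \<or> (\<exists>x. A = {x})" using assms by blast
  then show "finite A" "card A \<le> 1" by auto
qed

text \<open>A member that meets \<open>J\<close> without lying in it crosses the left or the right
  end of \<open>J\<close>. Two members crossing the left end have outside points \<open>c\<close>
  and \<open>d\<close> there, and the larger of these lies in both; disjointness leaves one member
  for each end.\<close>

lemma card_crossing_interval:
  fixes f :: "'w \<Rightarrow> real set"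
  assumes J: "is_interval J" and f: "\<And>w. w \<in> W \<Longrightarrow> is_interval (f w)"
    and disj: "\<And>v w. v \<in> W \<Longrightarrow> w \<in> W \<Longrightarrow> f v \<inter> f w \<noteq> {} \<Longrightarrow> v = w"
  shows "finite {w\<in>W. f w \<inter> J \<noteq> {} \<and> \<not> f w \<subseteq> J}" "card {w\<in>W. f w \<inter> J \<noteq> {} \<and> \<not> f w \<subseteq> J} \<le> 2"
proof -
  define L where "L = {w\<in>W. \<exists>c j. c \<in> f w \<and> j \<in> f w \<and> j \<in> J \<and> c \<notin> J \<and> c < j}"
  define R where "R = {w\<in>W. \<exists>c j. c \<in> f w \<and> j \<in> f w \<and> j \<in> J \<and> c \<notin> J \<and> j < c}"
  have L: "v = w" if vw: "v \<in> L" "w \<in> L" for v w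
  proof -
    from vw obtain c j d i where v: "v \<in> W" "c \<in> f v" "j \<in> f v" "j \<in> J" "c \<notin> J" "c < j"
      and w: "w \<in> W" "d \<in> f w" "i \<in> f w" "i \<in> J" "d \<notin> J" "d < i" unfolding L_def by blast
    have "c < i" using J v w unfolding is_interval_1 by (meson linorder_not_less less_imp_le)
    moreover have "d < j" using J v w unfolding is_interval_1 by (meson linorder_not_less less_imp_le)
    ultimately have "max c d \<in> f v" "max c d \<in> f w"
      using f[OF v(1)] f[OF w(1)] v w unfolding is_interval_1 by (smt (verit))+
    then show ?thesis using disj v w by blast
  qed
  have R: "v = w" if vw: "v \<in> R" "w \<in> R" for v w
  proof -
    from vw obtain c j d i where v: "v \<in> W" "c \<in> f v" "j \<in> f v" "j \<in> J" "c \<notin> J" "j < c"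
      and w: "w \<in> W" "d \<in> f w" "i \<in> f w" "i \<in> J" "d \<notin> J" "i < d" unfolding R_def by blast
    have "i < c" using J v w unfolding is_interval_1 by (meson linorder_not_less less_imp_le)
    moreover have "j < d" using J v w unfolding is_interval_1 by (meson linorder_not_less less_imp_le)
    ultimately have "min c d \<in> f v" "min c d \<in> f w"
      using f[OF v(1)] f[OF w(1)] v w unfolding is_interval_1 by (smt (verit))+
    then show ?thesis using disj v w by blast
  qed
  have sub: "{w\<in>W. f w \<inter> J \<noteq> {} \<and> \<not> f w \<subseteq> J} \<subseteq> L \<union> R"
  proof
    fix w assume "w \<in> {w\<in>W. f w \<inter> J \<noteq> {} \<and> \<not> f w \<subseteq> J}"
    then obtain c j where cj: "w \<in> W" "c \<in> f w" "c \<notin> J" "j \<in> f w" "j \<in> J" by blast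
    then have "c < j \<or> j < c" by (metis linorder_neqE)
    with cj show "w \<in> L \<union> R" unfolding L_def R_def by blast
  qed
  note cL = card_le_1[of L, OF L] and cR = card_le_1[of R, OF R]
  show "finite {w\<in>W. f w \<inter> J \<noteq> {} \<and> \<not> f w \<subseteq> J}" using finite_subset[OF sub] cL cR by simp
  have "card {w\<in>W. f w \<inter> J \<noteq> {} \<and> \<not> f w \<subseteq> J} \<le> card (L \<union> R)" using sub cL cR by (intro card_mono) auto
  also have "\<dots> \<le> card L + card R" by (rule card_Un_le)
  finally show "card {w\<in>W. f w \<inter> J \<noteq> {} \<and> \<not> f w \<subseteq> J} \<le> 2" using cL cR by simp
qed

lemma card_crossing_intervals:
  fixes f :: "'w \<Rightarrow> real set"
  assumes J: "finite \<J>" "\<And>J. J \<in> \<J> \<Longrightarrow> is_interval J" and f: "\<And>w. w \<in> W \<Longrightarrow> is_interval (f w)"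
    and disj: "\<And>v w. v \<in> W \<Longrightarrow> w \<in> W \<Longrightarrow> f v \<inter> f w \<noteq> {} \<Longrightarrow> v = w"
  shows "finite {w\<in>W. f w \<inter> \<Union>\<J> \<noteq> {} \<and> \<not> f w \<subseteq> \<Union>\<J>}"
    "card {w\<in>W. f w \<inter> \<Union>\<J> \<noteq> {} \<and> \<not> f w \<subseteq> \<Union>\<J>} \<le> 2 * card \<J>"
proof -
  let ?B = "\<lambda>J. {w\<in>W. f w \<inter> J \<noteq> {} \<and> \<not> f w \<subseteq> J}"
  note c = card_crossing_interval[OF J(2) f disj]
  have sub: "{w\<in>W. f w \<inter> \<Union>\<J> \<noteq> {} \<and> \<not> f w \<subseteq> \<Union>\<J>} \<subseteq> (\<Union>J\<in>\<J>. ?B J)" by blast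
  have fin: "finite (\<Union>J\<in>\<J>. ?B J)" by (intro finite_UN_I J(1) c(1))
  show "finite {w\<in>W. f w \<inter> \<Union>\<J> \<noteq> {} \<and> \<not> f w \<subseteq> \<Union>\<J>}" by (rule finite_subset[OF sub fin])
  have "card {w\<in>W. f w \<inter> \<Union>\<J> \<noteq> {} \<and> \<not> f w \<subseteq> \<Union>\<J>} \<le> card (\<Union>J\<in>\<J>. ?B J)" by (rule card_mono[OF fin sub])
  also have "\<dots> \<le> (\<Sum>J\<in>\<J>. card (?B J))" by (rule card_UN_le[OF J(1)])
  also have "\<dots> \<le> (\<Sum>J\<in>\<J>. 2)" by (intro sum_mono c(2))
  finally show "card {w\<in>W. f w \<inter> \<Union>\<J> \<noteq> {} \<and> \<not> f w \<subseteq> \<Union>\<J>} \<le> 2 * card \<J>" by simp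
qed

section \<open>Passing between sets of names and families of intervals\<close>

definition interval_family :: "real set set \<Rightarrow> real \<Rightarrow> bool" where
  "interval_family \<J> c \<longleftrightarrow> finite \<J> \<and> real (card \<J>) \<le> c \<and> (\<forall>J\<in>\<J>. is_interval J \<and> J \<subseteq> UI)"

lemma interval_family_sets: "interval_family \<J> c \<Longrightarrow> \<Union>\<J> \<in> sets lam"
  unfolding interval_family_def by (intro sets.finite_Union) (auto simp: sets_lam_iff interval_borel)

context interval_map
begin

abbreviation "cyl n S \<equiv> {x\<in>UI. name T \<alpha> n x \<in> S}"

lemma cyl_sets: "cyl n S \<in> sets lam"
  using sets_name[OF measurable_code, of n S] by (simp add: sets_\<mu> space_\<mu>)

lemma point_mass_cell: "point_mass \<mu> (name T \<alpha> n) w = measure \<mu> {x\<in>UI. name T \<alpha> n x = w}"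
  unfolding point_mass_def by (intro arg_cong[where f="measure \<mu>"]) (auto simp: space_\<mu>)

text \<open>The intervals are the cells of mass at least \<open>exp (- (n + l) h')\<close> for some
  \<open>h'\<close> between the entropy and \<open>h\<close>. There are at most
  \<open>exp ((n + l) h')\<close> of them, and the points in smaller cells have small
  measure.\<close>

lemma few_intervals:
  assumes h: "0 \<le> ks_entropy \<mu> T" "ks_entropy \<mu> T < ereal h" and d: "0 < d"
  shows "\<forall>\<^sub>F n in sequentially. \<forall>S. \<exists>\<J>. interval_family \<J> (exp (real n * h)) \<and>
     \<Union>\<J> \<subseteq> cyl (n + l) S \<and> measure lam (cyl (n + l) S - \<Union>\<J>) \<le> d"
proof -
  obtain h' where h': "ks_entropy \<mu> T < ereal h'" "h' < h" using ereal_dense2[OF h(2)] by auto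
  obtain c where c: "c \<ge> 1" "\<And>A. A \<in> sets lam \<Longrightarrow> measure lam A \<le> c * measure \<mu> A"
    by (rule equiv_lam) blast
  define small where "small = (\<lambda>n. {x\<in>space \<mu>. point_mass \<mu> (name T \<alpha> n) (name T \<alpha> n x) < exp (- (real n * h'))})"
  have small: "small n \<in> sets lam" for n
    unfolding small_def sets_\<mu>[symmetric] by (rule sets_point_mass_name[OF measurable_code])
  have "(\<lambda>n. measure \<mu> (small n)) \<longlonglongrightarrow> 0" unfolding small_def
    by (rule small_cells_tendsto_0[OF measurable_code integrable_info_code generating h(1) h'(1)])
  then have "(\<lambda>n. measure \<mu> (small (n + l))) \<longlonglongrightarrow> 0" by (rule LIMSEQ_ignore_initial_segment)
  then have ev: "\<forall>\<^sub>F n in sequentially. measure \<mu> (small (n + l)) < d / c"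
    using d c by (intro order_tendstoD) auto
  \<comment> \<open>Beyond \<open>n0\<close> the gap \<open>h - h'\<close> absorbs the
    \<open>l\<close> extra letters: \<open>(n + l) h' \<le> n h\<close>.\<close>
  obtain n0 :: nat where n0: "real l * h' / (h - h') \<le> real n0" using real_arch_simple by blast
  show ?thesis
    using ev eventually_ge_at_top[of n0]
  proof (eventually_elim, intro allI)
    fix n S
    assume n: "measure \<mu> (small (n + l)) < d / c" "n0 \<le> n"
    let ?N = "n + l"
    let ?cell = "\<lambda>w. {x\<in>UI. name T \<alpha> ?N x = w}"
    define W where "W = {w. exp (- (real ?N * h')) \<le> point_mass \<mu> (name T \<alpha> ?N) w}"
    have W: "finite W" "real (card W) \<le> exp (real ?N * h')"
      using card_point_mass_ge[OF measurable_name[OF measurable_code], of "exp (- (real ?N * h'))" ?N]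
      by (simp_all add: W_def exp_minus inverse_eq_divide)
    define \<J> where "\<J> = ?cell ` (W \<inter> S)"
    have "real l * h' / (h - h') \<le> real n" using n0 n by linarith
    then have "real l * h' \<le> real n * (h - h')" using h' by (simp add: pos_divide_le_eq)
    then have "real ?N * h' \<le> real n * h" by (simp add: algebra_simps)
    moreover have "card \<J> \<le> card W"
      unfolding \<J>_def using W by (intro order.trans[OF card_image_le] card_mono) auto
    ultimately have card: "real (card \<J>) \<le> exp (real n * h)"
      using W(2) by (meson exp_le_cancel_iff of_nat_mono order.trans)
    have "is_interval (?cell w)" if "w \<in> W" for w
      using that by (intro point_mass_pos_interval) (auto simp: W_def intro: less_le_trans[OF exp_gt_zero])
    then have iv: "interval_family \<J> (exp (real n * h))" using W card by (auto simp: interval_family_def \<J>_def)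
    have sub: "\<Union>\<J> \<subseteq> cyl ?N S" by (auto simp: \<J>_def)
    have "cyl ?N S - \<Union>\<J> \<subseteq> small ?N"
    proof
      fix x assume x: "x \<in> cyl ?N S - \<Union>\<J>"
      then have "name T \<alpha> ?N x \<notin> W" by (auto simp: \<J>_def)
      with x show "x \<in> small ?N" by (simp add: small_def W_def space_\<mu>)
    qed
    then have "measure lam (cyl ?N S - \<Union>\<J>) \<le> measure lam (small ?N)"
      using small prob_space_lam by (intro finite_measure.finite_measure_mono) (auto simp: prob_space_def)
    also have "\<dots> \<le> c * measure \<mu> (small ?N)" by (rule c(2)[OF small])
    also have "\<dots> \<le> d" using n(1) c(1) by (simp add: field_simps)
    finally show "\<exists>\<J>. interval_family \<J> (exp (real n * h)) \<and> \<Union>\<J> \<subseteq> cyl ?N S \<and> measure lam (cyl ?N S - \<Union>\<J>) \<le> d"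
      using iv sub by blast
  qed
qed

text \<open>Each interval is crossed by at most two cells, one at each end, and all cells but those in a set of
  small measure have mass below \<open>exp (- n h')\<close> for some \<open>h' > h\<close>.\<close>

lemma intervals_by_cells:
  assumes h: "ereal h < ks_entropy \<mu> T" and d: "0 < d"
  shows "\<forall>\<^sub>F n in sequentially. \<forall>\<J>. interval_family \<J> (exp (real n * h)) \<longrightarrow>
    (\<exists>S. cyl (n - m) S \<subseteq> \<Union>\<J> \<and> measure \<mu> (\<Union>\<J> - cyl (n - m) S) \<le> d)"
proof -
  obtain h' where h': "h < h'" "ereal h' < ks_entropy \<mu> T" using ereal_dense2[OF h] by auto
  define large where "large = (\<lambda>n. {x\<in>space \<mu>. exp (- (real n * h')) \<le> point_mass \<mu> (name T \<alpha> n) (name T \<alpha> n x)})"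
  have large: "large n \<in> sets \<mu>" for n unfolding large_def by (rule sets_point_mass_name[OF measurable_code])
  have "(\<lambda>n. measure \<mu> (large n)) \<longlonglongrightarrow> 0" unfolding large_def
    by (rule large_cells_tendsto_0[OF measurable_code integrable_info_code generating h'(2)])
  then have "\<forall>\<^sub>F n in sequentially. measure \<mu> (large n) < d / 2"
    using d by (intro order_tendstoD) auto
  then obtain n1 where n1: "\<And>n. n1 \<le> n \<Longrightarrow> measure \<mu> (large n) < d / 2" by (auto simp: eventually_sequentially)
  \<comment> \<open>This is \<open>2 exp (n h)\<close>, the number of crossing cells, times the mass
    bound \<open>exp (- (n - m) h')\<close>. Shortening the cells by \<open>m\<close> letters costs
    only a constant factor.\<close>
  have "(\<lambda>n. 2 * exp (real m * h') * exp (h - h') ^ n) \<longlonglongrightarrow> 0"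
    using h' by (intro tendsto_mult_right_zero LIMSEQ_power_zero) simp
  from order_tendstoD(2)[OF this, of "d / 2"]
  have ev: "\<forall>\<^sub>F n in sequentially. 2 * exp (real m * h') * exp (h - h') ^ n < d / 2"
    using d by simp
  show ?thesis
    using ev eventually_ge_at_top[of "n1 + m"]
  proof (eventually_elim, intro allI impI)
    fix n \<J>
    assume n: "2 * exp (real m * h') * exp (h - h') ^ n < d / 2" "n1 + m \<le> n"
      and J: "interval_family \<J> (exp (real n * h))"
    let ?N = "n - m"
    let ?cell = "\<lambda>w. {x\<in>UI. name T \<alpha> ?N x = w}"
    define S where "S = {w. ?cell w \<subseteq> \<Union>\<J>}"
    \<comment> \<open>Cells of mass 0 need not be intervals, so only those of positive mass enter
      the count; the others contribute nothing almost everywhere.\<close>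
    define W where "W = {w. 0 < point_mass \<mu> (name T \<alpha> ?N) w}"
    define V where "V = {w\<in>W. ?cell w \<inter> \<Union>\<J> \<noteq> {} \<and> \<not> ?cell w \<subseteq> \<Union>\<J>}"
    have V: "finite V" "card V \<le> 2 * card \<J>"
      unfolding V_def using J by (intro card_crossing_intervals; auto simp: interval_family_def W_def intro: point_mass_pos_interval)+
    define V' where "V' = {w\<in>V. point_mass \<mu> (name T \<alpha> ?N) w < exp (- (real ?N * h'))}"
    have cell: "?cell w \<in> sets \<mu>" for w using cyl_sets[of ?N "{w}"] by (simp add: sets_\<mu>)
    have sub: "cyl ?N S \<subseteq> \<Union>\<J>" by (auto simp: S_def)
    have JM: "\<Union>\<J> \<in> sets \<mu>" using interval_family_sets[OF J] by (simp add: sets_\<mu>)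
    have U: "(\<Union>w\<in>V'. ?cell w) \<in> sets \<mu>" using V cell by (intro sets.finite_UN) (auto simp: V'_def)
    have "AE x in \<mu>. x \<in> \<Union>\<J> - cyl ?N S \<longrightarrow> x \<in> large ?N \<union> (\<Union>w\<in>V'. ?cell w)"
      using AE_point_mass_pos[OF measurable_name[OF measurable_code], of ?N] AE_space
    proof (eventually_elim, intro impI)
      fix x assume pos: "0 < point_mass \<mu> (name T \<alpha> ?N) (name T \<alpha> ?N x)" and x: "x \<in> space \<mu>" "x \<in> \<Union>\<J> - cyl ?N S"
      let ?w = "name T \<alpha> ?N x"
      have xc: "x \<in> ?cell ?w" using x by (simp add: space_\<mu>)
      have "?w \<notin> S" using x by (auto simp: space_\<mu>)
      then have "\<not> ?cell ?w \<subseteq> \<Union>\<J>" unfolding S_def by blast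
      moreover have "?cell ?w \<inter> \<Union>\<J> \<noteq> {}" using xc x(2) by blast
      ultimately have "?w \<in> V" using pos unfolding V_def W_def by blast
      then have "x \<in> large ?N \<or> ?w \<in> V'" using x(1) unfolding V'_def large_def by (auto simp: not_less)
      then show "x \<in> large ?N \<union> (\<Union>w\<in>V'. ?cell w)" using xc by blast
    qed
    then have "measure \<mu> (\<Union>\<J> - cyl ?N S) \<le> measure \<mu> (large ?N \<union> (\<Union>w\<in>V'. ?cell w))"
      using large U by (intro finite_measure_mono_AE) auto
    also have "\<dots> \<le> measure \<mu> (large ?N) + measure \<mu> (\<Union>w\<in>V'. ?cell w)"
      using large U by (rule measure_Un_le)
    also have "measure \<mu> (\<Union>w\<in>V'. ?cell w) \<le> (\<Sum>w\<in>V'. measure \<mu> (?cell w))"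
      using V cell by (intro measure_UNION_le) (auto simp: V'_def)
    also have "\<dots> \<le> (\<Sum>w\<in>V'. exp (- (real ?N * h')))"
      by (intro sum_mono) (auto simp: V'_def point_mass_cell)
    also have "\<dots> = real (card V') * exp (- (real ?N * h'))" by simp
    also have "\<dots> \<le> (2 * exp (real n * h)) * exp (- (real ?N * h'))"
    proof (rule mult_right_mono)
      have "card V' \<le> card V" using V by (intro card_mono) (auto simp: V'_def)
      then have "real (card V') \<le> 2 * real (card \<J>)" using V(2) by linarith
      then show "real (card V') \<le> 2 * exp (real n * h)" using J by (simp add: interval_family_def)
    qed simp
    also have "\<dots> = 2 * exp (real m * h') * exp (h - h') ^ n"
    proof -
      have "real ?N = real n - real m" using n by simp
      then show ?thesis by (simp add: exp_of_nat_mult[symmetric] exp_add[symmetric] algebra_simps)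
    qed
    also have "\<dots> < d / 2" by (rule n(1))
    also have "measure \<mu> (large ?N) < d / 2" using n(2) by (intro n1) simp
    finally have "measure \<mu> (\<Union>\<J> - cyl ?N S) \<le> d" by simp
    with sub show "\<exists>S. cyl ?N S \<subseteq> \<Union>\<J> \<and> measure \<mu> (\<Union>\<J> - cyl ?N S) \<le> d" by blast
  qed
qed

end

section \<open>Induction on the number of maps\<close>

locale interval_maps =
  fixes k :: nat and T :: "nat \<Rightarrow> real \<Rightarrow> real" and \<mu> :: "nat \<Rightarrow> real measure" and \<A> :: "nat \<Rightarrow> real set set"
  assumes class_T: "\<And>i. i \<le> k \<Longrightarrow> class_T (T i) (\<mu> i) (\<A> i)"
    and property_B: "\<And>i. 1 \<le> i \<Longrightarrow> i \<le> k \<Longrightarrow> property_B (T i) (\<mu> i) (\<A> i)"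
    and ent0: "0 \<le> ks_entropy (\<mu> 0) (T 0)"
    and ent_mono: "\<And>i. i < k \<Longrightarrow> ks_entropy (\<mu> i) (T i) < ks_entropy (\<mu> (Suc i)) (T (Suc i))"
begin

lemma im: "i \<le> k \<Longrightarrow> interval_map (T i) (\<mu> i) (\<A> i)"
  using class_T by unfold_locales

lemma ent_nonneg: "i \<le> k \<Longrightarrow> 0 \<le> ks_entropy (\<mu> i) (T i)"
proof (induction i)
  case (Suc i)
  then show ?case using ent_mono[of i] by (auto intro: order.trans less_imp_le)
qed (use ent0 in auto)

definition joint :: "(nat \<Rightarrow> real set) \<Rightarrow> nat \<Rightarrow> nat \<Rightarrow> real set" where
  "joint B j n = {x\<in>UI. \<forall>i\<le>j. (T i ^^ n) x \<in> B i}"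

lemma T_iter_UI: "i \<le> k \<Longrightarrow> x \<in> UI \<Longrightarrow> (T i ^^ n) x \<in> UI"
proof -
  assume i: "i \<le> k" and x: "x \<in> UI"
  interpret interval_map "T i" "\<mu> i" "\<A> i" by (rule im[OF i])
  show ?thesis using iter_space[of x n] x by (simp add: space_\<mu>)
qed

lemma vimage_sets: "i \<le> k \<Longrightarrow> B \<in> sets lam \<Longrightarrow> {x\<in>UI. (T i ^^ n) x \<in> B} \<in> sets lam"
  and measure_vimage: "i \<le> k \<Longrightarrow> B \<in> sets lam \<Longrightarrow> measure (\<mu> i) {x\<in>UI. (T i ^^ n) x \<in> B} = measure (\<mu> i) B"
proof -
  assume i: "i \<le> k" and B: "B \<in> sets lam"
  interpret interval_map "T i" "\<mu> i" "\<A> i" by (rule im[OF i])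
  have eq: "{x\<in>UI. (T i ^^ n) x \<in> B} = (T i ^^ n) -` B \<inter> space (\<mu> i)" by (auto simp: space_\<mu>)
  show "{x\<in>UI. (T i ^^ n) x \<in> B} \<in> sets lam"
    unfolding eq using measurable_sets[OF measurable_iter, of B n] B by (simp add: sets_\<mu>)
  show "measure (\<mu> i) {x\<in>UI. (T i ^^ n) x \<in> B} = measure (\<mu> i) B"
    unfolding eq using measure_iter[of B n] B by (simp add: sets_\<mu>)
qed

lemma joint_sets:
  assumes "j \<le> k" "\<And>i. i \<le> j \<Longrightarrow> B i \<in> sets lam"
  shows "joint B j n \<in> sets lam"
proof -
  have "joint B j n = (\<Inter>i\<in>{..j}. {x\<in>UI. (T i ^^ n) x \<in> B i})" by (auto simp: joint_def)
  also have "\<dots> \<in> sets lam" using assms vimage_sets by (intro sets.finite_INT) auto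
  finally show ?thesis .
qed

abbreviation "cyls l S i \<equiv> {x\<in>UI. name (T i) (icode (\<A> i)) (l i) x \<in> S i}"

text \<open>The induction needs the intervals and not just a measure bound, since only sets made of
  few intervals can be compared with cells of the next map. \<open>C\<close> must not depend on
  \<open>l\<close>, \<open>S\<close> and \<open>d\<close>, because Borel sets are later approximated
  by ever longer names.\<close>

definition names_bound :: "nat \<Rightarrow> real \<Rightarrow> bool" where
  "names_bound j C \<longleftrightarrow> (\<forall>l S h d. ks_entropy (\<mu> j) (T j) < ereal h \<longrightarrow> 0 < d \<longrightarrow>
    (\<forall>\<^sub>F n in sequentially. \<exists>\<J>. interval_family \<J> (exp (real n * h)) \<and>
       measure lam (joint (cyls l S) j n - \<Union>\<J>) \<le> d \<and>
       measure lam (\<Union>\<J>) \<le> C * (\<Prod>i\<le>j. measure (\<mu> i) (cyls l S i)) + d))"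

text \<open>For a single map the joint set is one set of names, and invariance gives its measure
  exactly; \<open>C\<close> is the constant comparing \<open>lam\<close> with the measure of
  \<open>T 0\<close>.\<close>

lemma names_bound_0: "\<exists>C>0. names_bound 0 C"
proof -
  interpret interval_map "T 0" "\<mu> 0" "\<A> 0" by (rule im) simp
  interpret lam: prob_space lam by (rule prob_space_lam)
  obtain c where c: "c \<ge> 1" "\<And>A. A \<in> sets lam \<Longrightarrow> measure lam A \<le> c * measure (\<mu> 0) A"
    by (rule equiv_lam) blast
  have "\<forall>\<^sub>F n in sequentially. \<exists>\<J>. interval_family \<J> (exp (real n * h)) \<and>
       measure lam (joint (cyls l S) 0 n - \<Union>\<J>) \<le> d \<and>
       measure lam (\<Union>\<J>) \<le> c * (\<Prod>i\<le>0. measure (\<mu> i) (cyls l S i)) + d"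
    if h: "ks_entropy (\<mu> 0) (T 0) < ereal h" and d: "0 < d" for l S h d
    using few_intervals[OF ent0 h d, of "l 0"]
  proof eventually_elim
    case (elim n)
    have eq: "joint (cyls l S) 0 n = cyl (n + l 0) {w. drop n w \<in> S 0}"
      using T_iter_UI[of 0] by (auto simp: joint_def drop_name)
    from elim obtain \<J> where J: "interval_family \<J> (exp (real n * h))" "\<Union>\<J> \<subseteq> joint (cyls l S) 0 n"
      "measure lam (joint (cyls l S) 0 n - \<Union>\<J>) \<le> d" unfolding eq by blast
    have js: "joint (cyls l S) 0 n \<in> sets lam" unfolding eq by (rule cyl_sets)
    have "measure lam (\<Union>\<J>) \<le> measure lam (joint (cyls l S) 0 n)"
      by (rule lam.finite_measure_mono[OF J(2) js])
    also have "\<dots> \<le> c * measure (\<mu> 0) (joint (cyls l S) 0 n)" by (rule c(2)[OF js])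
    also have "joint (cyls l S) 0 n = {x\<in>UI. (T 0 ^^ n) x \<in> cyls l S 0}" by (auto simp: joint_def)
    also have "measure (\<mu> 0) \<dots> = measure (\<mu> 0) (cyls l S 0)"
      by (rule measure_vimage) (auto intro: cyl_sets)
    finally show ?case using J d by (intro exI[of _ \<J>]) simp
  qed
  then have "names_bound 0 c" unfolding names_bound_def by blast
  then show ?thesis using c(1) by (intro exI[of _ c]) simp
qed

text \<open>The old intervals serve only to find \<open>R\<close>. The set \<open>Q\<close> built
  from \<open>R\<close> is again described by names of the new map, so \<open>few_intervals\<close>
  supplies the next family at any rate above the new entropy. Each passage between
  \<open>lam\<close> and the new measure costs a factor \<open>c\<close>, whence
  \<open>C' = c * cB * c * C\<close>.\<close>

lemma names_bound_Suc:
  assumes j: "Suc j \<le> k" and C: "C > 0" and IH: "names_bound j C"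
  shows "\<exists>C>0. names_bound (Suc j) C"
proof -
  interpret interval_map "T (Suc j)" "\<mu> (Suc j)" "\<A> (Suc j)" by (rule im[OF j])
  interpret lam: prob_space lam by (rule prob_space_lam)
  let ?\<mu> = "\<mu> (Suc j)" and ?T = "T (Suc j)"
  obtain c where c: "c \<ge> 1" "\<And>A. A \<in> sets lam \<Longrightarrow> measure ?\<mu> A \<le> c * measure lam A"
    "\<And>A. A \<in> sets lam \<Longrightarrow> measure lam A \<le> c * measure ?\<mu> A"
    by (rule equiv_lam) blast
  obtain cB b where cB: "cB > 0" and b: "b \<longlonglongrightarrow> 0" and B: "\<And>l n S B. 1 \<le> l \<Longrightarrow> B \<in> sets lam \<Longrightarrow>
       measure ?\<mu> (cyl l S \<inter> ((?T ^^ (n + l)) -` B \<inter> UI)) \<le> cB * measure ?\<mu> (cyl l S) * measure ?\<mu> B + b n"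
    by (rule property_B_names[OF property_B]) (use j in auto)
  define C' where "C' = c * cB * c * C"
  have C': "C' > 0" using C cB c by (simp add: C'_def)
  have "\<forall>\<^sub>F n in sequentially. \<exists>\<J>. interval_family \<J> (exp (real n * h)) \<and>
       measure lam (joint (cyls l S) (Suc j) n - \<Union>\<J>) \<le> d \<and>
       measure lam (\<Union>\<J>) \<le> C' * (\<Prod>i\<le>Suc j. measure (\<mu> i) (cyls l S i)) + d"
    if h: "ks_entropy ?\<mu> ?T < ereal h" and d: "0 < d" for l S h d
  proof -
    \<comment> \<open>The entropy gap: a rate that bounds the number of old intervals and still lies
      below the decay rate of the new cells.\<close>
    obtain h0 where h0: "ks_entropy (\<mu> j) (T j) < ereal h0" "ereal h0 < ks_entropy ?\<mu> ?T"
      using ereal_dense2[OF ent_mono[of j]] j by auto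
    \<comment> \<open>The uncovered part loses \<open>2 + c\<close> times \<open>d1\<close>, the
      measure of the new intervals loses \<open>c * cB * c + c\<close> times \<open>d1\<close>.
      \<open>K\<close> dominates both because \<open>c \<ge> 1\<close>.\<close>
    define K where "K = 3 * c + c * cB * c"
    have "0 < c * cB * c" using c(1) cB by simp
    then have K: "K \<ge> 2 + c" "0 < K" using c(1) by (auto simp: K_def)
    define d1 where "d1 = d / K"
    have d1: "0 < d1" using d K by (simp add: d1_def)
    have dK: "K * d1 = d" using K by (simp add: d1_def)
    have "\<forall>\<^sub>F m in sequentially. b m < d1" using b d1 by (intro order_tendstoD) auto
    \<comment> \<open>The gap between the cells and time \<open>n\<close> for which the additive
      error of property B is below \<open>d1\<close>; it is fixed before \<open>n\<close>.\<close>
    then obtain m where m: "b m < d1" by (auto simp: eventually_sequentially)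
    let ?A = "cyls l S (Suc j)"
    have A: "?A \<in> sets lam" by (rule cyl_sets)
    show ?thesis
      using IH[unfolded names_bound_def, rule_format, OF h0(1) d1, of l S] intervals_by_cells[OF h0(2) d1, of m] few_intervals[OF ent_nonneg[OF j] h d1, of "l (Suc j)"]
        eventually_ge_at_top[of "Suc m"]
    proof eventually_elim
      case (elim n)
      from elim(1) obtain \<J> where J: "interval_family \<J> (exp (real n * h0))" "measure lam (joint (cyls l S) j n - \<Union>\<J>) \<le> d1"
        "measure lam (\<Union>\<J>) \<le> C * (\<Prod>i\<le>j. measure (\<mu> i) (cyls l S i)) + d1" by blast
      from elim(2) J(1) obtain R where R: "cyl (n - m) R \<subseteq> \<Union>\<J>" "measure ?\<mu> (\<Union>\<J> - cyl (n - m) R) \<le> d1" by blast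
      \<comment> \<open>Up to small error the joint set lies in \<open>Q\<close>: its first
        \<open>n - m\<close> letters are controlled by \<open>R\<close>, its letters from time
        \<open>n\<close> on by \<open>S (Suc j)\<close>, and the \<open>m\<close> letters between
        are free.\<close>
      define Q where "Q = cyl (n - m) R \<inter> ((?T ^^ n) -` ?A \<inter> UI)"
      have Q: "Q = cyl (n + l (Suc j)) {w. take (n - m) w \<in> R \<and> drop n w \<in> S (Suc j)}"
        unfolding Q_def using T_iter_UI[OF j] by (auto simp: drop_name take_name)
      from elim(3) obtain \<J>' where J': "interval_family \<J>' (exp (real n * h))" "\<Union>\<J>' \<subseteq> Q" "measure lam (Q - \<Union>\<J>') \<le> d1"
        unfolding Q by blast
      have Qs: "Q \<in> sets lam" unfolding Q by (rule cyl_sets)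
      have Js: "\<Union>\<J> \<in> sets lam" "\<Union>\<J>' \<in> sets lam" using J(1) J'(1) by (auto intro: interval_family_sets)
      have js: "joint (cyls l S) j n \<in> sets lam"
        using j by (intro joint_sets) (auto intro!: interval_map.cyl_sets im)
      have "joint (cyls l S) (Suc j) n - \<Union>\<J>' \<subseteq> (joint (cyls l S) j n - \<Union>\<J>) \<union> ((\<Union>\<J> - cyl (n - m) R) \<union> (Q - \<Union>\<J>'))"
        unfolding joint_def Q_def by (auto simp: le_Suc_eq)
      then have "measure lam (joint (cyls l S) (Suc j) n - \<Union>\<J>') \<le>
          measure lam ((joint (cyls l S) j n - \<Union>\<J>) \<union> ((\<Union>\<J> - cyl (n - m) R) \<union> (Q - \<Union>\<J>')))"
        using js Js Qs cyl_sets by (intro lam.finite_measure_mono) auto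
      also have "\<dots> \<le> measure lam (joint (cyls l S) j n - \<Union>\<J>) + (measure lam (\<Union>\<J> - cyl (n - m) R) + measure lam (Q - \<Union>\<J>'))"
        using js Js Qs cyl_sets by (intro order.trans[OF measure_Un_le] add_left_mono measure_Un_le) auto
      also have "\<dots> \<le> d1 + (c * d1 + d1)"
      proof (intro add_mono J(2) J'(3))
        have "measure lam (\<Union>\<J> - cyl (n - m) R) \<le> c * measure ?\<mu> (\<Union>\<J> - cyl (n - m) R)"
          using Js cyl_sets by (intro c(3)) auto
        also have "\<dots> \<le> c * d1" using R(2) c(1) by (intro mult_left_mono) auto
        finally show "measure lam (\<Union>\<J> - cyl (n - m) R) \<le> c * d1" .
      qed
      also have "\<dots> = (2 + c) * d1" by (simp add: algebra_simps)
      also have "\<dots> \<le> K * d1" using K d1 by (intro mult_right_mono) auto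
      finally have 1: "measure lam (joint (cyls l S) (Suc j) n - \<Union>\<J>') \<le> d" by (simp add: dK)
      define P where "P = (\<Prod>i\<le>j. measure (\<mu> i) (cyls l S i))"
      have R_le: "measure ?\<mu> (cyl (n - m) R) \<le> c * (C * P + d1)"
      proof -
        have "measure ?\<mu> (cyl (n - m) R) \<le> c * measure lam (cyl (n - m) R)" by (rule c(2)[OF cyl_sets])
        also have "\<dots> \<le> c * measure lam (\<Union>\<J>)"
          using R(1) Js c(1) by (intro mult_left_mono lam.finite_measure_mono) auto
        also have "\<dots> \<le> c * (C * P + d1)" using J(3) c(1) by (intro mult_left_mono) (auto simp: P_def)
        finally show ?thesis .
      qed
      have P0: "0 \<le> C * P + d1" using C d1 by (auto simp: P_def intro!: add_nonneg_nonneg mult_nonneg_nonneg prod_nonneg)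
      have nm: "1 \<le> n - m" "m + (n - m) = n" using elim(4) by auto
      have "measure ?\<mu> Q \<le> cB * measure ?\<mu> (cyl (n - m) R) * measure ?\<mu> ?A + b m"
        using B[OF nm(1) A, of R m] unfolding nm(2) Q_def .
      also have "\<dots> \<le> cB * (c * (C * P + d1)) * measure ?\<mu> ?A + d1"
        using m cB R_le by (intro add_mono mult_right_mono mult_left_mono) auto
      finally have Q_le: "measure ?\<mu> Q \<le> cB * (c * (C * P + d1)) * measure ?\<mu> ?A + d1" .
      have "measure lam (\<Union>\<J>') \<le> measure lam Q" using J'(2) Qs by (intro lam.finite_measure_mono)
      also have "\<dots> \<le> c * measure ?\<mu> Q" by (rule c(3)[OF Qs])
      also have "\<dots> \<le> c * (cB * (c * (C * P + d1)) * measure ?\<mu> ?A + d1)"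
        using Q_le c(1) by (intro mult_left_mono) auto
      also have "\<dots> = C' * (P * measure ?\<mu> ?A) + c * cB * c * d1 * measure ?\<mu> ?A + c * d1"
        by (simp add: C'_def algebra_simps)
      also have "\<dots> \<le> C' * (P * measure ?\<mu> ?A) + c * cB * c * d1 * 1 + (3 * c) * d1"
        using c(1) cB d1 by (intro add_mono[OF add_mono[OF order_refl]] mult_left_mono mult_right_mono) auto
      also have "\<dots> = C' * (P * measure ?\<mu> ?A) + K * d1" by (simp add: K_def algebra_simps)
      finally have 2: "measure lam (\<Union>\<J>') \<le> C' * (\<Prod>i\<le>Suc j. measure (\<mu> i) (cyls l S i)) + d"
        by (simp add: P_def dK)
      from J'(1) 1 2 show ?case by blast
    qed
  qed
  then have "names_bound (Suc j) C'" unfolding names_bound_def by blast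
  then show ?thesis using C' by blast
qed

lemma names_bound: "j \<le> k \<Longrightarrow> \<exists>C>0. names_bound j C"
  by (induction j) (use names_bound_0 names_bound_Suc Suc_leD in blast)+

end

section \<open>From names to Borel sets and to functions with finite range\<close>

lemma measurable_finite_range:
  assumes fin: "finite (f ` space M)" and sing: "\<And>y. f -` {y} \<inter> space M \<in> sets M"
  shows "f \<in> measurable M (count_space UNIV)"
proof (rule measurableI)
  fix A
  have "f -` A \<inter> space M = (\<Union>y\<in>A \<inter> f ` space M. f -` {y} \<inter> space M)" by blast
  also have "\<dots> \<in> sets M" using fin sing by (intro sets.finite_UN) auto
  finally show "f -` A \<inter> space M \<in> sets M" .
qed simp

lemma (in prob_space) integral_finite_range':
  fixes g :: "'c \<Rightarrow> real"
  assumes W: "finite W" "f ` space M \<subseteq> W" and sing: "\<And>y. y \<in> W \<Longrightarrow> f -` {y} \<inter> space M \<in> sets M"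
  shows "integrable M (\<lambda>x. g (f x))" "(\<integral>x. g (f x) \<partial>M) = (\<Sum>y\<in>W. point_mass M f y * g y)"
proof -
  have fin: "finite (f ` space M)" using W finite_subset by blast
  have sing': "f -` {y} \<inter> space M \<in> sets M" for y
  proof (cases "y \<in> W")
    case False
    then have "f -` {y} \<inter> space M = {}" using W(2) by blast
    then show ?thesis by simp
  qed (rule sing)
  note i = integral_finite_range[OF measurable_finite_range[OF fin sing'] fin, of g]
  show "integrable M (\<lambda>x. g (f x))" by (rule i(1))
  have "point_mass M f y = 0" if "y \<in> W - f ` space M" for y
  proof -
    have "f -` {y} \<inter> space M = {}" using that by blast
    then show ?thesis by (simp add: point_mass_def)
  qed
  then have "(\<Sum>y\<in>f ` space M. point_mass M f y * g y) = (\<Sum>y\<in>W. point_mass M f y * g y)"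
    using W by (intro sum.mono_neutral_left) auto
  then show "(\<integral>x. g (f x) \<partial>M) = (\<Sum>y\<in>W. point_mass M f y * g y)" using i(2) by simp
qed

context interval_maps
begin

lemma lam_le:
  obtains c where "1 \<le> c" "\<And>i A. i \<le> k \<Longrightarrow> A \<in> sets lam \<Longrightarrow> measure lam A \<le> c * measure (\<mu> i) A"
proof -
  have "\<forall>i\<in>{..k}. \<exists>c\<ge>1. \<forall>A\<in>sets lam. measure lam A \<le> c * measure (\<mu> i) A"
  proof
    fix i assume "i \<in> {..k}"
    then interpret interval_map "T i" "\<mu> i" "\<A> i" by (intro im) simp
    obtain c where "c \<ge> 1" "\<And>A. A \<in> sets lam \<Longrightarrow> measure lam A \<le> c * measure (\<mu> i) A"
      by (rule equiv_lam) blast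
    then show "\<exists>c\<ge>1. \<forall>A\<in>sets lam. measure lam A \<le> c * measure (\<mu> i) A" by blast
  qed
  from bchoice[OF this] obtain c where c: "\<And>i. i \<le> k \<Longrightarrow> 1 \<le> c i"
    "\<And>i A. i \<le> k \<Longrightarrow> A \<in> sets lam \<Longrightarrow> measure lam A \<le> c i * measure (\<mu> i) A" by auto
  have le: "c i \<le> (\<Sum>i\<le>k. c i)" if "i \<le> k" for i
    using that c(1) by (intro member_le_sum) (auto intro: order.trans[OF zero_le_one])
  show ?thesis
  proof (rule that)
    show "1 \<le> (\<Sum>i\<le>k. c i)" using le[of 0] c(1)[of 0] by simp
    show "measure lam A \<le> (\<Sum>i\<le>k. c i) * measure (\<mu> i) A" if "i \<le> k" "A \<in> sets lam" for i A
      using c(2)[OF that] mult_right_mono[OF le[OF that(1)], of "measure (\<mu> i) A"] by simp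
  qed
qed

text \<open>Each \<open>B i\<close> is replaced by a set of names. Since \<open>T i\<close>
  preserves its measure, the pulled back error set has the same measure at every time
  \<open>n\<close>, so the approximation is uniform in \<open>n\<close> and can be chosen before
  \<open>n\<close>.\<close>

lemma joint_bound:
  assumes ent_fin: "ks_entropy (\<mu> k) (T k) < \<infinity>"
  obtains C where "C > 0" "\<And>B d. (\<And>i. i \<le> k \<Longrightarrow> B i \<in> sets lam) \<Longrightarrow> 0 < d \<Longrightarrow>
    \<forall>\<^sub>F n in sequentially. measure lam (joint B k n) \<le> C * (\<Prod>i\<le>k. measure (\<mu> i) (B i)) + d"
proof -
  interpret lam: prob_space lam by (rule prob_space_lam)
  obtain C where C: "C > 0" "names_bound k C" using names_bound by blast
  obtain c where c: "1 \<le> c" "\<And>i A. i \<le> k \<Longrightarrow> A \<in> sets lam \<Longrightarrow> measure lam A \<le> c * measure (\<mu> i) A"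
    by (rule lam_le) blast
  obtain h where h: "ks_entropy (\<mu> k) (T k) < ereal h" using ereal_dense2[OF ent_fin] by auto
  have "\<forall>\<^sub>F n in sequentially. measure lam (joint B k n) \<le> C * (\<Prod>i\<le>k. measure (\<mu> i) (B i)) + d"
    if B: "\<And>i. i \<le> k \<Longrightarrow> B i \<in> sets lam" and d: "0 < d" for B d
  proof -
    \<comment> \<open>The total bound as a function of the approximation error \<open>e\<close>; it
      tends to the desired product as \<open>e\<close> tends to 0, which fixes the choice of
      \<open>e\<close>.\<close>
    let ?g = "\<lambda>e. C * (\<Prod>i\<le>k. measure (\<mu> i) (B i) + e) + 2 * e + real (Suc k) * (c * e)"
    have "(?g \<longlongrightarrow> ?g 0) (at_right 0)" by (intro tendsto_intros)
    then have "\<forall>\<^sub>F e in at_right 0. ?g e < C * (\<Prod>i\<le>k. measure (\<mu> i) (B i)) + d"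
      using d by (intro order_tendstoD(2)) auto
    moreover have "\<forall>\<^sub>F e in at_right (0::real). 0 < e" by (rule eventually_at_right_less)
    ultimately have "\<forall>\<^sub>F e in at_right 0. 0 < e \<and> ?g e < C * (\<Prod>i\<le>k. measure (\<mu> i) (B i)) + d"
      by eventually_elim simp
    then obtain e where e: "0 < e" "?g e < C * (\<Prod>i\<le>k. measure (\<mu> i) (B i)) + d"
      using eventually_happens'[OF trivial_limit_at_right_real] by blast
    have "\<forall>i\<in>{..k}. \<exists>mS. measure (\<mu> i) (sym_diff (B i) {x\<in>UI. name (T i) (icode (\<A> i)) (fst mS) x \<in> snd mS}) < e"
    proof
      fix i assume i: "i \<in> {..k}"
      then interpret interval_map "T i" "\<mu> i" "\<A> i" by (intro im) simp
      have "B i \<in> sets (\<mu> i)" using B i by (simp add: sets_\<mu>)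
      with e generating obtain m S where
        "measure (\<mu> i) (sym_diff (B i) {x\<in>UI. name (T i) (icode (\<A> i)) m x \<in> S}) < e"
        unfolding generating_def space_\<mu> by blast
      then show "\<exists>mS. measure (\<mu> i) (sym_diff (B i) {x\<in>UI. name (T i) (icode (\<A> i)) (fst mS) x \<in> snd mS}) < e"
        by (intro exI[of _ "(m, S)"]) simp
    qed
    from bchoice[OF this] obtain mS where mS: "\<And>i. i \<le> k \<Longrightarrow>
      measure (\<mu> i) (sym_diff (B i) {x\<in>UI. name (T i) (icode (\<A> i)) (fst (mS i)) x \<in> snd (mS i)}) < e" by auto
    define l S where "l = (\<lambda>i. fst (mS i))" and "S = (\<lambda>i. snd (mS i))"
    define D where "D = (\<lambda>i. sym_diff (B i) (cyls l S i))"
    have De: "measure (\<mu> i) (D i) < e" if "i \<le> k" for i using mS[OF that] by (simp add: D_def l_def S_def)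
    have cs: "cyls l S i \<in> sets lam" if "i \<le> k" for i by (rule interval_map.cyl_sets[OF im[OF that]])
    have Ds: "D i \<in> sets lam" if "i \<le> k" for i unfolding D_def using B cs that by auto
    have mle: "measure (\<mu> i) (cyls l S i) \<le> measure (\<mu> i) (B i) + e" if i: "i \<le> k" for i
    proof -
      interpret interval_map "T i" "\<mu> i" "\<A> i" by (rule im[OF i])
      have "measure (\<mu> i) (cyls l S i) \<le> measure (\<mu> i) (B i \<union> D i)"
        using B[OF i] Ds[OF i] by (intro finite_measure_mono) (auto simp: D_def sets_\<mu>)
      also have "\<dots> \<le> measure (\<mu> i) (B i) + measure (\<mu> i) (D i)"
        using B[OF i] Ds[OF i] by (intro measure_Un_le) (auto simp: sets_\<mu>)
      finally show ?thesis using De[OF i] by simp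
    qed
    show ?thesis
      using C(2)[unfolded names_bound_def, rule_format, OF h e(1), of l S]
    proof eventually_elim
      case (elim n)
      then obtain \<J> where J: "interval_family \<J> (exp (real n * h))" "measure lam (joint (cyls l S) k n - \<Union>\<J>) \<le> e"
        "measure lam (\<Union>\<J>) \<le> C * (\<Prod>i\<le>k. measure (\<mu> i) (cyls l S i)) + e" by blast
      let ?V = "\<lambda>i. {x\<in>UI. (T i ^^ n) x \<in> D i}"
      have Js: "\<Union>\<J> \<in> sets lam" using J(1) by (rule interval_family_sets)
      have js: "joint (cyls l S) k n \<in> sets lam" by (rule joint_sets) (use cs in auto)
      have Vs: "?V i \<in> sets lam" if "i \<in> {..k}" for i using that Ds by (intro vimage_sets) auto
      have sub: "joint B k n \<subseteq> (joint (cyls l S) k n - \<Union>\<J>) \<union> (\<Union>\<J> \<union> (\<Union>i\<in>{..k}. ?V i))"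
      proof
        fix x assume x: "x \<in> joint B k n"
        show "x \<in> (joint (cyls l S) k n - \<Union>\<J>) \<union> (\<Union>\<J> \<union> (\<Union>i\<in>{..k}. ?V i))"
        proof (cases "x \<in> (\<Union>i\<in>{..k}. ?V i)")
          case False
          have "(T i ^^ n) x \<in> cyls l S i" if "i \<le> k" for i
          proof -
            have "(T i ^^ n) x \<in> B i" "x \<in> UI" using x that by (simp_all add: joint_def)
            moreover have "(T i ^^ n) x \<notin> D i" using False that \<open>x \<in> UI\<close> by blast
            ultimately show ?thesis unfolding D_def by blast
          qed
          moreover have "x \<in> UI" using x by (simp add: joint_def)
          ultimately have "x \<in> joint (cyls l S) k n" unfolding joint_def by blast
          then show ?thesis by blast
        qed blast
      qed
      have "measure lam (joint B k n) \<le> measure lam ((joint (cyls l S) k n - \<Union>\<J>) \<union> (\<Union>\<J> \<union> (\<Union>i\<in>{..k}. ?V i)))"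
        using sub js Js Vs by (intro lam.finite_measure_mono) auto
      also have "\<dots> \<le> measure lam (joint (cyls l S) k n - \<Union>\<J>) + measure lam (\<Union>\<J> \<union> (\<Union>i\<in>{..k}. ?V i))"
        using js Js Vs by (intro measure_Un_le) auto
      also have "\<dots> \<le> measure lam (joint (cyls l S) k n - \<Union>\<J>) + (measure lam (\<Union>\<J>) + measure lam (\<Union>i\<in>{..k}. ?V i))"
        using Js Vs by (intro add_left_mono measure_Un_le) auto
      also have "\<dots> \<le> e + ((C * (\<Prod>i\<le>k. measure (\<mu> i) (B i) + e) + e) + real (Suc k) * (c * e))"
      proof (intro add_mono J(2))
        have "(\<Prod>i\<le>k. measure (\<mu> i) (cyls l S i)) \<le> (\<Prod>i\<le>k. measure (\<mu> i) (B i) + e)"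
          using mle by (intro prod_mono) auto
        then have "C * (\<Prod>i\<le>k. measure (\<mu> i) (cyls l S i)) \<le> C * (\<Prod>i\<le>k. measure (\<mu> i) (B i) + e)"
          using C(1) by (intro mult_left_mono) auto
        with J(3) show "measure lam (\<Union>\<J>) \<le> C * (\<Prod>i\<le>k. measure (\<mu> i) (B i) + e) + e" by linarith
        have "measure lam (\<Union>i\<in>{..k}. ?V i) \<le> (\<Sum>i\<in>{..k}. measure lam (?V i))"
          using Vs by (intro measure_UNION_le) auto
        also have "\<dots> \<le> (\<Sum>i\<in>{..k}. c * e)"
        proof (rule sum_mono)
          fix i assume i: "i \<in> {..k}"
          have "measure lam (?V i) \<le> c * measure (\<mu> i) (?V i)" using c(2)[OF _ Vs[OF i]] i by simp
          also have "measure (\<mu> i) (?V i) = measure (\<mu> i) (D i)" using i Ds by (intro measure_vimage) auto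
          also have "c * \<dots> \<le> c * e" using De[of i] i c(1) by (intro mult_left_mono) auto
          finally show "measure lam (?V i) \<le> c * e" .
        qed
        also have "\<dots> = real (Suc k) * (c * e)" by simp
        finally show "measure lam (\<Union>i\<in>{..k}. ?V i) \<le> real (Suc k) * (c * e)" .
      qed
      also have "\<dots> = ?g e" by simp
      finally show ?case using e(2) by simp
    qed
  qed
  then show ?thesis using that[OF C(1)] by blast
qed

text \<open>\<open>product_prob_space\<close> expects a probability measure at every index, so the
  family is padded by \<open>\<mu> 0\<close> beyond \<open>k\<close>.\<close>

definition \<mu>' :: "nat \<Rightarrow> real measure" where
  "\<mu>' i = (if i \<le> k then \<mu> i else \<mu> 0)"

lemma sets_\<mu>': "sets (\<mu>' i) = sets lam" and space_\<mu>': "space (\<mu>' i) = UI" and prob_\<mu>': "prob_space (\<mu>' i)"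
proof -
  have *: "sets (\<mu> i) = sets lam \<and> space (\<mu> i) = UI \<and> prob_space (\<mu> i)" if "i \<le> k" for i
  proof -
    interpret interval_map "T i" "\<mu> i" "\<A> i" by (rule im[OF that])
    show ?thesis using sets_\<mu> space_\<mu> prob_space_axioms by blast
  qed
  show "sets (\<mu>' i) = sets lam" "space (\<mu>' i) = UI" "prob_space (\<mu>' i)"
    using *[of i] *[of 0] by (auto simp: \<mu>'_def)
qed

sublocale PM: finite_product_prob_space \<mu>' "{0..k}"
proof -
  interpret product_prob_space \<mu>' "{0..k}" by (rule product_prob_spaceI[OF prob_\<mu>'])
  show "finite_product_prob_space \<mu>' {0..k}" by unfold_locales simp
qed

abbreviation "PM \<equiv> Pi\<^sub>M {0..k} \<mu>'"
abbreviation "TT \<equiv> (\<lambda>x. restrict (\<lambda>i. T i (x i)) {0..k})"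

lemma PM_eq: "PM = Pi\<^sub>M {0..k} \<mu>"
  by (intro PiM_cong) (auto simp: \<mu>'_def)

lemma TT_iter: "i \<le> k \<Longrightarrow> (TT ^^ n) x i = (T i ^^ n) (x i)"
  by (induction n arbitrary: x) (simp_all add: funpow_swap1 del: funpow.simps(2), simp_all)

text \<open>A function of finitely many code values is a combination of indicators of product sets,
  and \<open>g \<ge> 0\<close> lets the one-sided bound be summed over them.\<close>

lemma joint_code_bound:
  fixes \<rho> :: "nat \<Rightarrow> real \<Rightarrow> 'b" and g :: "(nat \<Rightarrow> 'b) \<Rightarrow> real"
  assumes C: "C > 0" "\<And>B d. (\<And>i. i \<le> k \<Longrightarrow> B i \<in> sets lam) \<Longrightarrow> 0 < d \<Longrightarrow>
    \<forall>\<^sub>F n in sequentially. measure lam (joint B k n) \<le> C * (\<Prod>i\<le>k. measure (\<mu> i) (B i)) + d"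
    and \<rho>: "\<And>i. i \<le> k \<Longrightarrow> finite (\<rho> i ` UI)" "\<And>i b. i \<le> k \<Longrightarrow> {x\<in>UI. \<rho> i x = b} \<in> sets lam"
    and g: "\<And>w. 0 \<le> g w" and d: "0 < d"
  shows "\<forall>\<^sub>F n in sequentially. (\<integral>x. g (restrict (\<lambda>i. \<rho> i ((T i ^^ n) x)) {0..k}) \<partial>lam)
    \<le> C * (\<integral>y. g (restrict (\<lambda>i. \<rho> i (y i)) {0..k}) \<partial>PM) + d"
proof -
  interpret lam: prob_space lam by (rule prob_space_lam)
  define W where "W = PiE {0..k} (\<lambda>i. \<rho> i ` UI)"
  have W: "finite W" unfolding W_def using \<rho>(1) by (intro finite_PiE) auto
  define B where "B = (\<lambda>w i. {x\<in>UI. \<rho> i x = w i})"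
  have B: "B w i \<in> sets lam" if "i \<le> k" for w i unfolding B_def by (rule \<rho>(2)[OF that])
  \<comment> \<open>The errors of all words, weighted by \<open>g\<close>, add up to at most
    \<open>d\<close>; the summand 1 keeps the denominator positive.\<close>
  define e where "e = d / (1 + (\<Sum>w\<in>W. g w))"
  have g0: "0 \<le> (\<Sum>w\<in>W. g w)" by (rule sum_nonneg) (rule g)
  have e: "0 < e" using g0 d by (simp add: e_def)
  have ge: "(\<Sum>w\<in>W. g w) * e \<le> d" using g0 d by (simp add: e_def field_simps)
  have eqP: "(\<integral>y. g (restrict (\<lambda>i. \<rho> i (y i)) {0..k}) \<partial>PM) = (\<Sum>w\<in>W. (\<Prod>i\<le>k. measure (\<mu> i) (B w i)) * g w)"
  proof -
    let ?f = "\<lambda>y. restrict (\<lambda>i. \<rho> i (y i)) {0..k}"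
    have pre: "?f -` {w} \<inter> space PM = PiE {0..k} (B w)" if w: "w \<in> W" for w
    proof (intro equalityI subsetI)
      fix y assume "y \<in> ?f -` {w} \<inter> space PM"
      then have y: "?f y = w" "y \<in> PiE {0..k} (\<lambda>_. UI)" by (simp_all add: space_PiM space_\<mu>')
      have "\<rho> i (y i) = w i" if "i \<in> {0..k}" for i using fun_cong[OF y(1), of i] that by simp
      with y(2) show "y \<in> PiE {0..k} (B w)" unfolding B_def PiE_iff by blast
    next
      fix y assume y: "y \<in> PiE {0..k} (B w)"
      have "?f y = w"
      proof (rule ext)
        fix i show "?f y i = w i"
          using y w PiE_arb[of w "{0..k}" _ i] by (cases "i \<in> {0..k}") (auto simp: B_def W_def PiE_iff)
      qed
      moreover have "y \<in> space PM" using y by (auto simp: space_PiM space_\<mu>' PiE_iff B_def)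
      ultimately show "y \<in> ?f -` {w} \<inter> space PM" by simp
    qed
    have "(\<integral>y. g (?f y) \<partial>PM) = (\<Sum>w\<in>W. point_mass PM ?f w * g w)"
    proof (rule PM.integral_finite_range'(2)[OF W])
      show "?f ` space PM \<subseteq> W" by (auto simp: W_def space_PiM space_\<mu>' PiE_iff)
      show "?f -` {w} \<inter> space PM \<in> sets PM" if "w \<in> W" for w
        unfolding pre[OF that] by (intro sets_PiM_I_finite) (auto simp: sets_\<mu>' B)
    qed
    also have "\<dots> = (\<Sum>w\<in>W. (\<Prod>i\<le>k. measure (\<mu> i) (B w i)) * g w)"
    proof (rule sum.cong[OF refl])
      fix w assume w: "w \<in> W"
      have "point_mass PM ?f w = measure PM (PiE {0..k} (B w))" by (simp add: point_mass_def pre[OF w])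
      also have "\<dots> = (\<Prod>i\<in>{0..k}. measure (\<mu>' i) (B w i))"
        by (rule PM.finite_measure_PiM_emb) (simp add: sets_\<mu>' B)
      also have "\<dots> = (\<Prod>i\<le>k. measure (\<mu> i) (B w i))"
        unfolding atLeast0AtMost by (intro prod.cong) (auto simp: \<mu>'_def)
      finally show "point_mass PM ?f w * g w = (\<Prod>i\<le>k. measure (\<mu> i) (B w i)) * g w" by simp
    qed
    finally show ?thesis .
  qed
  have eqL: "(\<integral>x. g (restrict (\<lambda>i. \<rho> i ((T i ^^ n) x)) {0..k}) \<partial>lam) = (\<Sum>w\<in>W. measure lam (joint (B w) k n) * g w)" for n
  proof -
    let ?f = "\<lambda>x. restrict (\<lambda>i. \<rho> i ((T i ^^ n) x)) {0..k}"
    have pre: "?f -` {w} \<inter> space lam = joint (B w) k n" if w: "w \<in> W" for w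
    proof (intro equalityI subsetI)
      fix x assume "x \<in> ?f -` {w} \<inter> space lam"
      then have x: "?f x = w" "x \<in> UI" by (simp_all add: space_lam)
      have "\<rho> i ((T i ^^ n) x) = w i" if "i \<le> k" for i using fun_cong[OF x(1), of i] that by simp
      with x(2) T_iter_UI show "x \<in> joint (B w) k n" unfolding B_def joint_def by blast
    next
      fix x assume x: "x \<in> joint (B w) k n"
      have "?f x = w"
      proof (rule ext)
        fix i show "?f x i = w i"
          using x w PiE_arb[of w "{0..k}" _ i] by (cases "i \<in> {0..k}") (auto simp: B_def W_def joint_def)
      qed
      moreover have "x \<in> UI" using x by (simp add: joint_def)
      ultimately show "x \<in> ?f -` {w} \<inter> space lam" by (simp add: space_lam)
    qed
    have "(\<integral>x. g (?f x) \<partial>lam) = (\<Sum>w\<in>W. point_mass lam ?f w * g w)"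
    proof (rule lam.integral_finite_range'(2)[OF W])
      show "?f ` space lam \<subseteq> W" using T_iter_UI by (auto simp: W_def space_lam PiE_iff)
      show "?f -` {w} \<inter> space lam \<in> sets lam" if "w \<in> W" for w
        unfolding pre[OF that] by (intro joint_sets B) auto
    qed
    then show ?thesis using pre by (simp add: point_mass_def)
  qed
  have "\<forall>w\<in>W. \<forall>\<^sub>F n in sequentially. measure lam (joint (B w) k n) \<le> C * (\<Prod>i\<le>k. measure (\<mu> i) (B w i)) + e"
    by (intro ballI C(2) B e)
  then have "\<forall>\<^sub>F n in sequentially. \<forall>w\<in>W. measure lam (joint (B w) k n) \<le> C * (\<Prod>i\<le>k. measure (\<mu> i) (B w i)) + e"
    using W by (simp add: eventually_ball_finite_distrib)
  then show ?thesis
  proof eventually_elim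
    case (elim n)
    have "(\<Sum>w\<in>W. measure lam (joint (B w) k n) * g w) \<le> (\<Sum>w\<in>W. (C * (\<Prod>i\<le>k. measure (\<mu> i) (B w i)) + e) * g w)"
      using elim g by (intro sum_mono mult_right_mono) auto
    also have "\<dots> = C * (\<Sum>w\<in>W. (\<Prod>i\<le>k. measure (\<mu> i) (B w i)) * g w) + (\<Sum>w\<in>W. g w) * e"
      by (simp add: distrib_right sum.distrib sum_distrib_left sum_distrib_right mult.assoc mult.commute[of e])
    finally show ?case unfolding eqP eqL using ge by linarith
  qed
qed

end

section \<open>Mean convergence\<close>

text \<open>Each further shift by one changes the sum by just two boundary terms.\<close>

lemma shifted_sum_diff:
  fixes u :: "nat \<Rightarrow> real"
  assumes bd: "\<And>n. \<bar>u n\<bar> \<le> U" and MN: "M \<le> N"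
  shows "\<bar>(\<Sum>n\<in>{M..<N}. u n) - (\<Sum>n\<in>{M..<N}. u (n + l))\<bar> \<le> 2 * real l * U"
proof (induction l)
  case (Suc l)
  have "(\<Sum>n\<in>{M..<N}. u (Suc n + l) - u (n + l)) = u (N + l) - u (M + l)"
    using MN by (rule sum_Suc_diff'[where f="\<lambda>n. u (n + l)"])
  then have "(\<Sum>n\<in>{M..<N}. u (n + l)) - (\<Sum>n\<in>{M..<N}. u (n + Suc l)) = u (M + l) - u (N + l)"
    by (simp add: sum_subtractf)
  with Suc bd[of "M + l"] bd[of "N + l"] show ?case by (simp add: algebra_simps)
qed simp

lemma abs_diff_diff_le: "\<bar>a - b\<bar> \<le> q \<Longrightarrow> \<bar>c - d\<bar> \<le> q \<Longrightarrow> \<bar>(a - c) - (b - d)\<bar> \<le> 2 * q" for a b c d q :: real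
  by linarith

lemma square_le_2_squares: "a\<^sup>2 \<le> 2 * b\<^sup>2 + 2 * (a - b)\<^sup>2" for a b :: real
  using zero_le_power2[of "a - 2 * b"] by (simp add: power2_eq_square algebra_simps)

text \<open>Convexity: the \<open>L\<^sup>2\<close> norm of a long average is controlled by the norms of the averages over
  windows of fixed length \<open>L\<close>, up to boundary terms.\<close>

lemma (in prob_space) averages_L2:
  fixes u :: "nat \<Rightarrow> 'a \<Rightarrow> real"
  assumes u[measurable]: "\<And>n. u n \<in> borel_measurable M" and bd: "\<And>n x. x \<in> space M \<Longrightarrow> \<bar>u n x\<bar> \<le> U"
    and c: "\<bar>c\<bar> \<le> U" and L: "1 \<le> L" and e: "0 < e"
    and ev: "\<forall>\<^sub>F n in sequentially. (\<integral>x. ((\<Sum>l<L. u (n + l) x) / real L - c)\<^sup>2 \<partial>M) \<le> e"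
  shows "\<exists>K0. \<forall>m n. m < n \<and> K0 \<le> n - m \<longrightarrow>
    (\<integral>x. ((\<Sum>j\<in>{m..<n}. u j x) / real (n - m) - c)\<^sup>2 \<partial>M) \<le> 4 * e"
proof -
  have U: "0 \<le> U" using c by linarith
  define v where "v = (\<lambda>n x. (\<Sum>l<L. u (n + l) x) / real L - c)"
  have v[measurable]: "v n \<in> borel_measurable M" for n unfolding v_def by measurable
  have vb: "\<bar>v n x\<bar> \<le> 2 * U" if "x \<in> space M" for n x
  proof -
    have "\<bar>\<Sum>l<L. u (n + l) x\<bar> \<le> (\<Sum>l<L. U)" by (rule order.trans[OF sum_abs]) (intro sum_mono bd that)
    then have "\<bar>(\<Sum>l<L. u (n + l) x) / real L\<bar> \<le> U" using L by (simp add: field_simps)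
    then show ?thesis using c unfolding v_def by linarith
  qed
  have v2b: "(v n x)\<^sup>2 \<le> 4 * U\<^sup>2" if "x \<in> space M" for n x
    using power_mono[OF vb[OF that], of n 2] by (simp add: power_mult_distrib)
  have iv: "integrable M (\<lambda>x. (v n x)\<^sup>2)" for n
    by (rule integrable_const_bound[of _ "4 * U\<^sup>2"]) (auto simp: v2b)
  have int4: "(\<integral>x. (v n x)\<^sup>2 \<partial>M) \<le> 4 * U\<^sup>2" for n
    using integral_mono[OF iv _ v2b, of n] prob_space by simp
  obtain n0 where n0: "\<And>n. n0 \<le> n \<Longrightarrow> (\<integral>x. (v n x)\<^sup>2 \<partial>M) \<le> e"
    using ev unfolding v_def eventually_sequentially by blast
  \<comment> \<open>At most \<open>n0\<close> windows of a block, wherever it begins, start before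
    \<open>n0\<close>, and for these only the trivial bound \<open>4 * U^2\<close> holds;
    \<open>K1\<close> makes their share at most \<open>e\<close>. \<open>K2\<close> does the same
    for the boundary error of the windows.\<close>
  obtain K1 :: nat where K1: "8 * U\<^sup>2 * real n0 / e \<le> real K1" using real_arch_simple by blast
  obtain K2 :: nat where K2: "8 * U\<^sup>2 * (real L)\<^sup>2 / e \<le> real K2" using real_arch_simple by blast
  show ?thesis
  proof (intro exI[of _ "max K1 K2"] allI impI)
    fix m n assume mn: "m < n \<and> max K1 K2 \<le> n - m"
    define K where "K = n - m"
    have K: "0 < K" "K1 \<le> K" "K2 \<le> K" using mn by (auto simp: K_def)
    define A where "A = (\<lambda>x. (\<Sum>j\<in>{m..<n}. u j x) / real K - c)"
    define B where "B = (\<lambda>x. (\<Sum>j\<in>{m..<n}. v j x) / real K)"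
    have AB: "\<bar>A x - B x\<bar> \<le> 2 * real L * U / real K" if x: "x \<in> space M" for x
    proof -
      have "(\<Sum>j\<in>{m..<n}. v j x) = (\<Sum>j\<in>{m..<n}. \<Sum>l<L. u (j + l) x) / real L - real K * c"
        by (simp add: v_def sum_subtractf sum_divide_distrib K_def)
      also have "(\<Sum>j\<in>{m..<n}. \<Sum>l<L. u (j + l) x) = (\<Sum>l<L. \<Sum>j\<in>{m..<n}. u (j + l) x)" by (rule sum.swap)
      finally have "A x - B x = ((\<Sum>j\<in>{m..<n}. u j x) - (\<Sum>l<L. \<Sum>j\<in>{m..<n}. u (j + l) x) / real L) / real K"
        using K by (simp add: A_def B_def diff_divide_distrib)
      also have "(\<Sum>j\<in>{m..<n}. u j x) - (\<Sum>l<L. \<Sum>j\<in>{m..<n}. u (j + l) x) / real L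
        = (\<Sum>l<L. (\<Sum>j\<in>{m..<n}. u j x) - (\<Sum>j\<in>{m..<n}. u (j + l) x)) / real L"
        using L by (simp add: sum_subtractf diff_divide_distrib)
      finally have eq: "A x - B x = (\<Sum>l<L. (\<Sum>j\<in>{m..<n}. u j x) - (\<Sum>j\<in>{m..<n}. u (j + l) x)) / real L / real K" .
      have "\<bar>\<Sum>l<L. (\<Sum>j\<in>{m..<n}. u j x) - (\<Sum>j\<in>{m..<n}. u (j + l) x)\<bar> \<le> (\<Sum>l<L. 2 * real L * U)"
      proof (rule order.trans[OF sum_abs sum_mono])
        fix l assume l: "l \<in> {..<L}"
        have "\<bar>(\<Sum>j\<in>{m..<n}. u j x) - (\<Sum>j\<in>{m..<n}. u (j + l) x)\<bar> \<le> 2 * real l * U"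
          using mn by (intro shifted_sum_diff bd x) simp
        also have "\<dots> \<le> 2 * real L * U" using l U by (intro mult_right_mono) auto
        finally show "\<bar>(\<Sum>j\<in>{m..<n}. u j x) - (\<Sum>j\<in>{m..<n}. u (j + l) x)\<bar> \<le> 2 * real L * U" .
      qed
      also have "\<dots> = real L * (2 * real L * U)" by simp
      finally have "\<bar>\<Sum>l<L. (\<Sum>j\<in>{m..<n}. u j x) - (\<Sum>j\<in>{m..<n}. u (j + l) x)\<bar> / real L \<le> 2 * real L * U"
        using L by (simp add: divide_le_eq mult.commute)
      from divide_right_mono[OF this, of "real K"] show ?thesis unfolding eq abs_divide by simp
    qed
    have B2: "(B x)\<^sup>2 \<le> (\<Sum>j\<in>{m..<n}. (v j x)\<^sup>2) / real K" for x
    proof -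
      have "(\<Sum>j\<in>{m..<n}. v j x)\<^sup>2 \<le> (\<Sum>j\<in>{m..<n}. (v j x)\<^sup>2) * real K"
        using sum_squared_le_sum_of_squares[of "\<lambda>j. v j x" "{m..<n}"] by (simp add: K_def)
      then have "(\<Sum>j\<in>{m..<n}. v j x)\<^sup>2 / (real K)\<^sup>2 \<le> (\<Sum>j\<in>{m..<n}. (v j x)\<^sup>2) * real K / (real K)\<^sup>2"
        by (intro divide_right_mono) auto
      then show ?thesis using K by (simp add: B_def power_divide power2_eq_square)
    qed
    have A2: "(A x)\<^sup>2 \<le> 2 * ((\<Sum>j\<in>{m..<n}. (v j x)\<^sup>2) / real K) + 2 * (2 * real L * U / real K)\<^sup>2" if "x \<in> space M" for x
      using square_le_2_squares[of "A x" "B x"] B2[of x] power_mono[OF AB[OF that], of 2] by simp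
    have "(\<integral>x. (A x)\<^sup>2 \<partial>M) \<le> (\<integral>x. 2 * ((\<Sum>j\<in>{m..<n}. (v j x)\<^sup>2) / real K) + 2 * (2 * real L * U / real K)\<^sup>2 \<partial>M)"
      by (intro integral_mono' A2) (auto intro!: Bochner_Integration.integrable_add integrable_mult_right integrable_divide Bochner_Integration.integrable_sum iv
        add_nonneg_nonneg divide_nonneg_nonneg mult_nonneg_nonneg sum_nonneg)
    also have "\<dots> = 2 * ((\<Sum>j\<in>{m..<n}. \<integral>x. (v j x)\<^sup>2 \<partial>M) / real K) + 2 * (2 * real L * U / real K)\<^sup>2"
      using prob_space iv by (subst Bochner_Integration.integral_add) auto
    also have "(\<Sum>j\<in>{m..<n}. \<integral>x. (v j x)\<^sup>2 \<partial>M) \<le> (\<Sum>j\<in>{m..<n}. (if j < n0 then 4 * U\<^sup>2 else 0) + e)"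
      using n0 int4 e by (intro sum_mono) (auto simp: not_less intro: add_increasing2)
    also have "\<dots> = real (card {j\<in>{m..<n}. j < n0}) * (4 * U\<^sup>2) + real K * e"
      by (simp add: sum.distrib sum.If_cases Int_def K_def)
    also have "\<dots> \<le> real n0 * (4 * U\<^sup>2) + real K * e"
    proof -
      have "card {j\<in>{m..<n}. j < n0} \<le> card {..<n0}" by (intro card_mono) auto
      then have "real (card {j\<in>{m..<n}. j < n0}) \<le> real n0" by simp
      then show ?thesis by (intro add_right_mono mult_right_mono) auto
    qed
    finally have main: "(\<integral>x. (A x)\<^sup>2 \<partial>M) \<le> 2 * ((real n0 * (4 * U\<^sup>2) + real K * e) / real K) + 2 * (2 * real L * U / real K)\<^sup>2"
      using K by (simp add: divide_right_mono)
    have 1: "8 * U\<^sup>2 * real n0 / real K \<le> e"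
    proof -
      have "8 * U\<^sup>2 * real n0 / e \<le> real K" using K1 K by linarith
      then show ?thesis using e K by (simp add: divide_le_eq mult.commute)
    qed
    have 2: "2 * (2 * real L * U / real K)\<^sup>2 \<le> e"
    proof -
      have "8 * U\<^sup>2 * (real L)\<^sup>2 / e \<le> real K" using K2 K by linarith
      also have "\<dots> \<le> (real K)\<^sup>2" using K by (simp add: power2_eq_square)
      finally have "8 * U\<^sup>2 * (real L)\<^sup>2 \<le> e * (real K)\<^sup>2" using e by (simp add: divide_le_eq mult.commute)
      then show ?thesis using K by (simp add: power_divide power_mult_distrib divide_le_eq mult_ac)
    qed
    have "2 * ((real n0 * (4 * U\<^sup>2) + real K * e) / real K) = 8 * U\<^sup>2 * real n0 / real K + 2 * e"
      using K by (simp add: add_divide_distrib)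
    with main 1 2 show "(\<integral>x. ((\<Sum>j\<in>{m..<n}. u j x) / real (n - m) - c)\<^sup>2 \<partial>M) \<le> 4 * e"
      unfolding A_def K_def by linarith
  qed
qed

text \<open>Values are clipped before being rounded down to multiples of \<open>h\<close>:
  \<open>f\<close> is bounded only almost everywhere, but the codes need a range that is finite at
  every point.\<close>

lemma floor_approx:
  fixes f :: "real \<Rightarrow> real"
  assumes f[measurable]: "f \<in> borel_measurable lam" and K: "0 \<le> K" "AE x in lam. \<bar>f x\<bar> \<le> K" and h: "0 < h"
  obtains f' where "f' \<in> borel_measurable lam" "finite (f' ` UI)" "AE x in lam. \<bar>f x - f' x\<bar> \<le> h" "\<And>x. \<bar>f' x\<bar> \<le> K + h"
proof -
  define t where "t = (\<lambda>x. max (- K) (min K (f x)))"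
  have t: "- K \<le> t x" "t x \<le> K" for x using K(1) by (auto simp: t_def)
  define f' where "f' = (\<lambda>x. h * of_int \<lfloor>t x / h\<rfloor>)"
  have close: "\<bar>t x - f' x\<bar> \<le> h" for x
  proof -
    have "of_int \<lfloor>t x / h\<rfloor> \<le> t x / h" "t x / h < of_int \<lfloor>t x / h\<rfloor> + 1" by linarith+
    then have "h * of_int \<lfloor>t x / h\<rfloor> \<le> t x" "t x < h * of_int \<lfloor>t x / h\<rfloor> + h"
      using h by (simp_all add: le_divide_eq divide_less_eq algebra_simps)
    then show ?thesis unfolding f'_def by linarith
  qed
  show ?thesis
  proof (rule that)
    show "f' \<in> borel_measurable lam" unfolding f'_def t_def by measurable
    have "f' ` UI \<subseteq> (\<lambda>i. h * of_int i) ` {\<lfloor>- K / h\<rfloor>..\<lfloor>K / h\<rfloor>}"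
    proof
      fix y assume "y \<in> f' ` UI"
      then obtain x where y: "y = h * of_int \<lfloor>t x / h\<rfloor>" by (auto simp: f'_def)
      have "- K / h \<le> t x / h" "t x / h \<le> K / h" using t[of x] h by (intro divide_right_mono; simp)+
      then have "\<lfloor>t x / h\<rfloor> \<in> {\<lfloor>- K / h\<rfloor>..\<lfloor>K / h\<rfloor>}" by (simp add: floor_mono)
      then show "y \<in> (\<lambda>i. h * of_int i) ` {\<lfloor>- K / h\<rfloor>..\<lfloor>K / h\<rfloor>}" using y by blast
    qed
    then show "finite (f' ` UI)" by (rule finite_subset) simp
    show "AE x in lam. \<bar>f x - f' x\<bar> \<le> h"
      using K(2)
    proof eventually_elim
      case (elim x)
      then have "t x = f x" by (auto simp: t_def)
      then show ?case using close[of x] by simp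
    qed
    show "\<bar>f' x\<bar> \<le> K + h" for x using close[of x] t[of x] by linarith
  qed
qed

text \<open>Dividing all factors by \<open>V\<close> makes them at most 1 in modulus, and then the
  difference of the products is at most the sum of the differences.\<close>

lemma prod_diff_bound:
  fixes a b :: "'i \<Rightarrow> real"
  assumes V: "1 \<le> V" and ab: "\<And>i. i \<in> I \<Longrightarrow> \<bar>a i\<bar> \<le> V" "\<And>i. i \<in> I \<Longrightarrow> \<bar>b i\<bar> \<le> V"
    "\<And>i. i \<in> I \<Longrightarrow> \<bar>a i - b i\<bar> \<le> h"
  shows "\<bar>(\<Prod>i\<in>I. a i) - (\<Prod>i\<in>I. b i)\<bar> \<le> V ^ card I * (real (card I) * h)"
proof -
  have "norm ((\<Prod>i\<in>I. a i / V) - (\<Prod>i\<in>I. b i / V)) \<le> (\<Sum>i\<in>I. norm (a i / V - b i / V))"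
    using V ab by (intro norm_prod_diff) (auto simp: divide_le_eq)
  also have "\<dots> \<le> (\<Sum>i\<in>I. h)"
  proof (rule sum_mono)
    fix i assume i: "i \<in> I"
    have "norm (a i / V - b i / V) = \<bar>a i - b i\<bar> / V" using V by (simp add: diff_divide_distrib[symmetric])
    also have "\<dots> \<le> \<bar>a i - b i\<bar> / 1" using V by (intro divide_left_mono) auto
    finally show "norm (a i / V - b i / V) \<le> h" using ab(3)[OF i] by simp
  qed
  finally have "\<bar>((\<Prod>i\<in>I. a i) - (\<Prod>i\<in>I. b i)) / V ^ card I\<bar> \<le> real (card I) * h"
    by (simp add: prod_dividef diff_divide_distrib)
  then show ?thesis using V by (simp add: abs_divide divide_le_eq mult.commute)
qed

lemma abs_prod_le:
  fixes a :: "'i \<Rightarrow> real"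
  assumes "\<And>i. i \<in> I \<Longrightarrow> \<bar>a i\<bar> \<le> V"
  shows "\<bar>\<Prod>i\<in>I. a i\<bar> \<le> V ^ card I"
proof -
  have "\<bar>\<Prod>i\<in>I. a i\<bar> \<le> (\<Prod>i\<in>I. V)" unfolding abs_prod using assms by (intro prod_mono) auto
  then show ?thesis by simp
qed

section \<open>Mean convergence with respect to Lebesgue measure\<close>

context interval_maps
begin

lemma measurable_iter_lam:
  assumes "i \<le> k" shows "T i ^^ n \<in> measurable lam lam"
proof -
  interpret interval_map "T i" "\<mu> i" "\<A> i" by (rule im[OF assms])
  show ?thesis using measurable_iter[of n] measurable_cong_sets[OF sets_\<mu> sets_\<mu>] by blast
qed

lemma AE_lam_iff: "i \<le> k \<Longrightarrow> (AE x in \<mu> i. P x) \<longleftrightarrow> (AE x in lam. P x)"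
proof -
  assume i: "i \<le> k"
  interpret interval_map "T i" "\<mu> i" "\<A> i" by (rule im[OF i])
  interpret lam: prob_space lam by (rule prob_space_lam)
  obtain c where c: "1 \<le> c" "\<And>i A. i \<le> k \<Longrightarrow> A \<in> sets lam \<Longrightarrow> measure lam A \<le> c * measure (\<mu> i) A"
    by (rule lam_le) blast
  have 1: "absolutely_continuous lam (\<mu> i)" unfolding absolutely_continuous_def using null_if_lam_null by blast
  have 2: "absolutely_continuous (\<mu> i) lam" unfolding absolutely_continuous_def
  proof
    fix A assume A: "A \<in> null_sets (\<mu> i)"
    then have As: "A \<in> sets lam" by (simp add: null_sets_def sets_\<mu>)
    have "measure (\<mu> i) A = 0" using A by (simp add: measure_eq_0_null_sets)
    then have "measure lam A = 0" using c(2)[OF i As] measure_nonneg[of lam A] by simp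
    then show "A \<in> null_sets lam" using As by (simp add: null_sets_def lam.emeasure_eq_measure)
  qed
  show ?thesis
    using absolutely_continuous_AE[OF sets_\<mu> 1, of P] absolutely_continuous_AE[OF sets_\<mu>[symmetric] 2, of P] by blast
qed

lemma AE_lam_iter:
  assumes i: "i \<le> k" and P: "AE x in lam. P x"
  shows "AE x in lam. \<forall>n. P ((T i ^^ n) x)"
proof -
  interpret interval_map "T i" "\<mu> i" "\<A> i" by (rule im[OF i])
  have "AE x in \<mu> i. P x" using P AE_lam_iff[OF i] by blast
  from AE_all_iter[OF this] show ?thesis using AE_lam_iff[OF i] by blast
qed

definition multi_prod :: "(nat \<Rightarrow> real \<Rightarrow> real) \<Rightarrow> nat \<Rightarrow> real \<Rightarrow> real" where
  "multi_prod f n x = (\<Prod>i\<in>{0..k}. f i ((T i ^^ n) x))"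

lemma measurable_multi_prod:
  assumes "\<And>i. i \<le> k \<Longrightarrow> f i \<in> borel_measurable lam"
  shows "multi_prod f n \<in> borel_measurable lam"
  unfolding multi_prod_def using assms
  by (intro borel_measurable_prod measurable_compose[OF measurable_iter_lam]) auto

lemma measurable_\<mu>:
  assumes "i \<le> k" "f \<in> borel_measurable lam"
  shows "f \<in> borel_measurable (\<mu> i)"
proof -
  interpret interval_map "T i" "\<mu> i" "\<A> i" by (rule im[OF assms(1)])
  show ?thesis using assms(2) measurable_cong_sets[OF sets_\<mu> refl] by blast
qed

text \<open>With finite ranges the window average is a function of finitely many codes, one for each
  map, so its squared distance to the limit is within reach of \<open>joint_code_bound\<close>. The
  same function on the product space is a Birkhoff average.\<close>

lemma L2_finite_valued:
  assumes ent_fin: "ks_entropy (\<mu> k) (T k) < \<infinity>" and prod_erg: "ergodic (Pi\<^sub>M {0..k} \<mu>) TT"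
    and f: "\<And>i. i \<le> k \<Longrightarrow> f i \<in> borel_measurable lam" and fin: "\<And>i. i \<le> k \<Longrightarrow> finite (f i ` UI)"
    and bd: "\<And>i x. i \<le> k \<Longrightarrow> \<bar>f i x\<bar> \<le> V" and e: "0 < e"
  shows "\<exists>K0. \<forall>m n. m < n \<and> K0 \<le> n - m \<longrightarrow>
    (\<integral>x. ((\<Sum>j\<in>{m..<n}. multi_prod f j x) / real (n - m) - (\<Prod>i\<in>{0..k}. \<integral>y. f i y \<partial>\<mu> i))\<^sup>2 \<partial>lam) \<le> e"
proof -
  interpret lam: prob_space lam by (rule prob_space_lam)
  interpret E: ergodic_mps PM TT
  proof -
    interpret mps PM TT by unfold_locales (use prod_erg in \<open>simp add: PM_eq ergodic_def\<close>)
    show "ergodic_mps PM TT" by unfold_locales (use prod_erg in \<open>simp add: PM_eq\<close>)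
  qed
  obtain C where C: "C > 0" "\<And>B d. (\<And>i. i \<le> k \<Longrightarrow> B i \<in> sets lam) \<Longrightarrow> 0 < d \<Longrightarrow>
    \<forall>\<^sub>F n in sequentially. measure lam (joint B k n) \<le> C * (\<Prod>i\<le>k. measure (\<mu> i) (B i)) + d"
    by (rule joint_bound[OF ent_fin]) blast
  define c where "c = (\<Prod>i\<in>{0..k}. \<integral>y. f i y \<partial>\<mu> i)"
  define F where "F = (\<lambda>y. \<Prod>i\<in>{0..k}. f i (y i))"
  define U where "U = V ^ Suc k"
  have f': "f i \<in> borel_measurable (\<mu>' i)" if "i \<le> k" for i
    using measurable_\<mu>[OF that f[OF that]] that by (simp add: \<mu>'_def)
  have F[measurable]: "F \<in> borel_measurable PM"
    unfolding F_def using f' by (intro borel_measurable_prod measurable_compose[OF measurable_component_singleton]) auto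
  have Fb: "\<bar>F y\<bar> \<le> U" for y unfolding F_def U_def using bd abs_prod_le[of "{0..k}" "\<lambda>i. f i (y i)" V] by simp
  have intF: "integral\<^sup>L PM F = c"
  proof -
    have "integral\<^sup>L PM F = (\<Prod>i\<in>{0..k}. integral\<^sup>L (\<mu>' i) (f i))" unfolding F_def
    proof (rule PM.product_integral_prod)
      fix i assume "i \<in> {0..k}"
      then have i: "i \<le> k" by simp
      show "integrable (\<mu>' i) (f i)"
        using f'[OF i] bd[OF i]
        by (intro finite_measure.integrable_const_bound[OF prob_space.axioms(1)[OF prob_\<mu>'], of _ V]) auto
    qed simp
    also have "\<dots> = c" unfolding c_def by (intro prod.cong) (auto simp: \<mu>'_def)
    finally show ?thesis .
  qed
  have cU: "\<bar>c\<bar> \<le> U"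
  proof -
    have "\<bar>integral\<^sup>L PM F\<bar> \<le> (\<integral>y. \<bar>F y\<bar> \<partial>PM)" by (rule integral_abs_bound)
    also have "\<dots> \<le> (\<integral>y. U \<partial>PM)"
      using Fb by (intro integral_mono) (auto intro!: PM.P.integrable_const_bound[of _ U])
    finally show ?thesis using intF PM.P.prob_space by simp
  qed
  have "(\<lambda>n. \<integral>y. (birkhoff_sum TT F n y / real n - c)\<^sup>2 \<partial>PM) \<longlonglongrightarrow> 0"
    using E.mean_ergodic_L2[OF F Fb] unfolding intF .
  \<comment> \<open>The key estimate multiplies this by \<open>C\<close> and adds another
    \<open>e / 8\<close>; \<open>averages_L2\<close> then multiplies the resulting
    \<open>e / 4\<close> by 4.\<close>
  from order_tendstoD(2)[OF this, of "e / 8 / C"]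
  have "\<forall>\<^sub>F n in sequentially. (\<integral>y. (birkhoff_sum TT F n y / real n - c)\<^sup>2 \<partial>PM) < e / 8 / C" using e C by simp
  then have "\<forall>\<^sub>F n in sequentially. 1 \<le> n \<and> (\<integral>y. (birkhoff_sum TT F n y / real n - c)\<^sup>2 \<partial>PM) < e / 8 / C"
    using eventually_ge_at_top[of 1] by eventually_elim simp
  then obtain L where L: "1 \<le> L" "(\<integral>y. (birkhoff_sum TT F L y / real L - c)\<^sup>2 \<partial>PM) < e / 8 / C"
    by (auto simp: eventually_sequentially)
  \<comment> \<open>The code of a point in coordinate \<open>i\<close> lists the values of
    \<open>f i\<close> along \<open>L\<close> steps of its orbit, so \<open>g\<close> can form the
    product at each time of the window.\<close>
  define \<rho> where "\<rho> = (\<lambda>i x. map (\<lambda>l. f i ((T i ^^ l) x)) [0..<L])"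
  define g where "g = (\<lambda>w. ((\<Sum>l<L. \<Prod>i\<in>{0..k}. w i ! l) / real L - c)\<^sup>2)"
  have \<rho>1: "finite (\<rho> i ` UI)" if i: "i \<le> k" for i
  proof (rule finite_subset)
    show "\<rho> i ` UI \<subseteq> {w. set w \<subseteq> f i ` UI \<and> length w = L}" using T_iter_UI[OF i] by (auto simp: \<rho>_def)
    show "finite {w. set w \<subseteq> f i ` UI \<and> length w = L}" by (rule finite_lists_length_eq[OF fin[OF i]])
  qed
  have \<rho>2: "{x\<in>UI. \<rho> i x = b} \<in> sets lam" if i: "i \<le> k" for i b
  proof (cases "length b = L")
    case True
    have [measurable]: "(\<lambda>x. f i ((T i ^^ l) x)) \<in> borel_measurable lam" for l
      by (rule measurable_compose[OF measurable_iter_lam[OF i] f[OF i]])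
    have "{x\<in>UI. \<rho> i x = b} = {x\<in>space lam. \<forall>l\<in>{..<L}. f i ((T i ^^ l) x) = b ! l}"
      using True by (auto simp: \<rho>_def space_lam list_eq_iff_nth_eq)
    also have "\<dots> \<in> sets lam" by measurable
    finally show ?thesis .
  next
    case False
    then have none: "{x\<in>UI. \<rho> i x = b} = {}" by (auto simp: \<rho>_def)
    show ?thesis unfolding none by simp
  qed
  have g_diag: "g (restrict (\<lambda>i. \<rho> i ((T i ^^ n) x)) {0..k}) = ((\<Sum>l<L. multi_prod f (n + l) x) / real L - c)\<^sup>2" for n x
  proof -
    have "(\<Sum>l<L. \<Prod>i\<in>{0..k}. restrict (\<lambda>i. \<rho> i ((T i ^^ n) x)) {0..k} i ! l) = (\<Sum>l<L. multi_prod f (n + l) x)"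
      unfolding multi_prod_def by (intro sum.cong prod.cong refl) (simp add: \<rho>_def funpow_add add.commute[of n])
    then show ?thesis by (simp add: g_def)
  qed
  have g_PM: "g (restrict (\<lambda>i. \<rho> i (y i)) {0..k}) = (birkhoff_sum TT F L y / real L - c)\<^sup>2" for y
  proof -
    have "(\<Sum>l<L. \<Prod>i\<in>{0..k}. restrict (\<lambda>i. \<rho> i (y i)) {0..k} i ! l) = birkhoff_sum TT F L y"
      unfolding birkhoff_sum_def F_def by (intro sum.cong prod.cong refl) (simp add: \<rho>_def TT_iter)
    then show ?thesis by (simp add: g_def)
  qed
  have "\<forall>\<^sub>F n in sequentially. (\<integral>x. g (restrict (\<lambda>i. \<rho> i ((T i ^^ n) x)) {0..k}) \<partial>lam)
    \<le> C * (\<integral>y. g (restrict (\<lambda>i. \<rho> i (y i)) {0..k}) \<partial>PM) + e / 8"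
    by (rule joint_code_bound[OF C \<rho>1 \<rho>2]) (use e in \<open>auto simp: g_def\<close>)
  then have ev: "\<forall>\<^sub>F n in sequentially. (\<integral>x. ((\<Sum>l<L. multi_prod f (n + l) x) / real L - c)\<^sup>2 \<partial>lam) \<le> e / 4"
  proof eventually_elim
    case (elim n)
    have "C * (\<integral>y. (birkhoff_sum TT F L y / real L - c)\<^sup>2 \<partial>PM) \<le> e / 8"
      using L(2) C(1) by (simp add: less_divide_eq mult.commute)
    with elim show ?case unfolding g_diag g_PM by linarith
  qed
  have "\<exists>K0. \<forall>m n. m < n \<and> K0 \<le> n - m \<longrightarrow>
    (\<integral>x. ((\<Sum>j\<in>{m..<n}. multi_prod f j x) / real (n - m) - c)\<^sup>2 \<partial>lam) \<le> 4 * (e / 4)"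
  proof (rule lam.averages_L2[OF _ _ cU L(1) _ ev])
    show "multi_prod f n \<in> borel_measurable lam" for n by (rule measurable_multi_prod[OF f])
    show "\<bar>multi_prod f n x\<bar> \<le> U" for n x unfolding multi_prod_def U_def
      using bd abs_prod_le[of "{0..k}" "\<lambda>i. f i ((T i ^^ n) x)" V] by simp
  qed (use e in simp)
  then show ?thesis unfolding c_def by simp
qed

text \<open>Approximating each \<open>f i\<close> uniformly almost everywhere changes all products,
  at all times and almost everywhere, by at most \<open>Q * h\<close>, because null sets have null
  preimages. The estimate is thus uniform in the block.\<close>

lemma L2_lam:
  assumes ent_fin: "ks_entropy (\<mu> k) (T k) < \<infinity>" and prod_erg: "ergodic (Pi\<^sub>M {0..k} \<mu>) TT"
    and f: "\<And>i. i \<le> k \<Longrightarrow> f i \<in> borel_measurable lam" and K: "1 \<le> K" "\<And>i. i \<le> k \<Longrightarrow> AE x in lam. \<bar>f i x\<bar> \<le> K"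
    and e: "0 < e"
  shows "\<exists>K0. \<forall>m n. m < n \<and> K0 \<le> n - m \<longrightarrow>
    (\<integral>x. ((\<Sum>j\<in>{m..<n}. multi_prod f j x) / real (n - m) - (\<Prod>i\<in>{0..k}. \<integral>y. f i y \<partial>\<mu> i))\<^sup>2 \<partial>lam) \<le> e"
proof -
  interpret lam: prob_space lam by (rule prob_space_lam)
  define V where "V = K + 1"
  have V: "1 \<le> V" using K by (simp add: V_def)
  define Q where "Q = V ^ Suc k * real (Suc k)"
  have Q: "0 < Q" using V by (simp add: Q_def)
  \<comment> \<open>The averages and the limits each move by at most \<open>Q * h\<close>, and
    \<open>2 * (2 * (Q * h))^2 \<le> e / 2\<close> is what the final estimate allows. The cap 1
    keeps the approximants below \<open>V = K + 1\<close>.\<close>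
  define h where "h = min 1 (sqrt (e / 16) / Q)"
  have h: "0 < h" "h \<le> 1" using e Q by (auto simp: h_def)
  have Qh: "(2 * (Q * h))\<^sup>2 \<le> e / 4"
  proof -
    have "Q * h \<le> sqrt (e / 16)" using Q by (simp add: h_def min_def field_simps)
    then have "(Q * h)\<^sup>2 \<le> (sqrt (e / 16))\<^sup>2" using Q h by (intro power_mono) auto
    then show ?thesis using e by (simp add: power_mult_distrib)
  qed
  have "\<forall>i\<in>{..k}. \<exists>f'. f' \<in> borel_measurable lam \<and> finite (f' ` UI) \<and> (AE x in lam. \<bar>f i x - f' x\<bar> \<le> h) \<and> (\<forall>x. \<bar>f' x\<bar> \<le> K + h)"
  proof
    fix i assume "i \<in> {..k}"
    then have i: "i \<le> k" by simp
    show "\<exists>f'. f' \<in> borel_measurable lam \<and> finite (f' ` UI) \<and> (AE x in lam. \<bar>f i x - f' x\<bar> \<le> h) \<and> (\<forall>x. \<bar>f' x\<bar> \<le> K + h)"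
      by (rule floor_approx[OF f[OF i] _ K(2)[OF i] h(1)]) (use K(1) in auto)
  qed
  from bchoice[OF this] obtain f' where f': "\<And>i. i \<le> k \<Longrightarrow> f' i \<in> borel_measurable lam" "\<And>i. i \<le> k \<Longrightarrow> finite (f' i ` UI)"
    "\<And>i. i \<le> k \<Longrightarrow> AE x in lam. \<bar>f i x - f' i x\<bar> \<le> h" "\<And>i x. i \<le> k \<Longrightarrow> \<bar>f' i x\<bar> \<le> K + h" by auto
  have f'V: "\<bar>f' i x\<bar> \<le> V" if "i \<le> k" for i x using f'(4)[OF that, of x] h by (simp add: V_def)
  define c where "c = (\<Prod>i\<in>{0..k}. \<integral>y. f i y \<partial>\<mu> i)"
  define c' where "c' = (\<Prod>i\<in>{0..k}. \<integral>y. f' i y \<partial>\<mu> i)"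
  have cc: "\<bar>c - c'\<bar> \<le> Q * h"
  proof -
    have *: "\<bar>integral\<^sup>L (\<mu> i) (f i)\<bar> \<le> V \<and> \<bar>integral\<^sup>L (\<mu> i) (f' i)\<bar> \<le> V \<and> \<bar>integral\<^sup>L (\<mu> i) (f i) - integral\<^sup>L (\<mu> i) (f' i)\<bar> \<le> h"
      if i: "i \<le> k" for i
    proof -
      interpret interval_map "T i" "\<mu> i" "\<A> i" by (rule im[OF i])
      have AEb: "AE x in \<mu> i. \<bar>f i x\<bar> \<le> K" "AE x in \<mu> i. \<bar>f i x - f' i x\<bar> \<le> h"
        using K(2)[OF i] f'(3)[OF i] AE_lam_iff[OF i] by blast+
      have m: "f i \<in> borel_measurable (\<mu> i)" "f' i \<in> borel_measurable (\<mu> i)"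
        using measurable_\<mu>[OF i] f[OF i] f'(1)[OF i] by blast+
      have I: "integrable (\<mu> i) (f i)" using m AEb by (intro integrable_const_bound[of _ K]) auto
      have I': "integrable (\<mu> i) (f' i)" using m f'V[OF i] by (intro integrable_const_bound[of _ V]) auto
      have le: "\<bar>integral\<^sup>L (\<mu> i) q\<bar> \<le> B" if "integrable (\<mu> i) q" "AE x in \<mu> i. \<bar>q x\<bar> \<le> B" for q :: "real \<Rightarrow> real" and B
      proof -
        have "\<bar>integral\<^sup>L (\<mu> i) q\<bar> \<le> (\<integral>x. \<bar>q x\<bar> \<partial>\<mu> i)" by (rule integral_abs_bound)
        also have "\<dots> \<le> (\<integral>x. B \<partial>\<mu> i)" using that by (intro integral_mono_AE) auto
        finally show ?thesis using prob_space by simp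
      qed
      have "\<bar>integral\<^sup>L (\<mu> i) (f i)\<bar> \<le> K" by (rule le[OF I AEb(1)])
      moreover have "\<bar>integral\<^sup>L (\<mu> i) (f' i)\<bar> \<le> V" using f'V[OF i] by (intro le[OF I']) auto
      moreover have "\<bar>\<integral>x. f i x - f' i x \<partial>\<mu> i\<bar> \<le> h"
        by (rule le[OF Bochner_Integration.integrable_diff[OF I I'] AEb(2)])
      ultimately show ?thesis using I I' by (simp add: V_def)
    qed
    have "\<bar>c - c'\<bar> \<le> V ^ card {0..k} * (real (card {0..k}) * h)"
      unfolding c_def c'_def using * by (intro prod_diff_bound V) auto
    then show ?thesis by (simp add: Q_def mult.assoc)
  qed
  have "AE x in lam. \<forall>i\<in>{..k}. (\<forall>n. \<bar>f i ((T i ^^ n) x)\<bar> \<le> K) \<and> (\<forall>n. \<bar>f i ((T i ^^ n) x) - f' i ((T i ^^ n) x)\<bar> \<le> h)"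
  proof (rule AE_finite_allI)
    fix i assume "i \<in> {..k}"
    then have i: "i \<le> k" by simp
    from AE_lam_iter[OF i K(2)[OF i]] AE_lam_iter[OF i f'(3)[OF i]]
    show "AE x in lam. (\<forall>n. \<bar>f i ((T i ^^ n) x)\<bar> \<le> K) \<and> (\<forall>n. \<bar>f i ((T i ^^ n) x) - f' i ((T i ^^ n) x)\<bar> \<le> h)"
      by eventually_elim blast
  qed simp
  then have close: "AE x in lam. \<forall>n. \<bar>multi_prod f n x - multi_prod f' n x\<bar> \<le> Q * h"
  proof eventually_elim
    case (elim x)
    have "\<bar>multi_prod f n x - multi_prod f' n x\<bar> \<le> V ^ card {0..k} * (real (card {0..k}) * h)" for n
      unfolding multi_prod_def using elim f'V by (intro prod_diff_bound V) (auto simp: V_def intro: order.trans[of _ K])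
    then show ?case by (simp add: Q_def mult.assoc)
  qed
  have "\<exists>K0. \<forall>m n. m < n \<and> K0 \<le> n - m \<longrightarrow>
    (\<integral>x. ((\<Sum>j\<in>{m..<n}. multi_prod f' j x) / real (n - m) - c')\<^sup>2 \<partial>lam) \<le> e / 4"
    unfolding c'_def
  proof (rule L2_finite_valued[OF ent_fin prod_erg])
    show "f' i \<in> borel_measurable lam" "finite (f' i ` UI)" "\<bar>f' i x\<bar> \<le> V" if "i \<le> k" for i x
      using f'(1,2)[OF that] f'V[OF that] by blast+
  qed (use e in simp)
  then obtain K0 where K0: "\<And>m n. m < n \<Longrightarrow> K0 \<le> n - m \<Longrightarrow>
    (\<integral>x. ((\<Sum>j\<in>{m..<n}. multi_prod f' j x) / real (n - m) - c')\<^sup>2 \<partial>lam) \<le> e / 4" by blast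
  show ?thesis
  proof (intro exI[of _ K0] allI impI)
    fix m n assume mn: "m < n \<and> K0 \<le> n - m"
    define A where "A = (\<lambda>x. (\<Sum>j\<in>{m..<n}. multi_prod f j x) / real (n - m) - c)"
    define A' where "A' = (\<lambda>x. (\<Sum>j\<in>{m..<n}. multi_prod f' j x) / real (n - m) - c')"
    have [measurable]: "multi_prod f j \<in> borel_measurable lam" "multi_prod f' j \<in> borel_measurable lam" for j
      by (intro measurable_multi_prod f f'(1); assumption)+
    have [measurable]: "A' \<in> borel_measurable lam" unfolding A'_def by measurable
    have AA: "AE x in lam. (A x)\<^sup>2 \<le> 2 * (A' x)\<^sup>2 + e / 2"
      using close
    proof eventually_elim
      case (elim x)
      have "\<bar>(\<Sum>j\<in>{m..<n}. multi_prod f j x) - (\<Sum>j\<in>{m..<n}. multi_prod f' j x)\<bar> \<le> (\<Sum>j\<in>{m..<n}. Q * h)"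
        unfolding sum_subtractf[symmetric] using elim by (intro order.trans[OF sum_abs] sum_mono) auto
      then have "\<bar>(\<Sum>j\<in>{m..<n}. multi_prod f j x) / real (n - m) - (\<Sum>j\<in>{m..<n}. multi_prod f' j x) / real (n - m)\<bar> \<le> Q * h"
        using mn by (simp add: diff_divide_distrib[symmetric] abs_divide divide_le_eq mult.commute)
      then have "\<bar>A x - A' x\<bar> \<le> 2 * (Q * h)" unfolding A_def A'_def by (rule abs_diff_diff_le[OF _ cc])
      from power_mono[OF this abs_ge_zero, of 2]
      have "(A x - A' x)\<^sup>2 \<le> (2 * (Q * h))\<^sup>2" by (simp only: power2_abs)
      with Qh square_le_2_squares[of "A x" "A' x"] show ?case by linarith
    qed
    have iA': "integrable lam (\<lambda>x. (A' x)\<^sup>2)"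
    proof (rule lam.integrable_const_bound[of _ "(V ^ Suc k + \<bar>c'\<bar>)\<^sup>2"])
      show "AE x in lam. norm ((A' x)\<^sup>2) \<le> (V ^ Suc k + \<bar>c'\<bar>)\<^sup>2"
      proof (rule AE_I2)
        fix x
        have "\<bar>multi_prod f' j x\<bar> \<le> V ^ Suc k" for j
          unfolding multi_prod_def using f'V abs_prod_le[of "{0..k}" "\<lambda>i. f' i ((T i ^^ j) x)" V] by simp
        then have "\<bar>\<Sum>j\<in>{m..<n}. multi_prod f' j x\<bar> \<le> (\<Sum>j\<in>{m..<n}. V ^ Suc k)"
          by (intro order.trans[OF sum_abs] sum_mono)
        then have "\<bar>(\<Sum>j\<in>{m..<n}. multi_prod f' j x) / real (n - m)\<bar> \<le> V ^ Suc k"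
          using mn by (simp add: abs_divide divide_le_eq mult.commute)
        then have "\<bar>A' x\<bar> \<le> V ^ Suc k + \<bar>c'\<bar>" unfolding A'_def
          by (intro order.trans[OF abs_triangle_ineq4] add_right_mono)
        then show "norm ((A' x)\<^sup>2) \<le> (V ^ Suc k + \<bar>c'\<bar>)\<^sup>2" using power_mono[OF _ abs_ge_zero, of "A' x" _ 2] by simp
      qed
    qed measurable
    have "(\<integral>x. (A x)\<^sup>2 \<partial>lam) \<le> (\<integral>x. 2 * (A' x)\<^sup>2 + e / 2 \<partial>lam)"
      using iA' e by (intro integral_mono_AE' AA) auto
    also have "\<dots> = 2 * (\<integral>x. (A' x)\<^sup>2 \<partial>lam) + e / 2"
      using iA' lam.prob_space by (subst Bochner_Integration.integral_add) auto
    also have "\<dots> \<le> e" using K0[of m n] mn unfolding A'_def by simp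
    finally show "(\<integral>x. ((\<Sum>j\<in>{m..<n}. multi_prod f j x) / real (n - m) - (\<Prod>i\<in>{0..k}. \<integral>y. f i y \<partial>\<mu> i))\<^sup>2 \<partial>lam) \<le> e"
      unfolding A_def c_def .
  qed
qed

end

text \<open>The density of \<open>\<nu>\<close> may be unbounded, so the convergence of integrals
  does not transfer directly. Almost everywhere convergence along a subsequence does, and the common
  bound turns it back into convergence of integrals by dominated convergence.\<close>

lemma L2_subseq_change_measure:
  fixes A :: "nat \<Rightarrow> 'a \<Rightarrow> real"
  assumes N: "prob_space N" and \<nu>: "prob_space \<nu>" "sets \<nu> = sets N" "absolutely_continuous N \<nu>"
    and A[measurable]: "\<And>n. A n \<in> borel_measurable N" and bd: "\<And>n. AE x in N. \<bar>A n x\<bar> \<le> B"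
    and lim: "(\<lambda>n. \<integral>x. (A n x)\<^sup>2 \<partial>N) \<longlonglongrightarrow> 0"
  obtains r :: "nat \<Rightarrow> nat" where "(\<lambda>n. \<integral>\<^sup>+x. ennreal ((A (r n) x)\<^sup>2) \<partial>\<nu>) \<longlonglongrightarrow> 0"
proof -
  interpret N: prob_space N by (rule N)
  interpret \<nu>: prob_space \<nu> by (rule \<nu>)
  have bd2: "AE x in N. norm ((A n x)\<^sup>2) \<le> B\<^sup>2" for n
    using bd[of n]
  proof eventually_elim
    case (elim x)
    then show ?case using power_mono[OF elim, of 2] by simp
  qed
  have iN: "integrable N (\<lambda>x. (A n x)\<^sup>2)" for n
    by (rule N.integrable_const_bound[OF bd2]) measurable
  obtain r :: "nat \<Rightarrow> nat" where r: "AE x in N. (\<lambda>n. (A (r n) x)\<^sup>2) \<longlonglongrightarrow> 0"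
    using tendsto_L1_AE_subseq[where u = "\<lambda>n x. (A n x)\<^sup>2", OF iN] lim by auto
  have r\<nu>: "AE x in \<nu>. (\<lambda>n. (A (r n) x)\<^sup>2) \<longlonglongrightarrow> 0" by (rule absolutely_continuous_AE[OF \<nu>(2,3) r])
  have bd\<nu>: "AE x in \<nu>. norm ((A n x)\<^sup>2) \<le> B\<^sup>2" for n by (rule absolutely_continuous_AE[OF \<nu>(2,3) bd2])
  have m\<nu>[measurable]: "A n \<in> borel_measurable \<nu>" for n using A measurable_cong_sets[OF \<nu>(2) refl] by blast
  have i\<nu>: "integrable \<nu> (\<lambda>x. (A n x)\<^sup>2)" for n
    by (rule \<nu>.integrable_const_bound[OF bd\<nu>]) measurable
  have "(\<lambda>n. \<integral>x. (A (r n) x)\<^sup>2 \<partial>\<nu>) \<longlonglongrightarrow> (\<integral>x. 0 \<partial>\<nu>)"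
    by (rule integral_dominated_convergence[where w="\<lambda>_. B\<^sup>2"]) (use r\<nu> bd\<nu> in auto)
  then have "(\<lambda>n. ennreal (\<integral>x. (A (r n) x)\<^sup>2 \<partial>\<nu>)) \<longlonglongrightarrow> ennreal 0"
    by (intro tendsto_ennrealI) simp
  moreover have "(\<integral>\<^sup>+x. ennreal ((A (r n) x)\<^sup>2) \<partial>\<nu>) = ennreal (\<integral>x. (A (r n) x)\<^sup>2 \<partial>\<nu>)" for n
    by (rule nn_integral_eq_integral[OF i\<nu>]) simp
  ultimately show ?thesis using that[of r] by simp
qed

theorem theorem5p1:
  fixes k :: nat and T :: "nat \<Rightarrow> real \<Rightarrow> real" and \<mu> :: "nat \<Rightarrow> real measure"
    and \<A> :: "nat \<Rightarrow> real set set"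
  assumes measures: "\<forall>i\<le>k. unit_prob (\<mu> i)"
    and mp_erg: "\<forall>i\<le>k. T i ` UI \<subseteq> UI \<and> mpt (\<mu> i) (T i) \<and> ergodic (\<mu> i) (T i)"
    and classT: "\<forall>i\<le>k. class_T (T i) (\<mu> i) (\<A> i)"
    and propB: "\<forall>i\<in>{1..k}. property_B (T i) (\<mu> i) (\<A> i)"
    and ent0: "0 \<le> ks_entropy (\<mu> 0) (T 0)"
    and ent_mono: "\<forall>i<k. ks_entropy (\<mu> i) (T i) < ks_entropy (\<mu> (Suc i)) (T (Suc i))"
    and ent_fin: "ks_entropy (\<mu> k) (T k) < \<infinity>"
    and prod_erg: "ergodic (PiM {0..k} \<mu>) (\<lambda>x. restrict (\<lambda>i. T i (x i)) {0..k})"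
  shows "\<forall>\<nu> f. prob_space \<nu> \<and> sets \<nu> = sets lam \<and>
            (\<forall>A\<in>sets lam. emeasure \<nu> A = 0 \<longleftrightarrow> emeasure lam A = 0) \<and>
            (\<forall>i\<le>k. Linf (f i)) \<longrightarrow>
          (\<forall>\<epsilon>>0. \<exists>L. \<forall>M N. M < N \<and> N - M \<ge> L \<longrightarrow>
             (\<integral>\<^sup>+ x. ennreal (((1 / real (N - M)) *
                 (\<Sum>n\<in>{M..<N}. \<Prod>i\<in>{0..k}. f i ((T i ^^ n) x))
               - (\<Prod>i\<in>{0..k}. \<integral>y. f i y \<partial>\<mu> i)) ^ 2) \<partial>\<nu>) < ennreal \<epsilon>)"
proof (intro allI impI, elim conjE, rule ccontr)
  fix \<nu> f and \<epsilon> :: real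
  assume \<nu>: "prob_space \<nu>" "sets \<nu> = sets lam" "\<forall>A\<in>sets lam. emeasure \<nu> A = 0 \<longleftrightarrow> emeasure lam A = 0"
    and Linf: "\<forall>i\<le>k. Linf (f i)" and \<epsilon>: "0 < \<epsilon>"
    and neg: "\<not> (\<exists>L. \<forall>M N. M < N \<and> N - M \<ge> L \<longrightarrow>
             (\<integral>\<^sup>+ x. ennreal (((1 / real (N - M)) *
                 (\<Sum>n\<in>{M..<N}. \<Prod>i\<in>{0..k}. f i ((T i ^^ n) x))
               - (\<Prod>i\<in>{0..k}. \<integral>y. f i y \<partial>\<mu> i)) ^ 2) \<partial>\<nu>) < ennreal \<epsilon>)"
  interpret interval_maps k T \<mu> \<A>
    using classT propB ent0 ent_mono by unfold_locales simp_all
  interpret lam: prob_space lam by (rule prob_space_lam)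
  have fm: "f i \<in> borel_measurable lam" if "i \<le> k" for i using Linf that by (simp add: Linf_def)
  have "\<forall>i\<in>{..k}. \<exists>C. AE x in lam. \<bar>f i x\<bar> \<le> C" using Linf by (simp add: Linf_def)
  from bchoice[OF this] obtain C where C: "\<And>i. i \<le> k \<Longrightarrow> AE x in lam. \<bar>f i x\<bar> \<le> C i" by auto
  define K where "K = 1 + (\<Sum>i\<le>k. \<bar>C i\<bar>)"
  have K1: "1 \<le> K" by (simp add: K_def sum_nonneg)
  have fK: "AE x in lam. \<bar>f i x\<bar> \<le> K" if i: "i \<le> k" for i
  proof -
    have "\<bar>C i\<bar> \<le> (\<Sum>i\<le>k. \<bar>C i\<bar>)" using i by (intro member_le_sum) auto
    then have "C i \<le> K" unfolding K_def by linarith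
    show ?thesis
      using C[OF i]
    proof eventually_elim
      case (elim x)
      then show ?case using \<open>C i \<le> K\<close> by linarith
    qed
  qed
  define c where "c = (\<Prod>i\<in>{0..k}. \<integral>y. f i y \<partial>\<mu> i)"
  define avg where "avg = (\<lambda>m n x. (\<Sum>j\<in>{m..<n}. multi_prod f j x) / real (n - m) - c)"
  have avg_eq: "1 / real (n - m) * (\<Sum>j\<in>{m..<n}. \<Prod>i\<in>{0..k}. f i ((T i ^^ j) x))
      - (\<Prod>i\<in>{0..k}. \<integral>y. f i y \<partial>\<mu> i) = avg m n x" for m n x
    by (simp add: avg_def multi_prod_def c_def)
  \<comment> \<open>If uniform convergence fails, each \<open>L\<close> yields a block of length at
    least \<open>L\<close> whose average stays \<open>\<epsilon>\<close> away from the limit under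
    \<open>\<nu>\<close>. Along these blocks the averages converge under \<open>lam\<close>, hence
    under \<open>\<nu>\<close> along a subsequence, a contradiction.\<close>
  from neg have "\<forall>L. \<exists>p. fst p < snd p \<and> L \<le> snd p - fst p \<and>
      ennreal \<epsilon> \<le> (\<integral>\<^sup>+x. ennreal ((avg (fst p) (snd p) x)\<^sup>2) \<partial>\<nu>)"
    unfolding avg_eq by (simp add: not_less)
  from choice[OF this] obtain p where p: "\<And>L. fst (p L) < snd (p L)" "\<And>L. L \<le> snd (p L) - fst (p L)"
    "\<And>L. ennreal \<epsilon> \<le> (\<integral>\<^sup>+x. ennreal ((avg (fst (p L)) (snd (p L)) x)\<^sup>2) \<partial>\<nu>)" by auto
  define A where "A = (\<lambda>L. avg (fst (p L)) (snd (p L)))"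
  have ac: "absolutely_continuous lam \<nu>"
    unfolding absolutely_continuous_def using \<nu> by (auto simp: null_sets_def)
  have [measurable]: "multi_prod f j \<in> borel_measurable lam" for j by (rule measurable_multi_prod[OF fm])
  have Am: "A L \<in> borel_measurable lam" for L unfolding A_def avg_def by measurable
  have "AE x in lam. \<forall>i\<in>{..k}. \<forall>n. \<bar>f i ((T i ^^ n) x)\<bar> \<le> K"
    by (rule AE_finite_allI) (use AE_lam_iter[OF _ fK] in auto)
  then have Ab: "AE x in lam. \<bar>A L x\<bar> \<le> K ^ Suc k + \<bar>c\<bar>" for L
  proof eventually_elim
    case (elim x)
    have "\<bar>multi_prod f j x\<bar> \<le> K ^ Suc k" for j
      unfolding multi_prod_def using elim abs_prod_le[of "{0..k}" "\<lambda>i. f i ((T i ^^ j) x)" K] by simp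
    then have "\<bar>\<Sum>j\<in>{fst (p L)..<snd (p L)}. multi_prod f j x\<bar> \<le> (\<Sum>j\<in>{fst (p L)..<snd (p L)}. K ^ Suc k)"
      by (intro order.trans[OF sum_abs] sum_mono)
    then have "\<bar>(\<Sum>j\<in>{fst (p L)..<snd (p L)}. multi_prod f j x) / real (snd (p L) - fst (p L))\<bar> \<le> K ^ Suc k"
      using p(1)[of L] by (simp add: abs_divide divide_le_eq mult.commute)
    then show ?case unfolding A_def avg_def by (intro order.trans[OF abs_triangle_ineq4] add_right_mono)
  qed
  have "(\<lambda>L. \<integral>x. (A L x)\<^sup>2 \<partial>lam) \<longlonglongrightarrow> 0"
  proof (rule LIMSEQ_I)
    fix e :: real assume e: "0 < e"
    have "\<exists>K0. \<forall>m n. m < n \<and> K0 \<le> n - m \<longrightarrow> (\<integral>x. (avg m n x)\<^sup>2 \<partial>lam) \<le> e / 2"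
      unfolding avg_def c_def by (rule L2_lam[OF ent_fin prod_erg _ K1]) (use e in \<open>auto intro: fm fK\<close>)
    then obtain K0 where K0: "\<And>m n. m < n \<Longrightarrow> K0 \<le> n - m \<Longrightarrow> (\<integral>x. (avg m n x)\<^sup>2 \<partial>lam) \<le> e / 2" by blast
    show "\<exists>L0. \<forall>L\<ge>L0. norm ((\<integral>x. (A L x)\<^sup>2 \<partial>lam) - 0) < e"
    proof (intro exI[of _ K0] allI impI)
      fix L assume "K0 \<le> L"
      then have "(\<integral>x. (A L x)\<^sup>2 \<partial>lam) \<le> e / 2" unfolding A_def using p(1,2)[of L] by (intro K0) auto
      moreover have "0 \<le> (\<integral>x. (A L x)\<^sup>2 \<partial>lam)" by (rule Bochner_Integration.integral_nonneg) simp
      ultimately show "norm ((\<integral>x. (A L x)\<^sup>2 \<partial>lam) - 0) < e" using e by simp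
    qed
  qed
  then obtain r :: "nat \<Rightarrow> nat" where "(\<lambda>n. \<integral>\<^sup>+x. ennreal ((A (r n) x)\<^sup>2) \<partial>\<nu>) \<longlonglongrightarrow> 0"
    by (rule L2_subseq_change_measure[OF prob_space_lam \<nu>(1,2) ac Am Ab])
  then have "ennreal \<epsilon> \<le> 0"
    using p(3) unfolding A_def by (intro LIMSEQ_le_const) auto
  then show False using \<epsilon> by simp
qed

end
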